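(* Suppose that the $\mathbb Z$-valued random variable $\kappa$ satisfies $\mathbb E[e^{\lambda|\kappa|}]<\infty$ for some $\lambda>0$. Let $(\tilde Z_k)_{k\in\mathbb Z_+}$ be the embedded process of the noisy simple harmonic urn with noise $\kappa$. Then the process $\tilde Z_k$ is: (i) transient if $\mathbb E[\kappa]<1/3$; (ii) null-recurrent if $1/3\le\mathbb E[\kappa]\le 2/3$; (iii) positive-recurrent if $\mathbb E[\kappa]>2/3$.
   Context: $\mathbb Z_+=\{0,1,2,\dots\}$, $\mathbb N=\{1,2,\dots\}$, and $\operatorname{sgn}(x)=-1,0,1$ according as $x<0$, $x=0$, $x>0$. Let $\kappa,\kappa_1,\kappa_2,\dots$ be i.i.d. $\mathbb Z$-valued random variables. The noisy simple harmonic urn is the Markov chain $(\tilde X_n,\tilde Y_n)_{n\in\mathbb Z_+}$ on $\mathbb Z^2\setminus\{(0,0)\}$ with $(\tilde X_0,\tilde Y_0)=(z_0,1)$, $z_0\in\mathbb N$, and the following transition law, where $\kappa_n$ is independent of all other randomness up to time $n$. Given $(\tilde X_n,\tilde Y_n)=(x,y)$ with $xy\neq0$, $$(\tilde X_{n+1},\tilde Y_{n+1})=\begin{cases}(x,y+\operatorname{sgn}(x)) & \text{with probability } \frac{|x|}{|x|+|y|},\\ (x-\operatorname{sgn}(y),y) & \text{with probability } \frac{|y|}{|x|+|y|};\end{cases}$$ if $x=0$, then $(\tilde X_{n+1},\tilde Y_{n+1})=(-\operatorname{sgn}(y),\ \operatorname{sgn}(y)\max(1,|y|-\kappa_n))$;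 if $y=0$, then $(\tilde X_{n+1},\tilde Y_{n+1})=(\operatorname{sgn}(x)\max(1,|x|-\kappa_n),\ \operatorname{sgn}(x))$. Set $\tilde\nu_0=-1$ and $\tilde\nu_k=\min\{n>\tilde\nu_{k-1}:\tilde X_n\tilde Y_n=0\}$ for $k\in\mathbb N$. Set $\tilde Z_0=z_0$ and, for $k\in\mathbb N$, $\tilde Z_k=\max\{|\tilde X_{1+\tilde\nu_k}|,|\tilde Y_{1+\tilde\nu_k}|\}=|\tilde X_{1+\tilde\nu_k}|+|\tilde Y_{1+\tilde\nu_k}|-1$; $(\tilde Z_k)$ is a Markov chain on $\mathbb N$. Transient means that almost surely $\tilde Z_k\to\infty$; null-recurrent and positive-recurrent have their usual meaning for irreducible Markov chains on a countable state space (return times to the state $1$ almost surely finite, with infinite, respectively finite, mean). *)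

theory Defs
  imports "HOL-Probability.Probability"
begin

text \<open>
  \<open>S\<close> is a time-homogeneous Markov chain on a countable state space, started at \<open>s0\<close>,
  with transition kernel \<open>K\<close>.
\<close>

definition markov_chain ::
  "'a measure \<Rightarrow> ('s::countable \<Rightarrow> 's pmf) \<Rightarrow> 's \<Rightarrow> (nat \<Rightarrow> 'a \<Rightarrow> 's) \<Rightarrow> bool" where
  "markov_chain M K s0 S \<longleftrightarrow>
     prob_space M \<and>
     (\<forall>n. S n \<in> measurable M (count_space UNIV)) \<and>
     (AE \<omega> in M. S 0 \<omega> = s0) \<and>
     (\<forall>n s t. \<P>(\<omega> in M. \<forall>i\<le>n. S i \<omega> = s i) > 0 \<longrightarrow>
        \<P>(\<omega> in M. S (Suc n) \<omega> = t \<bar> \<forall>i\<le>n. S i \<omega> = s i) = pmf (K (s n)) t)"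

text \<open>
  One step of the noisy simple harmonic urn, where \<open>\<kappa>\<close> is the law of the noise. On the axes,
  a fresh independent copy of the noise is used, so the new state has the image law of \<open>\<kappa>\<close>.
  The origin is not a state of the chain: it is never reached from any other state, and
  the first axis clause happens to make it absorbing.
\<close>

definition urn_kernel :: "int pmf \<Rightarrow> int \<times> int \<Rightarrow> (int \<times> int) pmf" where
  "urn_kernel \<kappa> = (\<lambda>(x, y).
     if x = 0 then map_pmf (\<lambda>k. (- sgn y, sgn y * max 1 (\<bar>y\<bar> - k))) \<kappa>
     else if y = 0 then map_pmf (\<lambda>k. (sgn x * max 1 (\<bar>x\<bar> - k), sgn x)) \<kappa>
     else map_pmf (\<lambda>b. if b then (x, y + sgn x) else (x - sgn y, y))
            (bernoulli_pmf (real_of_int \<bar>x\<bar> / real_of_int (\<bar>x\<bar> + \<bar>y\<bar>))))"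

definition noisy_urn ::
  "'a measure \<Rightarrow> int pmf \<Rightarrow> nat \<Rightarrow> (nat \<Rightarrow> 'a \<Rightarrow> int \<times> int) \<Rightarrow> bool" where
  "noisy_urn M \<kappa> z0 S \<longleftrightarrow> markov_chain M (urn_kernel \<kappa>) (int z0, 1) S"

text \<open>
  Axis-hitting times of a path. If a path stops hitting the axes, \<open>LEAST\<close> returns an
  arbitrary number; for the urn this happens with probability zero.
\<close>

primrec urn_nu :: "(nat \<Rightarrow> int \<times> int) \<Rightarrow> nat \<Rightarrow> int" where
  "urn_nu p 0 = -1"
| "urn_nu p (Suc k) = int (LEAST n. int n > urn_nu p k \<and> fst (p n) * snd (p n) = 0)"

definition urn_Z :: "(nat \<Rightarrow> int \<times> int) \<Rightarrow> nat \<Rightarrow> nat" where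
  "urn_Z p k = (let n = nat (1 + urn_nu p k) in nat (max \<bar>fst (p n)\<bar> \<bar>snd (p n)\<bar>))"

definition embedded_process ::
  "(nat \<Rightarrow> 'a \<Rightarrow> int \<times> int) \<Rightarrow> nat \<Rightarrow> 'a \<Rightarrow> nat" where
  "embedded_process S k \<omega> = urn_Z (\<lambda>n. S n \<omega>) k"

text \<open>
  \<open>visit_time z s j\<close> is the time of the \<open>(j+1)\<close>-st visit of the path \<open>z\<close> to \<open>s\<close>, time zero
  included, and \<open>\<infinity>\<close> if there is no such visit.
\<close>

primrec visit_time :: "(nat \<Rightarrow> 's) \<Rightarrow> 's \<Rightarrow> nat \<Rightarrow> enat" where
  "visit_time z s 0 = Inf {enat k | k. z k = s}"
| "visit_time z s (Suc j) = Inf {enat k | k. visit_time z s j < enat k \<and> z k = s}"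

text \<open>
  Successive return times to \<open>s\<close>. For a path started at \<open>s\<close>, \<open>return_time z s 0\<close> is the
  least \<open>k \<ge> 1\<close> with \<open>z k = s\<close>. Since \<open>\<infinity> - t = \<infinity>\<close> on \<^typ>\<open>enat\<close>, a return time is finite only
  if both visits take place.
\<close>

definition return_time :: "(nat \<Rightarrow> 's) \<Rightarrow> 's \<Rightarrow> nat \<Rightarrow> enat" where
  "return_time z s j = visit_time z s (Suc j) - visit_time z s j"

definition transient :: "'a measure \<Rightarrow> (nat \<Rightarrow> 'a \<Rightarrow> nat) \<Rightarrow> bool" where
  "transient M Z \<longleftrightarrow> (AE \<omega> in M. filterlim (\<lambda>k. Z k \<omega>) at_top sequentially)"

text \<open>
  Recurrence at the reference state \<open>1\<close>, for a chain with an arbitrary starting state: by the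
  strong Markov property every return time has the law of the first return time of the chain
  started at \<open>1\<close>.
\<close>

definition null_recurrent :: "'a measure \<Rightarrow> (nat \<Rightarrow> 'a \<Rightarrow> nat) \<Rightarrow> bool" where
  "null_recurrent M Z \<longleftrightarrow> (\<forall>j.
     (AE \<omega> in M. return_time (\<lambda>k. Z k \<omega>) 1 j < \<infinity>) \<and>
     (\<integral>\<^sup>+ \<omega>. ennreal_of_enat (return_time (\<lambda>k. Z k \<omega>) 1 j) \<partial>M) = \<infinity>)"

definition positive_recurrent :: "'a measure \<Rightarrow> (nat \<Rightarrow> 'a \<Rightarrow> nat) \<Rightarrow> bool" where
  "positive_recurrent M Z \<longleftrightarrow> (\<forall>j.
     (AE \<omega> in M. return_time (\<lambda>k. Z k \<omega>) 1 j < \<infinity>) \<and>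
     (\<integral>\<^sup>+ \<omega>. ennreal_of_enat (return_time (\<lambda>k. Z k \<omega>) 1 j) \<partial>M) < \<infinity>)"

end

theory Submission
  imports Defs "HOL-Real_Asymp.Real_Asymp"
begin

text \<open>
  By rotational symmetry the urn can be folded onto the first quadrant, so that \<open>Z\<close> is the Markov chain
  that from \<open>z\<close> moves to \<open>max 1 (Y - \<kappa>)\<close>, where \<open>Y\<close> is the exit point of the urn started at \<open>(z, 1)\<close>.
  Elementary symmetric polynomials in suitable increments are harmonic for the urn; those of order two and
  four give the moments of \<open>Y\<close>, hence \<open>Z\<close> has drift \<open>2/3 - E \<kappa> + O(z\<^sup>-\<^sup>1\<^sup>/\<^sup>2)\<close>, variance \<open>2z/3 + O(z\<^sup>1\<^sup>/\<^sup>2)\<close>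
  and fourth moment \<open>O(z\<^sup>2)\<close> of its increments.
  Lamperti's method then applies: far out, \<open>1 / (A + ln z)\<close> is a supermartingale if \<open>E \<kappa> < 1/3\<close>,
  \<open>ln (1 + ln z)\<close> if \<open>E \<kappa> \<ge> 1/3\<close>, \<open>z\<close> has negative drift if \<open>E \<kappa> > 2/3\<close>, and \<open>z - K * sqrt z\<close> is
  a submartingale with bounded drift if \<open>E \<kappa> \<le> 2/3\<close>, which rules out a finite mean return time.
\<close>

section \<open>The law of the exit point of a quadrant\<close>

text \<open>To leading order the generator of \<open>Z\<close> is
  \<open>a * f' + (z/3) * f''\<close> with \<open>a = 2/3 - E \<kappa>\<close>. It annihilates
  \<open>ln z\<close> when \<open>a = 1/3\<close> and \<open>z\<close> when \<open>a = 0\<close>.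
  These are the two thresholds, and both belong to the null-recurrent case. There the main terms
  cancel, and the remaining errors, smaller by a factor \<open>1 / sqrt z\<close>, have unknown
  sign. Hence a correction with drift of known sign: the outer logarithm gains a term that is
  smaller only by a factor \<open>ln z\<close>, and \<open>- K * sqrt z\<close> one of the order of
  the error, with \<open>K\<close> free. The martingale identities for the exit point are not
  closed: the square of the first brings in a third moment. So the fourth order bounds the
  deviations a priori, before the second order is evaluated up to lower terms. The fourth moment
  also controls large downward jumps, where \<open>ln\<close> is singular and the truncation at
  \<open>1\<close> acts. Return times are treated through taboo expectations, computed from the
  kernel alone, and every strong Markov argument is a sum over the countably many values of a random
  time.\<close>

lemma pmf_integral_bind_nonneg:
  fixes h :: "'b \<Rightarrow> real"
  assumes int: "integrable (measure_pmf (bind_pmf p f)) h" and nn: "\<And>y. 0 \<le> h y"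
  shows "\<And>x. x \<in> set_pmf p \<Longrightarrow> integrable (measure_pmf (f x)) h"
    and "integrable (measure_pmf p) (\<lambda>x. measure_pmf.expectation (f x) h)"
    and "measure_pmf.expectation (bind_pmf p f) h
           = measure_pmf.expectation p (\<lambda>x. measure_pmf.expectation (f x) h)"
proof -
  have fin: "(\<integral>\<^sup>+x. (\<integral>\<^sup>+y. ennreal (h y) \<partial>f x) \<partial>p) < \<infinity>"
    using int nn by (simp add: integrable_iff_bounded)
  have "(\<integral>\<^sup>+y. ennreal (h y) \<partial>f x) \<noteq> \<infinity>" if "x \<in> set_pmf p" for x
    using nn_integral_PInf_AE[OF _ fin[THEN less_imp_neq]] that by (auto simp: AE_measure_pmf_iff)
  then show int': "integrable (measure_pmf (f x)) h" if "x \<in> set_pmf p" for x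
    using nn that by (simp add: integrable_iff_bounded top.not_eq_extremum)
  have eq: "(\<integral>\<^sup>+x. ennreal (measure_pmf.expectation (f x) h) \<partial>p)
             = (\<integral>\<^sup>+x. (\<integral>\<^sup>+y. ennreal (h y) \<partial>f x) \<partial>p)"
    by (intro nn_integral_cong_AE AE_pmfI, subst nn_integral_eq_integral) (use int' nn in auto)
  then show int'': "integrable (measure_pmf p) (\<lambda>x. measure_pmf.expectation (f x) h)"
    using fin nn by (simp add: integrable_iff_bounded integral_nonneg_AE)
  show "measure_pmf.expectation (bind_pmf p f) h
           = measure_pmf.expectation p (\<lambda>x. measure_pmf.expectation (f x) h)"
    by (rule ennreal_inj[THEN iffD1])
      (use eq nn in \<open>auto simp: integral_nonneg_AE nn_integral_eq_integral[OF int'', symmetric]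
        nn_integral_eq_integral[OF int, symmetric]\<close>)
qed

lemma pmf_integral_bind:
  fixes h :: "'b \<Rightarrow> real"
  assumes int: "integrable (measure_pmf (bind_pmf p f)) h"
  shows "\<And>x. x \<in> set_pmf p \<Longrightarrow> integrable (measure_pmf (f x)) h"
    and "measure_pmf.expectation (bind_pmf p f) h
           = measure_pmf.expectation p (\<lambda>x. measure_pmf.expectation (f x) h)"
proof -
  define u where "u = (\<lambda>y. max (h y) 0)"
  define w where "w = (\<lambda>y. max (- h y) 0)"
  have h: "h = (\<lambda>y. u y - w y)"
    by (auto simp: u_def w_def max_def)
  have u: "integrable (measure_pmf (bind_pmf p f)) u" "\<And>y. 0 \<le> u y"
   and w: "integrable (measure_pmf (bind_pmf p f)) w" "\<And>y. 0 \<le> w y"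
    unfolding u_def w_def using int by (auto intro!: integrable_max)
  note U = pmf_integral_bind_nonneg[OF u] and W = pmf_integral_bind_nonneg[OF w]
  show int': "integrable (measure_pmf (f x)) h" if "x \<in> set_pmf p" for x
    unfolding h using U(1) W(1) that by auto
  have "measure_pmf.expectation p (\<lambda>x. measure_pmf.expectation (f x) h) =
      measure_pmf.expectation p (\<lambda>x. measure_pmf.expectation (f x) u - measure_pmf.expectation (f x) w)"
    unfolding h by (intro integral_cong_AE AE_pmfI) (auto simp: U(1) W(1))
  then show "measure_pmf.expectation (bind_pmf p f) h
           = measure_pmf.expectation p (\<lambda>x. measure_pmf.expectation (f x) h)"
    using u w U W by (simp add: h)
qed

text \<open>Probability that from \<open>(Suc a, b)\<close> the second coordinate increases at least \<open>n\<close> times before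
  the first one drops.\<close>

definition stay_prob :: "nat \<Rightarrow> nat \<Rightarrow> nat \<Rightarrow> real" where
  "stay_prob a b n = (\<Prod>i<n. real (Suc a) / real (Suc a + b + i))"

lemma stay_prob_0 [simp]: "stay_prob a b 0 = 1"
  by (simp add: stay_prob_def)

lemma stay_prob_Suc: "stay_prob a b (Suc n) = stay_prob a b n * (real (Suc a) / real (Suc a + b + n))"
  by (simp add: stay_prob_def)

lemma stay_prob_Suc_shift:
  "stay_prob a b (Suc n) = real (Suc a) / real (Suc a + b) * stay_prob a (Suc b) n"
  unfolding stay_prob_def by (subst prod.lessThan_Suc_shift) (simp del: of_nat_Suc)

lemma stay_prob_pos: "stay_prob a b n > 0"
  unfolding stay_prob_def by (intro prod_pos) auto

lemma stay_prob_diff: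
  "stay_prob a b n - stay_prob a b (Suc n) = stay_prob a b n * (real (b + n) / real (Suc a + b + n))"
  by (simp add: stay_prob_Suc field_simps)

lemma stay_prob_diff_nonneg: "0 \<le> stay_prob a b n - stay_prob a b (Suc n)"
  unfolding stay_prob_diff using stay_prob_pos[of a b n] by simp

text \<open>From \<open>i = Suc a\<close> on each factor is at most \<open>1/2\<close>, and the
  earlier ones are at most \<open>1\<close>. The resulting geometric tail does not depend on
  \<open>b\<close>; it makes the polynomial moments finite.\<close>

lemma stay_prob_le: "stay_prob a b n \<le> 2 ^ Suc a / 2 ^ n"
proof -
  have "stay_prob a b n \<le> (\<Prod>i<n. if i < Suc a then 1 else 1/2)"
    unfolding stay_prob_def by (intro prod_mono) (auto simp: field_simps)
  also have "\<dots> \<le> 2 ^ Suc a / 2 ^ n"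
  proof (induction n)
    case (Suc n)
    show ?case
    proof (cases "n < Suc a")
      case True
      then have "(\<Prod>i<Suc n. if i < Suc a then 1 else 1/2 :: real) = 1"
        by (intro prod.neutral) auto
      moreover have "(2::real) ^ Suc n \<le> 2 ^ Suc a" using True by (intro power_increasing) auto
      ultimately show ?thesis by (simp add: divide_simps)
    qed (use Suc in \<open>auto simp: mult.commute\<close>)
  next
    case 0
    show ?case using one_le_power[of "2::real" "Suc a"] by simp
  qed
  finally show ?thesis .
qed

lemma stay_prob_tendsto_0: "stay_prob a b \<longlonglongrightarrow> 0"
proof (rule tendsto_sandwich[OF _ _ tendsto_const])
  show "(\<lambda>n. 2 ^ Suc a / 2 ^ n :: real) \<longlonglongrightarrow> 0" by real_asymp
qed (auto simp: less_imp_le[OF stay_prob_pos] simp del: power_Suc intro!: always_eventually stay_prob_le)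

text \<open>The increase of the second coordinate before the first coordinate drops from \<open>Suc a\<close>.\<close>

definition gap_pmf :: "nat \<Rightarrow> nat \<Rightarrow> nat pmf" where
  "gap_pmf a b = embed_pmf (\<lambda>n. stay_prob a b n - stay_prob a b (Suc n))"

lemma pmf_gap: "pmf (gap_pmf a b) n = stay_prob a b n - stay_prob a b (Suc n)"
  unfolding gap_pmf_def
proof (rule pmf_embed_pmf)
  have "(\<lambda>n. stay_prob a b n - stay_prob a b (Suc n)) sums (stay_prob a b 0 - 0)"
    by (rule telescope_sums'[OF stay_prob_tendsto_0])
  then show "(\<integral>\<^sup>+ n. ennreal (stay_prob a b n - stay_prob a b (Suc n)) \<partial>count_space UNIV) = 1"
    using stay_prob_diff_nonneg
    by (subst nn_integral_count_space_nat, subst suminf_ennreal2) (auto simp: sums_iff)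
qed (rule stay_prob_diff_nonneg)

text \<open>Conditioning on the first step: \<open>stay_prob\<close> loses its first factor and
  \<open>b\<close> moves to \<open>Suc b\<close>.\<close>

lemma gap_pmf_Suc:
  "gap_pmf a b = bernoulli_pmf (real (Suc a) / real (Suc a + b)) \<bind>
     (\<lambda>c. if c then map_pmf Suc (gap_pmf a (Suc b)) else return_pmf 0)"
proof (rule pmf_eqI)
  fix n
  have pr: "real (Suc a) / real (Suc a + b) \<in> {0..1}" by (auto simp: field_simps)
  show "pmf (gap_pmf a b) n = pmf (bernoulli_pmf (real (Suc a) / real (Suc a + b)) \<bind>
     (\<lambda>c. if c then map_pmf Suc (gap_pmf a (Suc b)) else return_pmf 0)) n"
  proof (cases n)
    case 0
    have "pmf (map_pmf Suc (gap_pmf a (Suc b))) 0 = 0"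
      by (rule pmf_map_outside) auto
    then show ?thesis using pr 0 by (simp add: pmf_bind pmf_gap stay_prob_Suc)
  next
    case (Suc m)
    have "pmf (map_pmf Suc (gap_pmf a (Suc b))) (Suc m) = pmf (gap_pmf a (Suc b)) m"
      by (rule pmf_map_inj') auto
    then show ?thesis using pr Suc
      by (simp add: pmf_bind pmf_gap stay_prob_Suc_shift[of a b] diff_divide_distrib
          left_diff_distrib right_diff_distrib mult.commute[of "stay_prob _ _ _"] del: of_nat_Suc)
  qed
qed

text \<open>\<open>exit_law a b\<close> is the law of the second coordinate when the first one reaches zero.\<close>

primrec exit_law :: "nat \<Rightarrow> nat \<Rightarrow> nat pmf" where
  "exit_law 0 b = return_pmf b"
| "exit_law (Suc a) b = gap_pmf a b \<bind> (\<lambda>n. exit_law a (b + n))"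

text \<open>The law is built column by column because its one-step equation is not a well-founded
  recursion: \<open>b\<close> grows while \<open>a\<close> stays. That equation is recovered here,
  to be compared with the steps of the urn.\<close>

lemma exit_law_step:
  "exit_law (Suc a) b = bernoulli_pmf (real (Suc a) / real (Suc a + b)) \<bind>
     (\<lambda>c. if c then exit_law (Suc a) (Suc b) else exit_law a b)"
  by (simp only: exit_law.simps, subst gap_pmf_Suc)
     (auto simp: bind_assoc_pmf bind_map_pmf bind_return_pmf intro!: bind_pmf_cong)

section \<open>Support and polynomial moments of the exit law\<close>

lemma set_gap_pmf: "b \<ge> 1 \<Longrightarrow> set_pmf (gap_pmf a b) = UNIV"
  using stay_prob_pos[of a b, THEN less_imp_neq] by (auto simp: set_pmf_eq pmf_gap stay_prob_diff)

lemma set_exit_law: "b \<ge> 1 \<Longrightarrow> set_pmf (exit_law (Suc a) b) = {b..}"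
proof (induction a arbitrary: b)
  case 0
  then show ?case
    by (auto simp: set_gap_pmf nat_le_iff_add)
next
  case (Suc a)
  have "set_pmf (exit_law (Suc (Suc a)) b) = (\<Union>n. {b + n..})"
    using Suc by (simp only: exit_law.simps(2)[of "Suc a"] set_bind_pmf set_gap_pmf trans_le_add1)
  also have "\<dots> = {b..}" by (auto intro!: exI[of _ "0::nat"])
  finally show ?case .
qed

text \<open>\<open>1 + (b + n) \<le> (1 + b) * (1 + n)\<close> splits off \<open>b\<close> and
  leaves a series in \<open>n\<close> alone with a geometric factor. Since the power
  \<open>k\<close> of \<open>1 + b\<close> is not increased, the bound can be iterated over the
  columns.\<close>

lemma gap_moment:
  "\<exists>C. \<forall>b. (\<integral>\<^sup>+n. ennreal ((1 + real (b + n)) ^ k) \<partial>gap_pmf a b) \<le> ennreal (C * (1 + real b) ^ k)"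
proof -
  define g where "g n = 2 ^ Suc a / 2 ^ n * (1 + real n) ^ k" for n
  have g_nn: "0 \<le> g n" for n by (simp add: g_def)
  have "summable g"
  proof (rule summable_comparison_test_bigo)
    show "summable (\<lambda>n. norm ((3/4) ^ n :: real))" by (simp add: summable_geometric)
    \<comment> \<open>\<open>2/3\<close> is the quotient of the ratio \<open>1/2\<close> in the
      terms and the ratio \<open>3/4\<close> of the comparison series.\<close>
    have "(\<lambda>n. (1 + real n) ^ k * (2/3) ^ n) \<longlonglongrightarrow> 0" by real_asymp
    also have "(\<lambda>n. (1 + real n) ^ k * (2/3) ^ n) = (\<lambda>n. (1 + real n) ^ k / 2 ^ n / (3/4) ^ n)"
      by (simp add: fun_eq_iff power_divide power_mult_distrib[symmetric] field_simps)
    finally have "(\<lambda>n. (1 + real n) ^ k / 2 ^ n / (3/4) ^ n) \<longlonglongrightarrow> 0" .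
    then have "(\<lambda>n. (1 + real n) ^ k / 2 ^ n) \<in> O(\<lambda>n. (3/4) ^ n)"
      by (intro landau_o.small_imp_big smalloI_tendsto) auto
    moreover have "g = (\<lambda>n. 2 ^ Suc a * ((1 + real n) ^ k / 2 ^ n))" by (simp add: g_def fun_eq_iff)
    ultimately show "g \<in> O(\<lambda>n. (3/4) ^ n)" by (simp del: times_divide_eq_right)
  qed
  have "(\<integral>\<^sup>+n. ennreal ((1 + real (b + n)) ^ k) \<partial>gap_pmf a b) \<le> ennreal (suminf g * (1 + real b) ^ k)" for b
  proof -
    have "(\<integral>\<^sup>+n. ennreal ((1 + real (b + n)) ^ k) \<partial>gap_pmf a b)
       = (\<integral>\<^sup>+n. ennreal (pmf (gap_pmf a b) n) * ennreal ((1 + real (b + n)) ^ k) \<partial>count_space UNIV)"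
      by (rule nn_integral_measure_pmf)
    also have "\<dots> \<le> (\<integral>\<^sup>+n. ennreal (g n * (1 + real b) ^ k) \<partial>count_space UNIV)"
    proof (rule nn_integral_mono)
      fix n
      have "(1 + real (b + n)) ^ k \<le> ((1 + real n) * (1 + real b)) ^ k"
        by (intro power_mono) (auto simp: field_simps)
      moreover have "pmf (gap_pmf a b) n \<le> 2 ^ Suc a / 2 ^ n"
        unfolding pmf_gap using stay_prob_le[of a b n] stay_prob_pos[of a b "Suc n"] by linarith
      ultimately have "pmf (gap_pmf a b) n * (1 + real (b + n)) ^ k
           \<le> (2 ^ Suc a / 2 ^ n) * ((1 + real n) * (1 + real b)) ^ k"
        by (intro mult_mono) auto
      then show "ennreal (pmf (gap_pmf a b) n) * ennreal ((1 + real (b + n)) ^ k) \<le> ennreal (g n * (1 + real b) ^ k)"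
        by (simp add: ennreal_mult'[symmetric] g_def power_mult_distrib mult.assoc ennreal_leI)
    qed
    also have "\<dots> = ennreal (\<Sum>n. g n * (1 + real b) ^ k)"
      using \<open>summable g\<close> by (subst nn_integral_count_space_nat, subst suminf_ennreal2)
        (auto simp: g_nn intro!: summable_mult2)
    also have "(\<Sum>n. g n * (1 + real b) ^ k) = suminf g * (1 + real b) ^ k"
      using suminf_mult2[OF \<open>summable g\<close>] by simp
    finally show ?thesis .
  qed
  then show ?thesis by blast
qed

lemma exit_moment:
  "\<exists>C. \<forall>b. (\<integral>\<^sup>+n. ennreal ((1 + real n) ^ k) \<partial>exit_law a b) \<le> ennreal (C * (1 + real b) ^ k)"
proof (induction a)
  case 0
  then show ?case by (auto intro!: exI[of _ 1])
next
  case (Suc a)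
  then obtain C where C: "\<And>b. (\<integral>\<^sup>+n. ennreal ((1 + real n) ^ k) \<partial>exit_law a b) \<le> ennreal (C * (1 + real b) ^ k)"
    by blast
  obtain C' where C': "\<And>b. (\<integral>\<^sup>+n. ennreal ((1 + real (b + n)) ^ k) \<partial>gap_pmf a b) \<le> ennreal (C' * (1 + real b) ^ k)"
    using gap_moment by blast
  have "(\<integral>\<^sup>+n. ennreal ((1 + real n) ^ k) \<partial>exit_law (Suc a) b) \<le> ennreal (max 0 C * C' * (1 + real b) ^ k)" for b
  proof -
    have "(\<integral>\<^sup>+n. ennreal ((1 + real n) ^ k) \<partial>exit_law (Suc a) b)
      \<le> (\<integral>\<^sup>+n. ennreal (max 0 C) * ennreal ((1 + real (b + n)) ^ k) \<partial>gap_pmf a b)"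
      by (auto intro!: nn_integral_mono order_trans[OF C] ennreal_leI mult_right_mono
        simp: ennreal_mult''[symmetric] simp del: of_nat_add)
    also have "\<dots> \<le> ennreal (max 0 C) * ennreal (C' * (1 + real b) ^ k)"
      by (subst nn_integral_cmult) (auto intro!: mult_left_mono C' simp del: of_nat_add)
    also have "\<dots> = ennreal (max 0 C * C' * (1 + real b) ^ k)"
      by (subst ennreal_mult'[symmetric]) (auto simp: mult.assoc)
    finally show ?thesis .
  qed
  then show ?case by blast
qed

lemma integrable_exit_law:
  fixes f :: "nat \<Rightarrow> real"
  assumes f: "\<And>n. \<bar>f n\<bar> \<le> C * (1 + real n) ^ k"
  shows "integrable (measure_pmf (exit_law a b)) f"
proof (rule Bochner_Integration.integrable_bound)
  obtain K where "(\<integral>\<^sup>+n. ennreal ((1 + real n) ^ k) \<partial>exit_law a b) \<le> ennreal (K * (1 + real b) ^ k)"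
    using exit_moment by blast
  then have "integrable (measure_pmf (exit_law a b)) (\<lambda>n. (1 + real n) ^ k)"
    by (auto simp: integrable_iff_bounded le_less_trans)
  then show "integrable (measure_pmf (exit_law a b)) (\<lambda>n. C * (1 + real n) ^ k)" by simp
  show "AE n in exit_law a b. norm (f n) \<le> norm (C * (1 + real n) ^ k)"
    by (auto intro: order_trans[OF f] abs_ge_self)
qed simp

text \<open>Optional stopping within one column: \<open>harm\<close> makes the partial sums
  telescope to \<open>h (Suc a) b\<close> minus a remainder carried by the event of no drop so far,
  where geometric decay beats polynomial growth. Integrability is a separate premise since
  convergence of the partial sums alone does not identify the expectation.\<close>

lemma gap_expectation:
  fixes h :: "nat \<Rightarrow> nat \<Rightarrow> real"
  assumes harm: "\<And>b. b \<ge> 1 \<Longrightarrow>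
      (real (Suc a) + real b) * h (Suc a) b = real b * h a b + real (Suc a) * h (Suc a) (Suc b)"
    and bound: "\<And>b. \<bar>h (Suc a) b\<bar> \<le> C * (1 + real b) ^ k"
    and int: "integrable (gap_pmf a b) (\<lambda>n. h a (b + n))" and "b \<ge> 1"
  shows "measure_pmf.expectation (gap_pmf a b) (\<lambda>n. h a (b + n)) = h (Suc a) b"
proof -
  have part: "(\<Sum>i<n. pmf (gap_pmf a b) i * h a (b + i)) = h (Suc a) b - stay_prob a b n * h (Suc a) (b + n)" for n
  proof (induction n)
    case (Suc n)
    have "h (Suc a) (b + n) = real (b + n) / real (Suc a + b + n) * h a (b + n)
        + real (Suc a) / real (Suc a + b + n) * h (Suc a) (Suc (b + n))"
      using harm[of "b + n"] \<open>b \<ge> 1\<close>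
      by (simp add: add_divide_distrib[symmetric] eq_divide_eq) (simp add: algebra_simps)
    moreover have "pmf (gap_pmf a b) n = stay_prob a b n * (real (b + n) / real (Suc a + b + n))"
      by (rule trans[OF pmf_gap stay_prob_diff])
    ultimately have "stay_prob a b n * h (Suc a) (b + n) = pmf (gap_pmf a b) n * h a (b + n)
        + stay_prob a b (Suc n) * h (Suc a) (b + Suc n)"
      by (simp add: stay_prob_Suc algebra_simps add_divide_distrib)
    with Suc show ?case by simp
  qed auto
  have "(\<lambda>n. stay_prob a b n * h (Suc a) (b + n)) \<longlonglongrightarrow> 0"
  proof (rule Lim_null_comparison)
    show "(\<lambda>n. 2 ^ Suc a / 2 ^ n * (\<bar>C\<bar> * (1 + real b + real n) ^ k)) \<longlonglongrightarrow> 0"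
      by real_asymp
    show "\<forall>\<^sub>F n in sequentially. norm (stay_prob a b n * h (Suc a) (b + n)) \<le> 2 ^ Suc a / 2 ^ n * (\<bar>C\<bar> * (1 + real b + real n) ^ k)"
    proof (rule always_eventually, rule allI)
      fix n
      have "\<bar>h (Suc a) (b + n)\<bar> \<le> \<bar>C\<bar> * (1 + real b + real n) ^ k"
        using order_trans[OF bound[of "b + n"], of "\<bar>C\<bar> * (1 + real (b + n)) ^ k"]
        by (simp add: mult_right_mono add.assoc)
      then show "norm (stay_prob a b n * h (Suc a) (b + n)) \<le> 2 ^ Suc a / 2 ^ n * (\<bar>C\<bar> * (1 + real b + real n) ^ k)"
        unfolding real_norm_def abs_mult using stay_prob_le[of a b n] stay_prob_pos[of a b n]
        by (intro mult_mono) auto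
    qed
  qed
  from tendsto_diff[OF tendsto_const[of "h (Suc a) b"] this]
  have lim: "(\<lambda>i. pmf (gap_pmf a b) i * h a (b + i)) sums h (Suc a) b"
    by (simp add: sums_def part)
  have int': "integrable (count_space UNIV) (\<lambda>i. pmf (gap_pmf a b) i * h a (b + i))"
    using int by (subst (asm) measure_pmf_eq_density, subst (asm) integrable_density) auto
  have "measure_pmf.expectation (gap_pmf a b) (\<lambda>n. h a (b + n)) =
     integral\<^sup>L (count_space UNIV) (\<lambda>i. pmf (gap_pmf a b) i * h a (b + i))"
    by (subst measure_pmf_eq_density, subst integral_density) auto
  also have "\<dots> = h (Suc a) b"
    using sums_integral_count_space_nat[OF int'] lim sums_unique2 by blast
  finally show ?thesis .
qed

text \<open>Optional stopping over all columns: a function that is harmonic for the walk keeps its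
  initial value in the mean up to the exit. The growth bound is restricted to
  \<open>a \<le> z\<close> because the constants of the harmonic functions used later depend on
  \<open>z\<close> and are valid for columns up to \<open>z\<close>.\<close>

lemma exit_expectation:
  fixes h :: "nat \<Rightarrow> nat \<Rightarrow> real"
  assumes harm: "\<And>a b. b \<ge> 1 \<Longrightarrow>
      (real (Suc a) + real b) * h (Suc a) b = real b * h a b + real (Suc a) * h (Suc a) (Suc b)"
    and bound: "\<And>a b. a \<le> z \<Longrightarrow> \<bar>h a b\<bar> \<le> C * (1 + real b) ^ k"
    and "a \<le> z" "b \<ge> 1"
  shows "measure_pmf.expectation (exit_law a b) (h 0) = h a b"
  using \<open>a \<le> z\<close> \<open>b \<ge> 1\<close>
proof (induction a arbitrary: b)
  case (Suc a)
  have *: "integrable (measure_pmf (exit_law (Suc a) b)) (h 0)"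
    by (rule integrable_exit_law, rule bound) auto
  have IH: "measure_pmf.expectation (exit_law a (b + n)) (h 0) = h a (b + n)" for n
    using Suc by auto
  have "integrable (gap_pmf a b) (\<lambda>n. h a (b + n))"
  proof (rule Bochner_Integration.integrable_bound)
    obtain K where "(\<integral>\<^sup>+n. ennreal ((1 + real (b + n)) ^ k) \<partial>gap_pmf a b) \<le> ennreal (K * (1 + real b) ^ k)"
      using gap_moment by blast
    then have "integrable (measure_pmf (gap_pmf a b)) (\<lambda>n. (1 + real (b + n)) ^ k)"
      by (auto simp: integrable_iff_bounded le_less_trans)
    then show "integrable (measure_pmf (gap_pmf a b)) (\<lambda>n. C * (1 + real (b + n)) ^ k)" by simp
  qed (use bound Suc in \<open>auto intro!: order_trans[OF bound] simp del: of_nat_add\<close>)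
  moreover have "\<bar>h (Suc a) b\<bar> \<le> C * (1 + real b) ^ k" for b using Suc bound by simp
  ultimately have "measure_pmf.expectation (gap_pmf a b) (\<lambda>n. h a (b + n)) = h (Suc a) b"
    by (intro gap_expectation[where C=C and k=k] harm) (use Suc in auto)
  with * IH show ?case by (simp add: pmf_integral_bind(2))
qed simp

section \<open>Moments of the exit point\<close>

definition power_sum :: "nat \<Rightarrow> nat \<Rightarrow> real" where
  "power_sum k n = (\<Sum>j=1..n. real j ^ k)"

lemma power_sum_0 [simp]: "power_sum k 0 = 0"
  by (simp add: power_sum_def)

lemma power_sum_Suc: "power_sum k (Suc n) = power_sum k n + real (Suc n) ^ k"
  by (simp add: power_sum_def)

lemma power_sum_nonneg: "0 \<le> power_sum k n"
  by (simp add: power_sum_def sum_nonneg)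

lemma power_sum_le: "power_sum k n \<le> real n ^ Suc k"
proof -
  have "power_sum k n \<le> (\<Sum>j=1..n. real n ^ k)"
    unfolding power_sum_def by (intro sum_mono power_mono) auto
  then show ?thesis by simp
qed

text \<open>Faulhaber's formula in the variable \<open>n - 1/2\<close>, the centre of symmetry of
  the Bernoulli polynomials: here and for higher \<open>k\<close> only powers of one parity survive.
  With truncated subtraction it holds at \<open>n = 0\<close> as well, where both sides
  vanish.\<close>

lemma power_sum_1: "power_sum 1 (n - 1) = ((real n - 1/2)^2 - 1/4) / 2"
proof (cases n)
  case (Suc m)
  have "power_sum 1 m = ((real (Suc m) - 1/2)^2 - 1/4) / 2"
    by (induction m) (simp_all add: power_sum_Suc power2_eq_square field_simps)
  with Suc show ?thesis by simp
qed (simp add: power2_eq_square)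

lemma power_sum_2: "power_sum 2 (n - 1) = ((real n - 1/2)^3 - (real n - 1/2) / 4) / 3"
proof (cases n)
  case (Suc m)
  have "power_sum 2 m = ((real (Suc m) - 1/2)^3 - (real (Suc m) - 1/2) / 4) / 3"
    by (induction m) (simp_all add: power_sum_Suc power2_eq_square power3_eq_cube field_simps)
  with Suc show ?thesis by simp
qed (simp add: power3_eq_cube)

text \<open>Nicomachus' identity. In this form the shifted third power sum at the exit becomes a
  difference of two squares, so that its sign is that of the first one.\<close>

lemma power_sum_3: "power_sum 3 (n - 1) = (power_sum 1 (n - 1))^2"
proof (cases n)
  case (Suc m)
  have 3: "power_sum 3 m = ((real (Suc m) - 1/2)^2 - 1/4)^2 / 4"
    by (induction m) (simp_all add: power_sum_Suc power2_eq_square power3_eq_cube field_simps)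
  have 1: "power_sum 1 m = ((real (Suc m) - 1/2)^2 - 1/4) / 2"
    using power_sum_1[of "Suc m"] by simp
  show ?thesis unfolding Suc diff_Suc_1 3 1 by (simp add: power_divide)
qed simp

lemma power_sum_4: "power_sum 4 (n - 1) =
   (real n - 1/2)^5 / 5 - (real n - 1/2)^3 / 6 + 7 * (real n - 1/2) / 240"
proof (cases n)
  case (Suc m)
  have "power_sum 4 m = (real (Suc m) - 1/2)^5 / 5 - (real (Suc m) - 1/2)^3 / 6 + 7 * (real (Suc m) - 1/2) / 240"
    by (induction m) (simp_all add: power_sum_Suc power_numeral_reduce field_simps)
  with Suc show ?thesis by simp
qed (simp add: power_numeral_reduce)

text \<open>With \<open>v = n - 1/2\<close>, the two lower terms together are
  \<open>- v * (v^2 - 7/40) / 6\<close>, which is negative for \<open>v \<ge> 1/2\<close>.\<close>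

lemma power_sum_4_le:
  assumes "n \<ge> 1"
  shows "power_sum 4 (n - 1) \<le> (real n - 1/2)^5 / 5"
proof -
  define v where "v = real n - 1/2"
  have "v^2 \<ge> (1/2)^2" using assms by (intro power_mono) (auto simp: v_def)
  then have "v * (v^2 - 7/40) \<ge> 0"
    using assms by (intro mult_nonneg_nonneg) (auto simp: power2_eq_square v_def)
  moreover have "v * (v^2 - 7/40) = v^3 - 7 * v / 40" by algebra
  ultimately show ?thesis unfolding power_sum_4 v_def[symmetric] by simp
qed

text \<open>A step of the walk changes \<open>shifted_power_sum z k\<close> by \<open>\<delta> ^ k\<close>, where \<open>\<delta> = y\<close> if \<open>y\<close> increases
  and \<open>\<delta> = -x\<close> if \<open>x\<close> decreases; the conditional mean of \<open>\<delta>\<close> vanishes. Hence the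
  elementary symmetric polynomials in these variables are harmonic, and they vanish at \<open>(z, 1)\<close>.
  By Newton's identities, \<open>harmonic2\<close> and \<open>harmonic4\<close> are \<open>2! e\<^sub>2\<close> and \<open>4! e\<^sub>4\<close>.\<close>

definition shifted_power_sum :: "nat \<Rightarrow> nat \<Rightarrow> nat \<Rightarrow> nat \<Rightarrow> real" where
  "shifted_power_sum z k x y = power_sum k (y - 1) - (-1) ^ k * (power_sum k x - power_sum k z)"

lemma shifted_power_sum_up:
  "y \<ge> 1 \<Longrightarrow> shifted_power_sum z k x (Suc y) = shifted_power_sum z k x y + real y ^ k"
  by (cases y) (auto simp: shifted_power_sum_def power_sum_Suc)

lemma shifted_power_sum_down:
  "shifted_power_sum z k x y = shifted_power_sum z k (Suc x) y + (- real (Suc x)) ^ k"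
  by (simp add: shifted_power_sum_def power_sum_Suc power_minus[of "real (Suc x)"] algebra_simps del: of_nat_Suc)

text \<open>The shape \<open>q ^ k\<close> with one \<open>q\<close> for all \<open>k\<close> makes
  every monomial of weight \<open>j\<close> in Newton's identities at most \<open>q ^ j\<close>. The
  exponent \<open>5\<close> is the largest \<open>Suc k\<close>, and
  \<open>Suc k \<le> 2 * k\<close> explains the square.\<close>

lemma shifted_power_sum_bound:
  assumes "x \<le> z" "k \<ge> 1" "k \<le> 4"
  shows "\<bar>shifted_power_sum z k x y\<bar> \<le> ((1 + real z ^ 5) * (1 + real y) ^ 2) ^ k"
proof -
  have mono: "power_sum k x \<le> power_sum k z"
    unfolding power_sum_def using assms by (intro sum_mono2) auto
  have "real z ^ Suc k \<le> real z ^ 5"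
    using assms by (cases "z = 0") (auto intro!: power_increasing simp del: power_Suc)
  then have z: "power_sum k z \<le> real z ^ 5" using power_sum_le[of k z] by linarith
  have "power_sum k (y - 1) \<le> real (y - 1) ^ Suc k" by (rule power_sum_le)
  also have "\<dots> \<le> (1 + real y) ^ Suc k" by (intro power_mono) auto
  also have "\<dots> \<le> (1 + real y) ^ (2 * k)" using assms by (intro power_increasing) auto
  finally have y: "power_sum k (y - 1) \<le> (1 + real y) ^ (2 * k)" .
  have one: "1 \<le> (1 + real y) ^ (2 * k)" by (rule one_le_power) auto
  have "\<bar>shifted_power_sum z k x y\<bar> \<le> \<bar>power_sum k (y - 1)\<bar> + \<bar>power_sum k x - power_sum k z\<bar>"
    unfolding shifted_power_sum_def by (intro order_trans[OF abs_triangle_ineq4]) (simp add: abs_mult power_abs)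
  also have "\<dots> \<le> (1 + real y) ^ (2 * k) + real z ^ 5"
    using y z mono power_sum_nonneg[of k] by (smt (verit, ccfv_SIG))
  also have "\<dots> \<le> (1 + real y) ^ (2 * k) + real z ^ 5 * (1 + real y) ^ (2 * k)"
    using one mult_left_mono[OF one, of "real z ^ 5"] by simp
  also have "\<dots> = (1 + real z ^ 5) ^ 1 * (1 + real y) ^ (2 * k)" by (simp add: algebra_simps)
  also have "\<dots> \<le> (1 + real z ^ 5) ^ k * (1 + real y) ^ (2 * k)"
    using assms by (intro mult_right_mono power_increasing) auto
  finally show ?thesis by (simp add: power_mult power_mult_distrib)
qed

definition harmonic2 :: "nat \<Rightarrow> nat \<Rightarrow> nat \<Rightarrow> real" where
  "harmonic2 z x y = shifted_power_sum z 1 x y ^ 2 - shifted_power_sum z 2 x y"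

definition harmonic4 :: "nat \<Rightarrow> nat \<Rightarrow> nat \<Rightarrow> real" where
  "harmonic4 z x y = shifted_power_sum z 1 x y ^ 4
     - 6 * shifted_power_sum z 1 x y ^ 2 * shifted_power_sum z 2 x y
     + 3 * shifted_power_sum z 2 x y ^ 2
     + 8 * shifted_power_sum z 1 x y * shifted_power_sum z 3 x y - 6 * shifted_power_sum z 4 x y"

lemma exit_shifted_power_sum_1:
  "measure_pmf.expectation (exit_law z 1) (shifted_power_sum z 1 0) = 0"
proof -
  have "measure_pmf.expectation (exit_law z 1) (shifted_power_sum z 1 0) = shifted_power_sum z 1 z 1"
  proof (rule exit_expectation)
    fix a b :: nat assume "b \<ge> 1"
    then show "(real (Suc a) + real b) * shifted_power_sum z 1 (Suc a) b =
        real b * shifted_power_sum z 1 a b + real (Suc a) * shifted_power_sum z 1 (Suc a) (Suc b)"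
      by (simp only: shifted_power_sum_up shifted_power_sum_down[of z _ a]) algebra
  next
    fix x y assume "x \<le> z"
    from shifted_power_sum_bound[OF this, of 1 y]
    show "\<bar>shifted_power_sum z 1 x y\<bar> \<le> (1 + real z ^ 5) * (1 + real y) ^ 2" by simp
  qed auto
  then show ?thesis by (simp add: shifted_power_sum_def)
qed

lemma exit_harmonic2: "measure_pmf.expectation (exit_law z 1) (harmonic2 z 0) = 0"
proof -
  have "measure_pmf.expectation (exit_law z 1) (harmonic2 z 0) = harmonic2 z z 1"
  proof (rule exit_expectation)
    fix a b :: nat assume "b \<ge> 1"
    then show "(real (Suc a) + real b) * harmonic2 z (Suc a) b =
        real b * harmonic2 z a b + real (Suc a) * harmonic2 z (Suc a) (Suc b)"
      by (simp only: harmonic2_def shifted_power_sum_up shifted_power_sum_down[of z _ a]) algebra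
  next
    fix x y assume "x \<le> z"
    note B = shifted_power_sum_bound[OF this, of _ y]
    define q where "q = (1 + real z ^ 5) * (1 + real y) ^ 2"
    have "\<bar>harmonic2 z x y\<bar> \<le> \<bar>shifted_power_sum z 1 x y\<bar> ^ 2 + \<bar>shifted_power_sum z 2 x y\<bar>"
      unfolding harmonic2_def by (intro order_trans[OF abs_triangle_ineq4]) simp
    also have "\<dots> \<le> (q ^ 1) ^ 2 + q ^ 2"
      using B[of 1] B[of 2] by (intro add_mono power_mono) (auto simp: q_def)
    also have "\<dots> = 2 * (1 + real z ^ 5) ^ 2 * (1 + real y) ^ 4" by (simp add: q_def power_mult_distrib)
    finally show "\<bar>harmonic2 z x y\<bar> \<le> 2 * (1 + real z ^ 5) ^ 2 * (1 + real y) ^ 4" .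
  qed auto
  then show ?thesis by (simp add: harmonic2_def shifted_power_sum_def)
qed

lemma exit_harmonic4: "measure_pmf.expectation (exit_law z 1) (harmonic4 z 0) = 0"
  and integrable_exit_harmonic4: "integrable (measure_pmf (exit_law z 1)) (harmonic4 z 0)"
proof -
  \<comment> \<open>\<open>24 = 1 + 6 + 3 + 8 + 6\<close> is the sum of the absolute values of the
    coefficients.\<close>
  have bound: "\<bar>harmonic4 z x y\<bar> \<le> 24 * (1 + real z ^ 5) ^ 4 * (1 + real y) ^ 8" if "x \<le> z" for x y
  proof -
    note B = shifted_power_sum_bound[OF that, of _ y]
    define q where "q = (1 + real z ^ 5) * (1 + real y) ^ 2"
    have q: "q \<ge> 0" by (simp add: q_def)
    have b1: "\<bar>shifted_power_sum z 1 x y\<bar> \<le> q" and b2: "\<bar>shifted_power_sum z 2 x y\<bar> \<le> q^2"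
      and b3: "\<bar>shifted_power_sum z 3 x y\<bar> \<le> q^3" and b4: "\<bar>shifted_power_sum z 4 x y\<bar> \<le> q^4"
      using B[of 1] B[of 2] B[of 3] B[of 4] by (auto simp: q_def)
    have qs: "q^2 * q^2 = q^4" "(q^2)^2 = q^4" "q * q^3 = q^4" by algebra+
    have c1: "\<bar>shifted_power_sum z 1 x y ^ 4\<bar> \<le> q^4" using power_mono[OF b1, of 4] by (simp add: power_abs)
    have c2: "\<bar>shifted_power_sum z 1 x y ^ 2 * shifted_power_sum z 2 x y\<bar> \<le> q^2 * q^2"
      unfolding abs_mult power_abs using b1 b2 q by (intro mult_mono power_mono) auto
    have c3: "\<bar>shifted_power_sum z 2 x y ^ 2\<bar> \<le> (q^2)^2" using power_mono[OF b2, of 2] by (simp add: power_abs)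
    have c4: "\<bar>shifted_power_sum z 1 x y * shifted_power_sum z 3 x y\<bar> \<le> q * q^3"
      unfolding abs_mult using b1 b3 q by (intro mult_mono) auto
    have "\<bar>harmonic4 z x y\<bar> \<le> 24 * q ^ 4"
      using c1 c2 c3 c4 b4 unfolding harmonic4_def qs abs_le_iff mult.assoc by linarith
    then show ?thesis by (simp add: q_def power_mult_distrib)
  qed
  have "measure_pmf.expectation (exit_law z 1) (harmonic4 z 0) = harmonic4 z z 1"
  proof (rule exit_expectation[OF _ bound])
    fix a b :: nat assume "b \<ge> 1"
    then show "(real (Suc a) + real b) * harmonic4 z (Suc a) b =
        real b * harmonic4 z a b + real (Suc a) * harmonic4 z (Suc a) (Suc b)"
      by (simp only: harmonic4_def shifted_power_sum_up shifted_power_sum_down[of z _ a]) algebra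
  qed auto
  then show "measure_pmf.expectation (exit_law z 1) (harmonic4 z 0) = 0"
    by (simp add: harmonic4_def shifted_power_sum_def)
  show "integrable (measure_pmf (exit_law z 1)) (harmonic4 z 0)"
    by (rule integrable_exit_law[OF bound]) simp
qed

section \<open>The exit point in centred coordinates\<close>

lemma integrable_exit_power:
  "integrable (measure_pmf (exit_law a b)) (\<lambda>n. (real n - c) ^ k)"
  "integrable (measure_pmf (exit_law a b)) (\<lambda>n. \<bar>real n - c\<bar> ^ k)"
proof -
  have *: "\<bar>real n - c\<bar> ^ k \<le> (1 + \<bar>c\<bar>) ^ k * (1 + real n) ^ k" for n
    unfolding power_mult_distrib[symmetric]
  proof (intro power_mono)
    have "0 \<le> \<bar>c\<bar> * real n" by simp
    moreover have "\<bar>real n - c\<bar> \<le> real n + \<bar>c\<bar>" by linarith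
    moreover have "(1 + \<bar>c\<bar>) * (1 + real n) = 1 + real n + \<bar>c\<bar> + \<bar>c\<bar> * real n" by algebra
    ultimately show "\<bar>real n - c\<bar> \<le> (1 + \<bar>c\<bar>) * (1 + real n)" by linarith
  qed simp
  show "integrable (measure_pmf (exit_law a b)) (\<lambda>n. (real n - c) ^ k)"
    by (rule integrable_exit_law[where C="(1 + \<bar>c\<bar>) ^ k" and k=k]) (use * in \<open>auto simp: power_abs\<close>)
  show "integrable (measure_pmf (exit_law a b)) (\<lambda>n. \<bar>real n - c\<bar> ^ k)"
    by (rule integrable_exit_law[where C="(1 + \<bar>c\<bar>) ^ k" and k=k]) (use * in \<open>auto simp: power_abs\<close>)
qed

lemma AE_exit_law: "z \<ge> 1 \<Longrightarrow> AE n in exit_law z 1. n \<ge> 1"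
  using set_exit_law[of 1 "z - 1"] by (intro AE_pmfI) auto

text \<open>\<open>real n - 1/2\<close> and \<open>s\<close> are the centred coordinates in which
  the power sums up to \<open>n - 1\<close> and up to \<open>z\<close> take the same form;
  \<open>D n / 2\<close> is then the martingale of order one at the exit.\<close>

context
  fixes z :: nat and s :: real and D :: "nat \<Rightarrow> real"
  assumes z: "z \<ge> 1"
  defines "s \<equiv> real z + 1/2"
  defines "D \<equiv> \<lambda>n. (real n - 1/2)^2 - s^2"
begin

lemma exit_shifted_1: "shifted_power_sum z 1 0 n = D n / 2"
  using power_sum_1[of n] power_sum_1[of "Suc z"]
  by (simp add: shifted_power_sum_def D_def s_def algebra_simps)

lemma exit_shifted_2:
  "shifted_power_sum z 2 0 n = ((real n - 1/2)^3 - (real n - 1/2) / 4) / 3 + (s^3 - s / 4) / 3"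
proof -
  have s: "real (Suc z) - 1/2 = s" by (simp add: s_def)
  have "power_sum 2 z = (s^3 - s / 4) / 3" using power_sum_2[of "Suc z", unfolded s] by simp
  then show ?thesis unfolding shifted_power_sum_def power_sum_2 by simp
qed

lemma integrable_exit_D:
  "integrable (measure_pmf (exit_law z 1)) (\<lambda>n. D n ^ k)"
  "integrable (measure_pmf (exit_law z 1)) (\<lambda>n. \<bar>D n\<bar> ^ k)"
proof -
  have "\<bar>D n\<bar> \<le> (1 + s^2) * (1 + real n)^2" for n
  proof -
    have "(real n - 1/2)^2 \<le> (1 + real n)^2" by (simp add: power2_eq_square algebra_simps)
    moreover have "s^2 * 1 \<le> s^2 * (1 + real n)^2" by (intro mult_left_mono) (auto simp: one_le_power)
    moreover have "(1 + s^2) * (1 + real n)^2 = (1 + real n)^2 + s^2 * (1 + real n)^2" by algebra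
    moreover have "0 \<le> (real n - 1/2)^2" "0 \<le> s^2" "0 \<le> (1 + real n)^2" by auto
    ultimately show ?thesis unfolding D_def by linarith
  qed
  then have "\<bar>D n ^ k\<bar> \<le> (1 + s^2) ^ k * (1 + real n) ^ (2 * k)" for n
    unfolding power_abs power_mult power_mult_distrib[symmetric] by (intro power_mono) auto
  then show *: "integrable (measure_pmf (exit_law z 1)) (\<lambda>n. D n ^ k)"
    by (rule integrable_exit_law)
  from integrable_abs[OF *] show "integrable (measure_pmf (exit_law z 1)) (\<lambda>n. \<bar>D n\<bar> ^ k)"
    by (simp add: power_abs)
qed

text \<open>\<open>D\<close> has mean zero. The identity is exact, and this is what later yields the
  mean of the increment from its second moment.\<close>

lemma exit_second: "measure_pmf.expectation (exit_law z 1) (\<lambda>n. (real n - 1/2)^2) = s^2"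
proof -
  have "0 = measure_pmf.expectation (exit_law z 1) (\<lambda>n. D n / 2)"
    using exit_shifted_power_sum_1[of z] by (simp only: exit_shifted_1[abs_def] ext)
  then show ?thesis using integrable_exit_power[of z 1 "1/2" 2] by (simp add: D_def)
qed

text \<open>The upper bound is Cauchy-Schwarz with the exact second moment, linearised by the
  inequality of arithmetic and geometric means.\<close>

lemma exit_mean_bounds:
  "0 \<le> measure_pmf.expectation (exit_law z 1) (\<lambda>n. real n - 1/2)"
  "measure_pmf.expectation (exit_law z 1) (\<lambda>n. real n - 1/2) \<le> s"
proof -
  have int: "integrable (measure_pmf (exit_law z 1)) (\<lambda>n. real n - 1/2)"
    using integrable_exit_power[of z 1 "1/2" 1] by simp
  show "0 \<le> measure_pmf.expectation (exit_law z 1) (\<lambda>n. real n - 1/2)"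
    using AE_exit_law[OF z] by (intro integral_nonneg_AE) (auto elim: eventually_mono)
  have "s > 0" by (simp add: s_def)
  have "measure_pmf.expectation (exit_law z 1) (\<lambda>n. real n - 1/2)
      \<le> measure_pmf.expectation (exit_law z 1) (\<lambda>n. ((real n - 1/2)^2 / s + s) / 2)"
  proof (intro integral_mono int)
    fix n
    have "0 \<le> (real n - 1/2 - s)^2" by simp
    then show "real n - 1/2 \<le> ((real n - 1/2)^2 / s + s) / 2"
      using \<open>s > 0\<close> by (simp add: field_simps power2_eq_square)
  qed (use integrable_exit_power[of z 1 "1/2" 2] in simp)
  also have "\<dots> = s"
    using integrable_exit_power[of z 1 "1/2" 2] exit_second \<open>s > 0\<close> by (simp add: power2_eq_square)
  finally show "measure_pmf.expectation (exit_law z 1) (\<lambda>n. real n - 1/2) \<le> s" .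
qed

text \<open>The martingale of order two at the exit. The identity is not closed, as a third moment
  occurs. Once that is known to be near \<open>s^3\<close>, the right side is near
  \<open>8/3 * s^3\<close>, and division by \<open>4 * s^2\<close> gives the second moment
  \<open>2/3 * s\<close> of the increment.\<close>

lemma exit_D_second:
  "measure_pmf.expectation (exit_law z 1) (\<lambda>n. D n ^ 2) =
     4/3 * (measure_pmf.expectation (exit_law z 1) (\<lambda>n. (real n - 1/2)^3) + s^3)
     - (measure_pmf.expectation (exit_law z 1) (\<lambda>n. real n - 1/2) + s) / 3"
proof -
  note i = integrable_exit_D(1)[of 2] integrable_exit_power(1)[of z 1 "1/2" 3]
    integrable_exit_power(1)[of z 1 "1/2" 1, simplified]
  have "harmonic2 z 0 = (\<lambda>n. D n ^ 2 / 4 - (((real n - 1/2)^3 - (real n - 1/2) / 4) / 3 + (s^3 - s / 4) / 3))"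
    by (auto simp: fun_eq_iff harmonic2_def exit_shifted_2 exit_shifted_1[unfolded One_nat_def] power_divide)
  then have "0 = measure_pmf.expectation (exit_law z 1)
    (\<lambda>n. D n ^ 2 / 4 - (((real n - 1/2)^3 - (real n - 1/2) / 4) / 3 + (s^3 - s / 4) / 3))"
    using exit_harmonic2[of z] by simp
  also have "\<dots> = measure_pmf.expectation (exit_law z 1) (\<lambda>n. D n ^ 2) / 4
     - ((measure_pmf.expectation (exit_law z 1) (\<lambda>n. (real n - 1/2)^3)
         - measure_pmf.expectation (exit_law z 1) (\<lambda>n. real n - 1/2) / 4) / 3 + (s^3 - s / 4) / 3)"
    using i by simp
  finally show ?thesis by (simp add: field_simps)
qed

text \<open>The leading term is \<open>D^4 / 16\<close>. Half of it absorbs the mixed term by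
  completing the square. The product of the first and third power sums is nonnegative by Nicomachus'
  identity. The rest is of order \<open>v^6 + s^6\<close> with \<open>v^2 = s^2 + D\<close>, thus of
  order \<open>s^6 + \<bar>D\<bar>^3\<close>, and a quarter of the leading term pays for the
  cube.\<close>

lemma harmonic4_exit_ge:
  assumes "n \<ge> 1"
  shows "harmonic4 z 0 n \<ge> D n ^ 4 / 64 - 30 * s ^ 6 - 24 * 1536 ^ 3"
proof -
  define v where "v = real n - 1/2"
  have v: "v \<ge> 1/2" and s: "s \<ge> 3/2" using assms z by (auto simp: v_def s_def)
  define A2 where "A2 = shifted_power_sum z 2 0 n"
  define A3 where "A3 = shifted_power_sum z 3 0 n"
  define A4 where "A4 = shifted_power_sum z 4 0 n"
  have A1: "shifted_power_sum z 1 0 n = D n / 2" by (rule exit_shifted_1)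
  have "A3 = power_sum 3 (n - 1) - power_sum 3 (Suc z - 1)" by (simp add: A3_def shifted_power_sum_def)
  also have "\<dots> = (power_sum 1 (n - 1) - power_sum 1 z) * (power_sum 1 (n - 1) + power_sum 1 z)"
    unfolding power_sum_3 by (simp add: power2_eq_square algebra_simps)
  also have "power_sum 1 (n - 1) - power_sum 1 z = D n / 2"
    using A1 by (simp add: shifted_power_sum_def)
  finally have "D n / 2 * A3 = (D n / 2)^2 * (power_sum 1 (n - 1) + power_sum 1 z)"
    by (simp add: power2_eq_square)
  then have A3: "D n / 2 * A3 \<ge> 0"
    by (simp only:) (intro mult_nonneg_nonneg add_nonneg_nonneg power_sum_nonneg zero_le_power2)
  have "A2 = (v^3 - v/4)/3 + (s^3 - s/4)/3" by (simp add: A2_def exit_shifted_2 v_def)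
  moreover have A2_nn: "0 \<le> A2"
    unfolding A2_def shifted_power_sum_def by (simp add: power_sum_nonneg)
  ultimately have "A2 \<le> (v^3 + s^3)/3" using v s by (simp add: add_divide_distrib diff_divide_distrib)
  note A2 = A2_nn this
  have "A2^2 \<le> ((v^3 + s^3)/3)^2" using A2 by (intro power_mono) auto
  also have "\<dots> \<le> 2/9 * ((v^3)^2 + (s^3)^2)"
    using zero_le_power2[of "v^3 - s^3"] by (simp add: power_divide power2_sum power2_diff algebra_simps)
  finally have A2': "A2^2 \<le> 2/9 * (v^6 + s^6)" by simp
  have "A4 = power_sum 4 (n - 1) + power_sum 4 (Suc z - 1)" by (simp add: A4_def shifted_power_sum_def)
  also have "\<dots> \<le> v^5/5 + s^5/5"
    using power_sum_4_le[OF assms] power_sum_4_le[of "Suc z"] by (simp add: v_def s_def algebra_simps)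
  also have "v^5 \<le> 2 * v^6" using v by (simp add: power_numeral_reduce)
  also have "s^5 \<le> 2 * s^6" using s by (simp add: power_numeral_reduce)
  finally have A4: "A4 \<le> 2/5 * (v^6 + s^6)" by simp
  have "v^2 = s^2 + D n" by (simp add: D_def v_def)
  moreover have "0 \<le> v^2" by simp
  ultimately have sD: "0 \<le> s^2 + D n" by simp
  from \<open>v^2 = s^2 + D n\<close> have "v^6 = (s^2 + D n)^3" by (metis mult_2_right numeral_Bit0 power_mult num_double numeral_times_numeral mult_numeral_1 power_even_eq)
  also have "\<dots> \<le> (s^2 + \<bar>D n\<bar>)^3" using sD by (intro power_mono) auto
  also have "\<dots> \<le> 4 * ((s^2)^3 + \<bar>D n\<bar>^3)"
  proof -
    have "(a + b)^3 \<le> 4 * (a^3 + b^3)" if "a \<ge> 0" "b \<ge> 0" for a b :: real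
    proof -
      have "4 * (a^3 + b^3) - (a + b)^3 = 3 * ((a + b) * (a - b)^2)" by algebra
      also have "\<dots> \<ge> 0" using that by simp
      finally show ?thesis by simp
    qed
    then show ?thesis by (simp only: zero_le_power2 abs_ge_zero)
  qed
  finally have v6: "v^6 \<le> 4 * s^6 + 4 * \<bar>D n\<bar>^3" by simp
  \<comment> \<open>\<open>1536 = 24 * 64\<close> is where \<open>24 * \<bar>D n\<bar>^3\<close>
    falls below \<open>D n ^ 4 / 64\<close>; smaller values go into the additive constant.\<close>
  have d3: "24 * \<bar>D n\<bar>^3 \<le> D n ^ 4 / 64 + 24 * 1536^3"
  proof (cases "\<bar>D n\<bar> \<ge> 1536")
    case True
    have "24 * 64 * \<bar>D n\<bar>^3 \<le> \<bar>D n\<bar> * \<bar>D n\<bar>^3" using True by (intro mult_right_mono) auto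
    also have "\<dots> = \<bar>D n\<bar> ^ 4" by algebra
    also have "\<dots> = D n ^ 4" by simp
    finally show ?thesis by simp
  next
    case False
    then have "\<bar>D n\<bar>^3 \<le> 1536^3" by (intro power_mono) auto
    moreover have "0 \<le> D n ^ 4 / 64" by simp
    ultimately show ?thesis by linarith
  qed
  have "0 \<le> ((D n / 2)^2 - 6 * A2)^2" by simp
  then have "6 * (D n / 2)^2 * A2 \<le> (D n / 2)^4 / 2 + 18 * A2^2"
    by (simp add: power2_diff power_mult_distrib algebra_simps)
  moreover have "harmonic4 z 0 n = (D n / 2)^4 - 6 * (D n / 2)^2 * A2 + 3 * A2^2 + 8 * (D n / 2 * A3) - 6 * A4"
    by (simp add: harmonic4_def A1[unfolded One_nat_def] A2_def A3_def A4_def)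
  moreover have "(D n / 2)^4 = D n ^ 4 / 16" by (simp add: power_divide)
  moreover have "0 \<le> \<bar>D n\<bar>^3" "0 \<le> s^6" by auto
  \<comment> \<open>\<open>18 - 3 = 15\<close> copies of \<open>A2^2\<close> and \<open>6\<close> of
    \<open>A4\<close> contribute less than \<open>15 * 2/9 + 6 * 2/5 < 6\<close> times
    \<open>v^6 + s^6\<close>; with \<open>v6\<close> this gives \<open>30 = 6 * 5\<close> and
    \<open>24 = 6 * 4\<close>.\<close>
  ultimately show ?thesis using A2' A4 A3 v6 d3 unfolding distrib_left by linarith
qed

text \<open>\<open>harmonic4\<close> has mean zero at the exit, so its lower bound has mean at most
  zero; \<open>1 \<le> s^6\<close> absorbs the constant.\<close>

lemma exit_D_fourth:
  "measure_pmf.expectation (exit_law z 1) (\<lambda>n. D n ^ 4) \<le> 64 * (30 + 24 * 1536 ^ 3) * s ^ 6"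
proof -
  have "measure_pmf.expectation (exit_law z 1) (\<lambda>n. D n ^ 4 / 64 - 30 * s ^ 6 - 24 * 1536 ^ 3)
    \<le> measure_pmf.expectation (exit_law z 1) (harmonic4 z 0)"
  proof (rule integral_mono_AE[OF _ integrable_exit_harmonic4])
    show "AE n in exit_law z 1. D n ^ 4 / 64 - 30 * s ^ 6 - 24 * 1536 ^ 3 \<le> harmonic4 z 0 n"
      using AE_exit_law[OF z] by eventually_elim (rule harmonic4_exit_ge)
  qed (use integrable_exit_D(1)[of 4] in simp)
  then have "measure_pmf.expectation (exit_law z 1) (\<lambda>n. D n ^ 4) \<le> 64 * (30 * s ^ 6 + 24 * 1536 ^ 3)"
    using integrable_exit_D(1)[of 4] by (simp add: exit_harmonic4[unfolded One_nat_def])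
  moreover have "1 \<le> s^6" using z by (intro one_le_power) (simp add: s_def)
  ultimately show ?thesis by simp
qed

text \<open>\<open>v - s = D / (v + s)\<close> with \<open>v = n - 1/2\<close> turns the moments of \<open>D\<close> into those of the increment
  \<open>v - s\<close>; the orders of magnitude are tracked in powers of \<open>r = sqrt s\<close>.\<close>

lemma exit_increment_moments:
  fixes K2 K4 r :: real and w :: "nat \<Rightarrow> real"
  defines "K4 \<equiv> 64 * (30 + 24 * 1536 ^ 3)"
  defines "r \<equiv> sqrt s" and "w \<equiv> \<lambda>n. real n - real z - 1"
  shows "\<bar>measure_pmf.expectation (exit_law z 1) w + 1/3\<bar> \<le> 2 * K4 / r"
    and "\<bar>measure_pmf.expectation (exit_law z 1) (\<lambda>n. w n ^ 2) - 2/3 * r^2\<bar> \<le> 4 * K4 * r"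
    and "measure_pmf.expectation (exit_law z 1) (\<lambda>n. w n ^ 4) \<le> K4 * r ^ 4"
proof -
  let ?E = "measure_pmf.expectation (exit_law z 1)"
  define v where "v n = real n - 1/2" for n :: nat
  have r: "s = r^2" "r \<ge> 1" "r > 0" using z by (auto simp: r_def s_def)
  have K4: "K4 \<ge> 1000" by (simp add: K4_def)
  have Dv: "D n = v n ^ 2 - (r^2)^2" for n by (simp add: D_def v_def r)
  have wv: "w n = v n - r^2" for n using r(1) by (simp add: w_def v_def s_def)
  have Dw: "D n = w n * (v n + r^2)" for n unfolding Dv wv by algebra
  have AEv: "AE n in exit_law z 1. v n > 0"
    using AE_exit_law[OF z] by eventually_elim (simp add: v_def)
  note iD = integrable_exit_D
  have iv [simp]: "integrable (measure_pmf (exit_law z 1)) (\<lambda>n. v n ^ k)" for k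
    unfolding v_def by (rule integrable_exit_power)
  have iw [simp]: "integrable (measure_pmf (exit_law z 1)) (\<lambda>n. w n ^ k)" for k
    using integrable_exit_power(1)[of z 1 "real z + 1" k] by (simp add: w_def algebra_simps)
  have iv1 [simp]: "integrable (measure_pmf (exit_law z 1)) v" using iv[of 1] by simp
  have iw1 [simp]: "integrable (measure_pmf (exit_law z 1)) w" using iw[of 1] by simp
  note [simp] = iv[unfolded One_nat_def] iw[unfolded One_nat_def] iv1[unfolded One_nat_def] iw1[unfolded One_nat_def]
  have Ev2: "?E (\<lambda>n. v n ^ 2) = (r^2)^2" using exit_second by (simp add: v_def r)
  have Ev: "0 \<le> ?E v" "?E v \<le> r^2" using exit_mean_bounds by (simp_all add: v_def[abs_def] r)
  have D4: "?E (\<lambda>n. D n ^ 4) \<le> K4 * r ^ 12"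
    using exit_D_fourth by (simp add: K4_def r power_mult[symmetric])
  \<comment> \<open>The typical size of \<open>D\<close> is \<open>r^3\<close>; the weight
    \<open>r^6\<close> balances the two halves of the arithmetic-geometric inequality. The same
    principle fixes the weights for \<open>D3\<close> and \<open>v3\<close>.\<close>
  have D2: "?E (\<lambda>n. D n ^ 2) \<le> (K4 + 1) / 2 * r ^ 6"
  proof -
    have "?E (\<lambda>n. D n ^ 2) \<le> ?E (\<lambda>n. (D n ^ 4 / r^6 + r^6) / 2)"
    proof (rule integral_mono)
      fix n
      have "0 \<le> (D n ^ 2 - r^6)^2" by simp
      also have "\<dots> = D n ^ 4 - 2 * r^6 * D n ^ 2 + r^6 * r^6" by algebra
      finally show "D n ^ 2 \<le> (D n ^ 4 / r^6 + r^6) / 2" using r by (simp add: field_simps)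
    qed (use iD(1)[of 4] iD(1)[of 2] in auto)
    also have "\<dots> = (?E (\<lambda>n. D n ^ 4) / r^6 + r^6) / 2" using iD(1)[of 4] by simp
    also have "\<dots> \<le> (K4 * r ^ 12 / r^6 + r^6) / 2"
      using D4 r by (intro divide_right_mono add_right_mono) auto
    also have "K4 * r ^ 12 / r^6 = K4 * r^6" using r by (simp add: power_numeral_reduce)
    finally show ?thesis by (simp add: algebra_simps)
  qed
  have D3: "?E (\<lambda>n. \<bar>D n\<bar> ^ 3) \<le> K4 * r ^ 9"
  proof -
    have "?E (\<lambda>n. \<bar>D n\<bar> ^ 3) \<le> ?E (\<lambda>n. (D n ^ 4 / r^3 + r^3 * D n ^ 2) / 2)"
    proof (rule integral_mono)
      fix n
      have "0 \<le> \<bar>D n\<bar>^2 * (\<bar>D n\<bar> - r^3)^2" by simp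
      also have "\<dots> = \<bar>D n\<bar>^4 - 2 * r^3 * \<bar>D n\<bar>^3 + r^3 * r^3 * \<bar>D n\<bar>^2" by algebra
      finally show "\<bar>D n\<bar> ^ 3 \<le> (D n ^ 4 / r^3 + r^3 * D n ^ 2) / 2" using r by (simp add: field_simps)
    qed (use iD(1)[of 4] iD(1)[of 2] iD(2)[of 3] in auto)
    also have "\<dots> = (?E (\<lambda>n. D n ^ 4) / r^3 + r^3 * ?E (\<lambda>n. D n ^ 2)) / 2"
      using iD(1)[of 4] iD(1)[of 2] by simp
    also have "\<dots> \<le> (K4 * r ^ 12 / r^3 + r^3 * ((K4 + 1) / 2 * r ^ 6)) / 2"
      using D4 D2 r by (intro divide_right_mono add_mono mult_left_mono) auto
    also have "\<dots> = (K4 + (K4 + 1) / 2) / 2 * r^9" using r by (simp add: power_numeral_reduce field_simps)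
    also have "\<dots> \<le> K4 * r^9" using K4 r by (intro mult_right_mono) auto
    finally show ?thesis .
  qed
  \<comment> \<open>\<open>\<bar>v^3 - s^3\<bar>\<close> is at most
    \<open>\<bar>D\<bar> * (v + s)\<close>, because \<open>v^2 + v * s + s^2 \<le> (v + s)^2\<close>
    and \<open>D = w * (v + s)\<close>.\<close>
  have v3: "\<bar>?E (\<lambda>n. v n ^ 3) - r^6\<bar> \<le> ((K4 + 1) / 2 + 4) / 2 * r^5"
  proof -
    have "\<bar>?E (\<lambda>n. v n ^ 3) - r^6\<bar> = \<bar>?E (\<lambda>n. v n ^ 3 - r^6)\<bar>" by simp
    also have "\<dots> \<le> ?E (\<lambda>n. \<bar>v n ^ 3 - r^6\<bar>)" by (rule integral_abs_bound)
    also have "\<dots> \<le> ?E (\<lambda>n. (D n ^ 2 / r + r * (2 * v n ^ 2 + 2 * (r^2)^2)) / 2)"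
    proof (rule integral_mono_AE)
      show "AE n in exit_law z 1. \<bar>v n ^ 3 - r^6\<bar> \<le> (D n ^ 2 / r + r * (2 * v n ^ 2 + 2 * (r^2)^2)) / 2"
        using AEv
      proof eventually_elim
        case (elim n)
        have "v n ^ 3 - r^6 = w n * (v n ^ 2 + v n * r^2 + (r^2)^2)" unfolding wv by algebra
        also have "\<bar>\<dots>\<bar> = \<bar>w n\<bar> * (v n ^ 2 + v n * r^2 + (r^2)^2)" using elim r by (simp add: abs_mult)
        also have "\<dots> \<le> \<bar>w n\<bar> * (v n + r^2)^2"
          using elim r by (intro mult_left_mono) (auto simp: power2_eq_square algebra_simps)
        also have "\<dots> = \<bar>D n\<bar> * (v n + r^2)" unfolding Dw abs_mult using elim r
          by (simp add: power2_eq_square)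
        also have "\<dots> \<le> (\<bar>D n\<bar> ^ 2 / r + r * (v n + r^2)^2) / 2"
        proof -
          have "0 \<le> (\<bar>D n\<bar> - r * (v n + r^2))^2" by simp
          also have "\<dots> = \<bar>D n\<bar>^2 - 2 * r * (\<bar>D n\<bar> * (v n + r^2)) + r * (r * (v n + r^2)^2)" by algebra
          finally show ?thesis using r by (simp add: field_simps)
        qed
        also have "(v n + r^2)^2 \<le> 2 * v n ^ 2 + 2 * (r^2)^2"
          using zero_le_power2[of "v n - r^2"] by (simp add: power2_sum power2_diff)
        finally show ?case using r by simp
      qed
    qed (use iD(1)[of 2] in \<open>auto intro!: integrable_abs\<close>)
    also have "\<dots> = (?E (\<lambda>n. D n ^ 2) / r + r * (2 * (r^2)^2 + 2 * (r^2)^2)) / 2"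
      using iD(1)[of 2] Ev2 by simp
    also have "\<dots> \<le> ((K4 + 1) / 2 * r ^ 6 / r + r * (2 * (r^2)^2 + 2 * (r^2)^2)) / 2"
      using D2 r by (intro divide_right_mono add_right_mono) auto
    also have "\<dots> = ((K4 + 1) / 2 + 4) / 2 * r^5" using r by (simp add: power_numeral_reduce field_simps)
    finally show ?thesis .
  qed
  have D2': "\<bar>?E (\<lambda>n. D n ^ 2) - 8/3 * r^6\<bar> \<le> K4 * r^5"
  proof -
    have aux: "\<bar>d\<bar> \<le> k" if "d = 4/3 * x - (e + q) / 3" "q \<le> p" "1000 * p \<le> k" "\<bar>x\<bar> \<le> b"
      "b = 1/4 * k + 9/4 * p" "0 \<le> e" "e \<le> q" for d x e q p k b :: real
      using that unfolding abs_le_iff by argo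
    show ?thesis
    proof (rule aux)
      show "?E (\<lambda>n. D n ^ 2) - 8/3 * r^6 = 4/3 * (?E (\<lambda>n. v n ^ 3) - r^6) - (?E v + r^2) / 3"
        using exit_D_second by (simp add: r power_mult[symmetric] flip: v_def[abs_def]) (simp add: v_def)
      show "r^2 \<le> r^5" using r by (intro power_increasing) auto
      show "1000 * r^5 \<le> K4 * r^5" using K4 r by (intro mult_right_mono) auto
      show "((K4 + 1) / 2 + 4) / 2 * r^5 = 1/4 * (K4 * r^5) + 9/4 * r^5" by (simp add: field_simps)
    qed (use v3 Ev in auto)
  qed
  \<comment> \<open>Replacing \<open>v + s\<close> by \<open>2 * s\<close> in
    \<open>w = D / (v + s)\<close> costs a relative error of order \<open>w / s\<close>, hence a
    third absolute moment of \<open>D\<close>.\<close>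
  have w2: "\<bar>?E (\<lambda>n. w n ^ 2) - ?E (\<lambda>n. D n ^ 2) / (4 * r^4)\<bar> \<le> 3/4 * (K4 * r)"
  proof -
    have "\<bar>?E (\<lambda>n. w n ^ 2) - ?E (\<lambda>n. D n ^ 2) / (4 * r^4)\<bar> = \<bar>?E (\<lambda>n. w n ^ 2 - D n ^ 2 / (4 * r^4))\<bar>"
      using iD(1)[of 2] by simp
    also have "\<dots> \<le> ?E (\<lambda>n. \<bar>w n ^ 2 - D n ^ 2 / (4 * r^4)\<bar>)" by (rule integral_abs_bound)
    also have "\<dots> \<le> ?E (\<lambda>n. 3/4 * \<bar>D n\<bar>^3 / r^8)"
    proof (rule integral_mono_AE)
      show "AE n in exit_law z 1. \<bar>w n ^ 2 - D n ^ 2 / (4 * r^4)\<bar> \<le> 3/4 * \<bar>D n\<bar>^3 / r^8"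
        using AEv
      proof eventually_elim
        case (elim n)
        have wD: "\<bar>w n\<bar> \<le> \<bar>D n\<bar> / r^2"
          unfolding Dw abs_mult using elim r by (simp add: field_simps)
        have "w n ^ 2 - D n ^ 2 / (4 * r^4) = w n ^ 2 * (4 * r^4 - (v n + r^2)^2) / (4 * r^4)"
          unfolding Dw power_mult_distrib right_diff_distrib diff_divide_distrib using r by simp
        also have "4 * r^4 - (v n + r^2)^2 = - w n * (v n + 3 * r^2)" unfolding wv by algebra
        also have "\<bar>w n ^ 2 * (- w n * (v n + 3 * r^2)) / (4 * r^4)\<bar> = w n ^ 2 * (\<bar>w n\<bar> * (v n + 3 * r^2)) / (4 * r^4)"
          using elim r by (simp add: abs_mult)
        also have "\<dots> \<le> w n ^ 2 * (\<bar>w n\<bar> * (3 * (v n + r^2))) / (4 * r^4)"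
          using elim r by (intro divide_right_mono mult_left_mono) auto
        also have "\<bar>w n\<bar> * (3 * (v n + r^2)) = 3 * \<bar>D n\<bar>" unfolding Dw abs_mult using elim r by simp
        also have "w n ^ 2 * (3 * \<bar>D n\<bar>) / (4 * r^4) \<le> (\<bar>D n\<bar> / r^2)^2 * (3 * \<bar>D n\<bar>) / (4 * r^4)"
          using power_mono[OF wD, of 2] by (intro divide_right_mono mult_right_mono) auto
        also have "\<dots> = 3/4 * \<bar>D n\<bar>^3 / r^8" using r by (simp add: power_numeral_reduce field_simps)
        finally show ?case .
      qed
    qed (use iD(1)[of 2] iD(2)[of 3] in \<open>auto intro!: integrable_abs\<close>)
    also have "\<dots> = 3/4 * ?E (\<lambda>n. \<bar>D n\<bar>^3) / r^8" using iD(2)[of 3] by simp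
    also have "\<dots> \<le> 3/4 * (K4 * r^9) / r^8"
      using D3 r by (intro divide_right_mono mult_left_mono) auto
    also have "\<dots> = 3/4 * (K4 * r)" using r by (simp add: power_numeral_reduce)
    finally show ?thesis .
  qed
  have "\<bar>?E (\<lambda>n. D n ^ 2) / (4 * r^4) - 2/3 * r^2\<bar> \<le> 1/4 * (K4 * r)"
  proof -
    have "?E (\<lambda>n. D n ^ 2) / (4 * r^4) - 2/3 * r^2 = (?E (\<lambda>n. D n ^ 2) - 8/3 * r^6) / (4 * r^4)"
      using r by (simp add: diff_divide_distrib power_numeral_reduce)
    also have "\<bar>\<dots>\<bar> \<le> K4 * r^5 / (4 * r^4)"
      using D2' r by (simp only: abs_divide) (intro frac_le, auto)
    also have "\<dots> = 1/4 * (K4 * r)" using r by (simp add: power_numeral_reduce)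
    finally show ?thesis .
  qed
  with w2 have w2': "\<bar>?E (\<lambda>n. w n ^ 2) - 2/3 * r^2\<bar> \<le> K4 * r" by linarith
  moreover have "0 \<le> K4 * r" using K4 r by simp
  ultimately show "\<bar>?E (\<lambda>n. w n ^ 2) - 2/3 * r^2\<bar> \<le> 4 * K4 * r" by linarith
  \<comment> \<open>As the mean of \<open>v^2\<close> is exactly \<open>s^2\<close>, expanding the
    square leaves \<open>2 * s * E w = - E (w^2)\<close>: the mean \<open>-1/3\<close> is minus half
    the coefficient \<open>2/3\<close>.\<close>
  have "v n ^ 2 = (r^2)^2 + 2 * r^2 * w n + w n ^ 2" for n unfolding wv by algebra
  with Ev2 have "(r^2)^2 = (r^2)^2 + 2 * r^2 * ?E w + ?E (\<lambda>n. w n ^ 2)" by simp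
  then have "?E w = - ?E (\<lambda>n. w n ^ 2) / (2 * r^2)" using r by (simp add: field_simps)
  then have "?E w + 1/3 = - ((?E (\<lambda>n. w n ^ 2) - 2/3 * r^2) / (2 * r^2))"
    using r by (simp add: field_simps)
  then have "\<bar>?E w + 1/3\<bar> = \<bar>?E (\<lambda>n. w n ^ 2) - 2/3 * r^2\<bar> / (2 * r^2)" by simp
  also have "\<dots> \<le> K4 * r / (2 * r^2)" using w2' r by (intro divide_right_mono) auto
  also have "\<dots> \<le> 2 * K4 / r" using r K4 by (simp add: field_simps power2_eq_square)
  finally show "\<bar>?E w + 1/3\<bar> \<le> 2 * K4 / r" .
  have "?E (\<lambda>n. w n ^ 4) \<le> ?E (\<lambda>n. D n ^ 4 / r^8)"
  proof (rule integral_mono_AE)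
    show "AE n in exit_law z 1. w n ^ 4 \<le> D n ^ 4 / r^8"
      using AEv
    proof eventually_elim
      case (elim n)
      have "\<bar>w n\<bar> \<le> \<bar>D n\<bar> / r^2"
        unfolding Dw abs_mult using elim r by (simp add: field_simps)
      from power_mono[OF this, of 4] show ?case by (simp add: power_divide)
    qed
  qed (use iD(1)[of 4] in auto)
  also have "\<dots> \<le> K4 * r ^ 12 / r^8" using iD(1)[of 4] D4 r by (simp add: divide_right_mono)
  also have "\<dots> = K4 * r^4" using r by (simp add: power_numeral_reduce)
  finally show "?E (\<lambda>n. w n ^ 4) \<le> K4 * r ^ 4" .
qed

end

lemma exit_increment:
  obtains C where "C \<ge> 1"
    and "\<And>z. z \<ge> 1 \<Longrightarrow> \<bar>measure_pmf.expectation (exit_law z 1) (\<lambda>n. real n - real z - 1) + 1/3\<bar> \<le> C / sqrt z"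
    and "\<And>z. z \<ge> 1 \<Longrightarrow> \<bar>measure_pmf.expectation (exit_law z 1) (\<lambda>n. (real n - real z - 1)^2) - 2/3 * z\<bar> \<le> C * sqrt z"
    and "\<And>z. z \<ge> 1 \<Longrightarrow> measure_pmf.expectation (exit_law z 1) (\<lambda>n. (real n - real z - 1)^4) \<le> C * real z ^ 2"
proof
  define K :: real where "K = 64 * (30 + 24 * 1536 ^ 3)"
  have K: "K \<ge> 1" by (simp add: K_def)
  \<comment> \<open>\<open>16 = 2 ^ 4\<close> comes from \<open>r \<le> 2 * q\<close> in the fourth
    moment; it also covers the change from \<open>z + 1/2\<close> to \<open>z\<close> in the other
    two.\<close>
  show "16 * K \<ge> 1" using K by simp
  fix z :: nat assume z: "z \<ge> 1"
  note M = exit_increment_moments[OF z, folded K_def]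
  define r where "r = sqrt (real z + 1/2)"
  define q where "q = sqrt z"
  have q: "q \<ge> 1" "q^2 = z" using z by (auto simp: q_def)
  have r: "q \<le> r" "r \<le> 2 * q"
    unfolding q_def r_def using z by (auto intro!: real_le_lsqrt simp: power_mult_distrib)
  have "2 * K / r \<le> 16 * K / q" using r q K by (intro frac_le) auto
  with M(1) show "\<bar>measure_pmf.expectation (exit_law z 1) (\<lambda>n. real n - real z - 1) + 1/3\<bar> \<le> 16 * K / sqrt z"
    by (simp add: r_def q_def)
  have "4 * K * r \<le> 8 * (K * q)" using r K by simp
  moreover have "1 \<le> K * q" using mult_mono[of 1 K 1 q] q K by simp
  moreover have "r^2 = z + 1/2" by (simp add: r_def)
  ultimately have "4 * K * r + 1/3 \<le> 16 * K * q" "2/3 * r^2 = 2/3 * z + 1/3" by auto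
  with M(2) show "\<bar>measure_pmf.expectation (exit_law z 1) (\<lambda>n. (real n - real z - 1)^2) - 2/3 * z\<bar> \<le> 16 * K * sqrt z"
    unfolding r_def[symmetric] q_def[symmetric] by linarith
  have "K * r^4 \<le> K * (2 * q)^4" using r q K by (intro mult_left_mono power_mono) auto
  also have "\<dots> = 16 * K * (q^2)^2" by algebra
  finally show "measure_pmf.expectation (exit_law z 1) (\<lambda>n. (real n - real z - 1)^4) \<le> 16 * K * real z ^ 2"
    using M(3) q(2) by (simp add: r_def)
qed

section \<open>The increments of the embedded chain\<close>

lemma pair_pmf_product:
  fixes f :: "'a \<Rightarrow> real" and g :: "'b \<Rightarrow> real"
  assumes f: "integrable (measure_pmf p) f" and g: "integrable (measure_pmf q) g"
  shows "integrable (measure_pmf (pair_pmf p q)) (\<lambda>(x, y). f x * g y)"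
    and "measure_pmf.expectation (pair_pmf p q) (\<lambda>(x, y). f x * g y)
           = measure_pmf.expectation p f * measure_pmf.expectation q g"
proof -
  have "(\<integral>\<^sup>+xy. ennreal (norm (case xy of (x, y) \<Rightarrow> f x * g y)) \<partial>pair_pmf p q)
      = (\<integral>\<^sup>+x. ennreal \<bar>f x\<bar> * (\<integral>\<^sup>+y. ennreal \<bar>g y\<bar> \<partial>q) \<partial>p)"
    by (simp add: nn_integral_pair_pmf' abs_mult ennreal_mult nn_integral_cmult)
  also have "\<dots> = (\<integral>\<^sup>+x. ennreal \<bar>f x\<bar> \<partial>p) * (\<integral>\<^sup>+y. ennreal \<bar>g y\<bar> \<partial>q)"
    by (simp add: nn_integral_multc)
  also have "\<dots> < \<infinity>"
    using f g by (simp add: integrable_iff_bounded ennreal_mult_less_top)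
  finally show int: "integrable (measure_pmf (pair_pmf p q)) (\<lambda>(x, y). f x * g y)"
    by (simp add: integrable_iff_bounded)
  then show "measure_pmf.expectation (pair_pmf p q) (\<lambda>(x, y). f x * g y)
           = measure_pmf.expectation p f * measure_pmf.expectation q g"
    unfolding pair_pmf_def by (subst pmf_integral_bind(2), assumption)
      (subst pmf_integral_bind(2); auto simp: bind_return_pmf' map_pmf_def[symmetric] intro!: integrable_mult_right g)
qed

definition noisy_step :: "int pmf \<Rightarrow> nat \<Rightarrow> nat pmf" where
  "noisy_step \<kappa> b = map_pmf (\<lambda>k. nat (max 1 (int b - k))) \<kappa>"

text \<open>The law of the next traversal size. The state \<open>0\<close> is never visited; \<open>max 1 z\<close> makes it a copy of \<open>1\<close>.\<close>

definition urn_chain :: "int pmf \<Rightarrow> nat \<Rightarrow> nat pmf" where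
  "urn_chain \<kappa> z = exit_law (max 1 z) 1 \<bind> noisy_step \<kappa>"

lemma urn_chain_pair:
  "z \<ge> 1 \<Longrightarrow> urn_chain \<kappa> z = map_pmf (\<lambda>(y, k). nat (max 1 (int y - k))) (pair_pmf (exit_law z 1) \<kappa>)"
  by (simp add: urn_chain_def noisy_step_def[abs_def] pair_pmf_def map_pmf_def bind_assoc_pmf
      bind_return_pmf max_def)

lemma urn_chain_pos: "n \<in> set_pmf (urn_chain \<kappa> z) \<Longrightarrow> n \<ge> 1"
  by (auto simp: urn_chain_def noisy_step_def)

section \<open>Fourth moments of the noise and of sums\<close>

lemma pow4_le_exp:
  fixes x r :: real assumes "r > 0" "x \<ge> 0" shows "x ^ 4 \<le> (4 / r) ^ 4 * exp (r * x)"
proof -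
  have "r * x / 4 \<le> exp (r * x / 4)" using exp_ge_add_one_self[of "r * x / 4"] by linarith
  then have "(r * x / 4) ^ 4 \<le> exp (r * x / 4) ^ 4" using assms by (intro power_mono) auto
  also have "\<dots> = exp (r * x)" by (simp add: exp_of_nat_mult[symmetric])
  finally have "(4 / r) ^ 4 * (r * x / 4) ^ 4 \<le> (4 / r) ^ 4 * exp (r * x)" by (intro mult_left_mono) auto
  moreover have "(4 / r) ^ 4 * (r * x / 4) ^ 4 = x ^ 4"
    using assms by (simp add: power_mult_distrib[symmetric])
  ultimately show ?thesis by simp
qed

lemma integrable_pow4_of_exp:
  assumes "r > 0" "integrable (measure_pmf \<kappa>) (\<lambda>k. exp (r * \<bar>real_of_int k\<bar>))"
  shows "integrable (measure_pmf \<kappa>) (\<lambda>k. real_of_int k ^ 4)"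
proof (rule Bochner_Integration.integrable_bound)
  show "integrable (measure_pmf \<kappa>) (\<lambda>k. (4 / r) ^ 4 * exp (r * \<bar>real_of_int k\<bar>))"
    using assms by simp
  show "AE k in \<kappa>. norm (real_of_int k ^ 4) \<le> norm ((4 / r) ^ 4 * exp (r * \<bar>real_of_int k\<bar>))"
    using pow4_le_exp[OF assms(1), of "\<bar>real_of_int k\<bar>" for k] by (auto simp: abs_mult)
qed simp

lemma pow_le_pow4: fixes x :: real assumes "k \<le> 4" shows "\<bar>x\<bar> ^ k \<le> 1 + x ^ 4"
proof (cases "\<bar>x\<bar> \<le> 1")
  case True
  then have "\<bar>x\<bar> ^ k \<le> 1" by (intro power_le_one) auto
  then show ?thesis by (smt (verit) zero_le_even_power even_numeral)
next
  case False
  then have "\<bar>x\<bar> ^ k \<le> \<bar>x\<bar> ^ 4" using assms by (intro power_increasing) auto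
  then show ?thesis by simp
qed

lemma integrable_pow_le4:
  fixes f :: "'a \<Rightarrow> real"
  assumes "integrable (measure_pmf p) (\<lambda>k. f k ^ 4)" "k \<le> 4"
  shows "integrable (measure_pmf p) (\<lambda>x. f x ^ k)" "integrable (measure_pmf p) (\<lambda>x. \<bar>f x\<bar> ^ k)"
proof -
  have i: "integrable (measure_pmf p) (\<lambda>x. 1 + f x ^ 4)" using assms by simp
  have a: "\<bar>f x\<bar> ^ k \<le> \<bar>1 + f x ^ 4\<bar>" for x
    using pow_le_pow4[OF assms(2), of "f x"] by linarith
  show "integrable (measure_pmf p) (\<lambda>x. f x ^ k)" "integrable (measure_pmf p) (\<lambda>x. \<bar>f x\<bar> ^ k)"
    by (rule Bochner_Integration.integrable_bound[OF i]; use a in \<open>simp add: power_abs\<close>)+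
qed

lemma pow4_add_le: fixes x y :: real shows "(x + y) ^ 4 \<le> 8 * x ^ 4 + 8 * y ^ 4"
proof -
  have "(x + y)^2 \<le> 2 * (x^2 + y^2)" using zero_le_power2[of "x - y"] by (simp add: power2_sum power2_diff)
  then have "((x + y)^2)^2 \<le> (2 * (x^2 + y^2))^2" by (intro power_mono) auto
  also have "\<dots> \<le> 8 * (x^2)^2 + 8 * (y^2)^2"
    using zero_le_power2[of "x^2 - y^2"] by (simp add: power2_sum power2_diff power_mult_distrib)
  finally show ?thesis by simp
qed

lemma integrable_add_pow4:
  fixes f g :: "'a \<Rightarrow> real"
  assumes "integrable (measure_pmf p) (\<lambda>k. f k ^ 4)" "integrable (measure_pmf p) (\<lambda>k. g k ^ 4)"
  shows "integrable (measure_pmf p) (\<lambda>k. (f k + g k) ^ 4)"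
proof (rule Bochner_Integration.integrable_bound)
  show "integrable (measure_pmf p) (\<lambda>k. 8 * f k ^ 4 + 8 * g k ^ 4)" using assms by simp
  have "norm ((f k + g k) ^ 4) \<le> norm (8 * f k ^ 4 + 8 * g k ^ 4)" for k
  proof -
    have "0 \<le> (f k + g k) ^ 4" by simp
    then show ?thesis using pow4_add_le[of "f k" "g k"] abs_ge_self[of "8 * f k ^ 4 + 8 * g k ^ 4"]
    unfolding real_norm_def by linarith
  qed
  then show "AE k in p. norm ((f k + g k) ^ 4) \<le> norm (8 * f k ^ 4 + 8 * g k ^ 4)" by simp
qed simp

text \<open>The increment before truncation is \<open>X = w + \<eta>\<close> with independent parts,
  of mean \<open>-1/3 + 1 - \<mu>\<close> up to the error. Truncation at \<open>1\<close> changes it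
  only where \<open>X \<le> - z\<close>, and there powers of \<open>\<bar>X\<bar> / z\<close> may be
  inserted: the fourth moment, of order \<open>z^2\<close>, makes the effect on the mean
  \<open>O(1 / z)\<close> and on the second moment \<open>O(1)\<close>.\<close>

lemma urn_chain_moments:
  assumes k4: "integrable (measure_pmf \<kappa>) (\<lambda>k. real_of_int k ^ 4)"
  defines "\<mu> \<equiv> measure_pmf.expectation \<kappa> real_of_int"
  obtains C where "C \<ge> 1"
    and "\<And>z. z \<ge> 1 \<Longrightarrow> integrable (measure_pmf (urn_chain \<kappa> z)) (\<lambda>n. (real n - real z) ^ 4)"
    and "\<And>z. z \<ge> 1 \<Longrightarrow>
      \<bar>measure_pmf.expectation (urn_chain \<kappa> z) (\<lambda>n. real n - real z) - (2/3 - \<mu>)\<bar> \<le> C / sqrt z"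
    and "\<And>z. z \<ge> 1 \<Longrightarrow>
      \<bar>measure_pmf.expectation (urn_chain \<kappa> z) (\<lambda>n. (real n - real z)^2) - 2/3 * real z\<bar> \<le> C * sqrt z"
    and "\<And>z. z \<ge> 1 \<Longrightarrow>
      measure_pmf.expectation (urn_chain \<kappa> z) (\<lambda>n. (real n - real z)^4) \<le> C * real z ^ 2"
proof -
  obtain C where C: "C \<ge> 1"
    "\<And>z. z \<ge> 1 \<Longrightarrow> \<bar>measure_pmf.expectation (exit_law z 1) (\<lambda>n. real n - real z - 1) + 1/3\<bar> \<le> C / sqrt z"
    "\<And>z. z \<ge> 1 \<Longrightarrow> \<bar>measure_pmf.expectation (exit_law z 1) (\<lambda>n. (real n - real z - 1)^2) - 2/3 * z\<bar> \<le> C * sqrt z"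
    "\<And>z. z \<ge> 1 \<Longrightarrow> measure_pmf.expectation (exit_law z 1) (\<lambda>n. (real n - real z - 1)^4) \<le> C * real z ^ 2"
    using exit_increment by blast
  \<comment> \<open>The summand \<open>1\<close> undoes the \<open>- 1\<close> in \<open>w\<close>,
    so that \<open>w + \<eta>\<close> is the exit point minus the noise minus
    \<open>z\<close>.\<close>
  define \<eta> where "\<eta> k = 1 - real_of_int k" for k
  have i\<eta>4: "integrable (measure_pmf \<kappa>) (\<lambda>k. \<eta> k ^ 4)"
    using integrable_add_pow4[of \<kappa> "\<lambda>_. 1" "\<lambda>k. - real_of_int k"] k4 by (simp add: \<eta>_def)
  note i\<eta> = integrable_pow_le4[OF i\<eta>4]
  define m1 where "m1 = measure_pmf.expectation \<kappa> \<eta>"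
  define m2 where "m2 = measure_pmf.expectation \<kappa> (\<lambda>k. \<eta> k ^ 2)"
  define m4 where "m4 = measure_pmf.expectation \<kappa> (\<lambda>k. \<eta> k ^ 4)"
  have m: "m2 \<ge> 0" "m4 \<ge> 0" by (auto simp: m2_def m4_def intro!: integral_nonneg_AE)
  have m1: "m1 = 1 - \<mu>"
    using integrable_pow_le4(1)[OF k4, of 1] by (simp add: m1_def \<eta>_def[abs_def] \<mu>_def)
  define K where "K = 8 * C + 8 * m4"
  have K: "K \<ge> 8" using C m by (simp add: K_def)
  define L where "L = 2 * K + 4 * C * (1 + \<bar>m1\<bar>) + m2"
  have "K \<le> L" "C * (1 + \<bar>m1\<bar>) \<ge> 0" using K C m by (auto simp: L_def)
  show thesis
  proof (rule that[of L])
    show "L \<ge> 1" using \<open>K \<le> L\<close> K by simp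
    fix z :: nat assume z: "z \<ge> 1"
    define q where "q = sqrt z"
    have q: "q \<ge> 1" "real z = q^2" using z by (auto simp: q_def)
    define P where "P = pair_pmf (exit_law z 1) \<kappa>"
    define w where "w n = real n - real z - 1" for n
    define X where "X = (\<lambda>(y, k). w y + \<eta> k)"
    define Y where "Y = (\<lambda>(y, k). real (nat (max 1 (int y - k))) - real z)"
    have tr: "measure_pmf.expectation (urn_chain \<kappa> z) (\<lambda>n. (real n - real z) ^ j)
        = measure_pmf.expectation P (\<lambda>v. Y v ^ j)" for j
      by (simp add: urn_chain_pair[OF z] P_def Y_def split_def)
    have XY: "\<bar>Y v\<bar> \<le> \<bar>X v\<bar>" "0 \<le> Y v - X v" "Y v - X v \<le> X v ^ 4 / q^6" "X v ^ 2 - Y v ^ 2 \<le> X v ^ 4 / q^4" for v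
    proof -
      obtain y k where v: "v = (y, k)" by force
      define x where "x = int y - k - int z"
      have X: "X v = of_int x" by (simp add: X_def v w_def \<eta>_def x_def)
      have Y: "Y v = max (1 - real z) (of_int x)" by (auto simp: Y_def v x_def max_def)
      show *: "\<bar>Y v\<bar> \<le> \<bar>X v\<bar>" "0 \<le> Y v - X v" unfolding X Y using z by auto
      have "Y v - X v \<le> X v ^ 4 / q^6 \<and> X v ^ 2 - Y v ^ 2 \<le> X v ^ 4 / q^4"
      proof (cases "x \<ge> 1 - int z")
        case True
        then have "of_int x \<ge> (1 - real z)" by linarith
        then have "Y v = X v" unfolding X Y by simp
        then show ?thesis using q by simp
      next
        case False
        then have "x \<le> - int z" by simp
        then have "of_int x \<le> - real z" by linarith
        then have big: "\<bar>X v\<bar> \<ge> q^2" and "X v < 0" unfolding X q(2)[symmetric] using z by auto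
        have "\<bar>X v\<bar> * (q^2)^3 \<le> \<bar>X v\<bar> * \<bar>X v\<bar> ^ 3" using big q by (intro mult_left_mono power_mono) auto
        also have "\<bar>X v\<bar> * \<bar>X v\<bar> ^ 3 = \<bar>X v\<bar> ^ 4" by algebra
        finally have 1: "\<bar>X v\<bar> \<le> X v ^ 4 / q^6" using q by (simp add: field_simps)
        have "Y v \<le> 0" using False z unfolding Y by auto
        then have 2: "Y v - X v \<le> \<bar>X v\<bar>" by simp
        have "\<bar>X v\<bar>^2 * (q^2)^2 \<le> \<bar>X v\<bar>^2 * \<bar>X v\<bar> ^ 2" using big q by (intro mult_left_mono power_mono) auto
        then have 3: "X v ^ 2 \<le> X v ^ 4 / q^4" using q by (simp add: field_simps power_numeral_reduce)
        have "X v ^ 2 - Y v ^ 2 \<le> X v ^ 2" by simp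
        with 1 2 3 show ?thesis by linarith
      qed
      then show "Y v - X v \<le> X v ^ 4 / q^6" "X v ^ 2 - Y v ^ 2 \<le> X v ^ 4 / q^4" by auto
    qed
    have iw: "integrable (measure_pmf (exit_law z 1)) (\<lambda>n. w n ^ j)" for j
      using integrable_exit_power(1)[of z 1 "real z + 1" j] by (simp add: w_def algebra_simps)
    have i1: "integrable (measure_pmf P) (\<lambda>v. w (fst v) ^ j)" for j
      unfolding P_def using pair_pmf_product(1)[OF iw[of j], of \<kappa> "\<lambda>_. 1"] by (simp add: split_def)
    have i2: "integrable (measure_pmf P) (\<lambda>v. \<eta> (snd v) ^ j)" if "j \<le> 4" for j
      unfolding P_def using pair_pmf_product(1)[OF _ i\<eta>(1)[OF that], of "exit_law z 1" "\<lambda>_. 1"] by (simp add: split_def)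
    have Xs: "X v = w (fst v) + \<eta> (snd v)" for v by (simp add: X_def split_def)
    have iX4: "integrable (measure_pmf P) (\<lambda>v. X v ^ 4)"
      unfolding Xs by (intro integrable_add_pow4 i1 i2) auto
    have iY4: "integrable (measure_pmf P) (\<lambda>v. Y v ^ 4)"
      by (rule Bochner_Integration.integrable_bound[OF iX4])
        (use power_mono[OF XY(1), where n=4] in auto)
    then show "integrable (measure_pmf (urn_chain \<kappa> z)) (\<lambda>n. (real n - real z) ^ 4)"
      by (simp add: urn_chain_pair[OF z] P_def Y_def split_def)
    note iX = integrable_pow_le4(1)[OF iX4] and iY = integrable_pow_le4(1)[OF iY4]
    let ?E = "measure_pmf.expectation P"
    have [simp]: "integrable (measure_pmf P) X" "integrable (measure_pmf P) Y"
      "integrable (measure_pmf P) (\<lambda>v. X v ^ 2)" "integrable (measure_pmf P) (\<lambda>v. Y v ^ 2)"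
      "integrable (measure_pmf P) (\<lambda>v. X v ^ 4)" "integrable (measure_pmf P) (\<lambda>v. Y v ^ 4)"
      using iX[of 1] iX[of 2] iX[of 4] iY[of 1] iY[of 2] iY[of 4] by auto
    have Ew: "?E (\<lambda>v. w (fst v) ^ j) = measure_pmf.expectation (exit_law z 1) (\<lambda>n. w n ^ j)" for j
      unfolding P_def by (rule expectation_pair_pmf_fst)
    have E\<eta>: "?E (\<lambda>v. \<eta> (snd v) ^ j) = measure_pmf.expectation \<kappa> (\<lambda>k. \<eta> k ^ j)" for j
      unfolding P_def by (rule expectation_pair_pmf_snd)
    define w1 where "w1 = measure_pmf.expectation (exit_law z 1) w"
    have w1: "\<bar>w1 + 1/3\<bar> \<le> C / q" using C(2)[OF z] by (simp add: w1_def w_def[abs_def] q_def)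
    have "?E X = ?E (\<lambda>v. w (fst v)) + ?E (\<lambda>v. \<eta> (snd v))"
      unfolding Xs using i1[of 1] i2[of 1] by simp
    then have EX1: "?E X = w1 + m1" using Ew[of 1] E\<eta>[of 1] by (simp add: w1_def m1_def)
    have "?E (\<lambda>v. X v ^ 4) \<le> ?E (\<lambda>v. 8 * w (fst v) ^ 4 + 8 * \<eta> (snd v) ^ 4)"
      using i1[of 4] i2[of 4] pow4_add_le iX4[unfolded Xs] by (intro integral_mono) (auto simp: Xs)
    also have "\<dots> = 8 * measure_pmf.expectation (exit_law z 1) (\<lambda>n. w n ^ 4) + 8 * m4"
      using i1[of 4] i2[of 4] by (simp add: Ew E\<eta> m4_def)
    also have "\<dots> \<le> 8 * (C * q^4) + 8 * (m4 * q^4)"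
      using C(4)[OF z] m q by (intro add_mono mult_left_mono)
        (auto simp: w_def power_mult[symmetric] mult_le_cancel_left1 one_le_power)
    finally have EX4: "?E (\<lambda>v. X v ^ 4) \<le> K * q^4" by (simp add: K_def algebra_simps)
    have ip: "integrable (measure_pmf P) (\<lambda>v. w (fst v) * \<eta> (snd v))"
      and Ep: "?E (\<lambda>v. w (fst v) * \<eta> (snd v)) = w1 * m1"
      using pair_pmf_product[OF iw[of 1] i\<eta>(1)[of 1]] by (auto simp: P_def split_def w1_def m1_def)
    have "X v ^ 2 = w (fst v) ^ 2 + 2 * (w (fst v) * \<eta> (snd v)) + \<eta> (snd v) ^ 2" for v
      unfolding Xs by algebra
    then have EX2: "?E (\<lambda>v. X v ^ 2) = measure_pmf.expectation (exit_law z 1) (\<lambda>n. w n ^ 2) + 2 * (w1 * m1) + m2"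
      using i1[of 2] i2[of 2] ip by (simp add: Ep Ew E\<eta> m2_def)
    have "?E (\<lambda>v. Y v ^ 4) \<le> ?E (\<lambda>v. X v ^ 4)"
      by (rule integral_mono) (use power_mono[OF XY(1), where n=4] in auto)
    also have "\<dots> \<le> L * q^4" using EX4 \<open>K \<le> L\<close> q by (meson mult_right_mono order_trans zero_le_power zero_le_one)
    finally show "measure_pmf.expectation (urn_chain \<kappa> z) (\<lambda>n. (real n - real z)^4) \<le> L * real z ^ 2"
      unfolding tr by (simp add: q power_mult[symmetric])
    have "0 \<le> ?E Y - ?E X"
      using XY(2) by (simp flip: Bochner_Integration.integral_diff add: integral_nonneg_AE)
    moreover have "?E Y - ?E X \<le> ?E (\<lambda>v. X v ^ 4 / q^6)"
    proof -
      have "?E Y - ?E X = ?E (\<lambda>v. Y v - X v)" by simp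
      also have "\<dots> \<le> ?E (\<lambda>v. X v ^ 4 / q^6)" by (rule integral_mono) (use XY(3) in auto)
      finally show ?thesis .
    qed
    moreover have "?E (\<lambda>v. X v ^ 4 / q^6) \<le> K / q"
    proof -
      have "?E (\<lambda>v. X v ^ 4 / q^6) = ?E (\<lambda>v. X v ^ 4) / q^6" by simp
      also have "\<dots> \<le> K * q^4 / q^6" using EX4 q by (intro divide_right_mono) auto
      also have "\<dots> = K / q^2" using q by (simp add: power_numeral_reduce)
      also have "\<dots> \<le> K / q" using q K by (intro divide_left_mono) (auto simp: power2_eq_square)
      finally show ?thesis .
    qed
    moreover have "(K + C) / q \<le> L / q" using q K C m
      by (intro divide_right_mono) (auto simp: L_def algebra_simps intro!: add_nonneg_nonneg)
    ultimately have "\<bar>?E Y - (2/3 - \<mu>)\<bar> \<le> L / q"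
      using w1 EX1 m1 unfolding add_divide_distrib by argo
    then show "\<bar>measure_pmf.expectation (urn_chain \<kappa> z) (\<lambda>n. real n - real z) - (2/3 - \<mu>)\<bar> \<le> L / sqrt z"
      using tr[of 1] by (simp add: q_def)
    have "0 \<le> ?E (\<lambda>v. X v ^ 2) - ?E (\<lambda>v. Y v ^ 2)"
      using power_mono[OF XY(1), where n=2] by (simp flip: Bochner_Integration.integral_diff add: integral_nonneg_AE)
    moreover have "?E (\<lambda>v. X v ^ 2) - ?E (\<lambda>v. Y v ^ 2) \<le> ?E (\<lambda>v. X v ^ 4 / q^4)"
    proof -
      have "?E (\<lambda>v. X v ^ 2) - ?E (\<lambda>v. Y v ^ 2) = ?E (\<lambda>v. X v ^ 2 - Y v ^ 2)" by simp
      also have "\<dots> \<le> ?E (\<lambda>v. X v ^ 4 / q^4)" by (rule integral_mono) (use XY(4) in auto)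
      finally show ?thesis .
    qed
    moreover have "?E (\<lambda>v. X v ^ 4 / q^4) \<le> K"
      using EX4 q by (simp add: field_simps)
    moreover have "\<bar>measure_pmf.expectation (exit_law z 1) (\<lambda>n. w n ^ 2) - 2/3 * real z\<bar> \<le> C * q"
      using C(3)[OF z] by (simp add: w_def q_def)
    moreover have "\<bar>2 * (w1 * m1)\<bar> \<le> 2 * (C + 1/3) * \<bar>m1\<bar>"
    proof -
      have "C / q \<le> C" using q C by (simp add: field_simps)
      with w1 have "\<bar>w1\<bar> \<le> C + 1/3" by linarith
      then have "\<bar>w1\<bar> * \<bar>m1\<bar> \<le> (C + 1/3) * \<bar>m1\<bar>" by (intro mult_right_mono) auto
      then show ?thesis by (simp add: abs_mult algebra_simps)
    qed
    moreover have "2 * (C + 1/3) * \<bar>m1\<bar> \<le> 4 * C * \<bar>m1\<bar>" using C by (intro mult_right_mono) auto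
    moreover have "(K + 4 * C * \<bar>m1\<bar> + m2) * 1 \<le> (K + 4 * C * \<bar>m1\<bar> + m2) * q"
      using K C m q by (intro mult_left_mono add_nonneg_nonneg) auto
    moreover note EX2
    moreover have "\<bar>Y2 - Z\<bar> \<le> r + c" if "0 \<le> X2 - Y2" "X2 - Y2 \<le> e" "e \<le> K" "\<bar>W - Z\<bar> \<le> c" "\<bar>x\<bar> \<le> b"
        "b \<le> d" "(K + d + m2) * 1 \<le> r" "X2 = W + x + m2" for X2 Y2 e W Z c x b d r :: real
      using that m(1) by argo
    ultimately have "\<bar>?E (\<lambda>v. Y v ^ 2) - 2/3 * real z\<bar> \<le> (K + 4 * C * \<bar>m1\<bar> + m2) * q + C * q"
      by blast
    also have "\<dots> = (K + 4 * C * \<bar>m1\<bar> + m2 + C) * q" by algebra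
    finally have "\<bar>?E (\<lambda>v. Y v ^ 2) - 2/3 * real z\<bar> \<le> (K + 4 * C * \<bar>m1\<bar> + m2 + C) * q" .
    then show "\<bar>measure_pmf.expectation (urn_chain \<kappa> z) (\<lambda>n. (real n - real z)^2) - 2/3 * real z\<bar> \<le> L * sqrt z"
      unfolding tr q_def[symmetric]
    proof (rule order_trans)
      have "K + 4 * C * \<bar>m1\<bar> + m2 + C \<le> L" using K C by (simp add: L_def algebra_simps)
      then show "(K + 4 * C * \<bar>m1\<bar> + m2 + C) * q \<le> L * q" using q by (intro mult_right_mono) auto
    qed
  qed
qed

section \<open>Lyapunov functions\<close>

text \<open>The right side minus the left has derivative \<open>x^3 / (1 + x)\<close>, which has the
  sign of \<open>x\<close>. So the bound holds up to the singularity, and large jumps need no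
  separate treatment.\<close>

lemma ln_1_plus_le_cubic:
  fixes t :: real assumes "t > -1"
  shows "ln (1 + t) \<le> t - t^2/2 + t^3/3"
proof -
  define g where "g x = x - x^2/2 + x^3/3 - ln (1 + x)" for x :: real
  have g': "(g has_real_derivative x^3 / (1 + x)) (at x)" if "x > -1" for x
  proof -
    have "(g has_real_derivative 1 - x + x^2 - 1 / (1 + x)) (at x)"
      unfolding g_def[abs_def] using that by (auto intro!: derivative_eq_intros)
    moreover have "1 - x + x^2 - 1 / (1 + x) = x^3 / (1 + x)"
      using that by (simp add: divide_simps) algebra
    ultimately show ?thesis by simp
  qed
  have "g 0 \<le> g t"
  proof (cases "t \<ge> 0")
    case True
    then show ?thesis
      by (intro DERIV_nonneg_imp_nondecreasing[of 0 t g]) (auto intro!: exI[of _ "_^3/_"] g')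
  next
    case False
    show ?thesis
    proof (rule DERIV_nonpos_imp_nonincreasing[of t 0 g])
      fix x assume x: "t \<le> x" "x \<le> 0"
      then have "x^3 \<le> 0" by (simp add: power3_eq_cube mult_nonneg_nonpos mult_nonpos_nonpos)
      with x assms show "\<exists>y. (g has_real_derivative y) (at x) \<and> y \<le> 0"
        by (intro exI[of _ "x^3 / (1 + x)"]) (auto intro!: g' divide_nonpos_nonneg)
    qed (use False in auto)
  qed
  then show ?thesis by (simp add: g_def)
qed

text \<open>A lower bound of this kind must stay away from the singularity at \<open>-1\<close>. For
  negative \<open>t\<close> the relevant derivative is
  \<open>- (x^2 * (2 + 3 * x) / (1 + x))\<close>, of constant sign for
  \<open>x \<ge> -2/3\<close>.\<close>

lemma ln_1_plus_ge_cubic: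
  fixes t :: real assumes "t \<ge> -1/2"
  shows "ln (1 + t) \<ge> t - t^2/2 - \<bar>t\<bar>^3"
proof (cases "t \<ge> 0")
  case True
  define g where "g x = ln (1 + x) - (x - x^2/2)" for x :: real
  have "g 0 \<le> g t"
  proof (rule DERIV_nonneg_imp_nondecreasing[OF True])
    fix x :: real assume x: "0 \<le> x"
    have "(g has_real_derivative 1 / (1 + x) - (1 - x)) (at x)"
      unfolding g_def[abs_def] using x by (auto intro!: derivative_eq_intros)
    moreover have "1 / (1 + x) - (1 - x) = x^2 / (1 + x)"
      using x by (simp add: field_simps power2_eq_square)
    ultimately show "\<exists>y. (g has_real_derivative y) (at x) \<and> 0 \<le> y" using x by auto
  qed
  then have "t - t^2/2 \<le> ln (1 + t)" by (simp add: g_def)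
  moreover have "0 \<le> \<bar>t\<bar>^3" by simp
  ultimately show ?thesis by linarith
next
  case False
  define g where "g x = ln (1 + x) - (x - x^2/2 + x^3)" for x :: real
  have "g 0 \<le> g t"
  proof (rule DERIV_nonpos_imp_nonincreasing[of t 0])
    fix x :: real assume x: "t \<le> x" "x \<le> 0"
    have "(g has_real_derivative 1 / (1 + x) - (1 - x + 3 * x^2)) (at x)"
      unfolding g_def[abs_def] using x assms by (auto intro!: derivative_eq_intros)
    moreover have "1 / (1 + x) - (1 - x + 3 * x^2) = - (x^2 * (2 + 3 * x) / (1 + x))"
      using x assms by (simp add: divide_simps) algebra
    moreover have "0 \<le> x^2 * (2 + 3 * x) / (1 + x)" using x assms by simp
    ultimately show "\<exists>y. (g has_real_derivative y) (at x) \<and> y \<le> 0" by (metis neg_le_0_iff_le)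
  qed (use False in auto)
  then have "t - t^2/2 + t^3 \<le> ln (1 + t)" by (simp add: g_def)
  moreover have "\<bar>t\<bar>^3 = - (t^3)" using False by (simp add: abs_if power_minus_odd)
  ultimately show ?thesis by linarith
qed

text \<open>Applied with \<open>1 + t = n / z\<close> and \<open>n \<ge> 1\<close>: below
  \<open>t = -1/2\<close> the logarithm is at least \<open>- ln z\<close>, and
  \<open>16 * t^4 \<ge> 1\<close> there. In the mean the extra term is of order
  \<open>ln z / z^2\<close>, negligible against \<open>1 / z\<close>.\<close>

lemma ln_1_plus_ge:
  fixes t z :: real assumes "z \<ge> 1" "1 + t \<ge> 1 / z"
  shows "ln (1 + t) \<ge> t - t^2/2 - \<bar>t\<bar>^3 - 16 * ln z * t^4"
proof (cases "t \<ge> -1/2")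
  case True
  have "0 \<le> 16 * ln z * t^4" using assms by simp
  then show ?thesis using ln_1_plus_ge_cubic[OF True] by linarith
next
  case False
  have "ln (1 / z) \<le> ln (1 + t)" using assms by (intro ln_mono) auto
  then have "- ln z \<le> ln (1 + t)" using assms by (simp add: ln_div)
  moreover have "\<bar>t\<bar>^4 \<ge> (1/2)^4" using False by (intro power_mono) auto
  then have "16 * t^4 \<ge> 1" by (simp add: power_divide)
  then have "ln z * (16 * t^4) \<ge> ln z * 1" using assms by (intro mult_left_mono) auto
  moreover have "t - t^2/2 - \<bar>t\<bar>^3 \<le> 0"
  proof -
    have "0 \<le> t^2" "0 \<le> \<bar>t\<bar>^3" by auto
    then show ?thesis using False by linarith
  qed
  ultimately show ?thesis by (simp add: algebra_simps)
qed

text \<open>The same division at \<open>-1/2\<close>. Above it,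
  \<open>t / (1 + t) \<le> ln (1 + t) \<le> t\<close> gives the factor \<open>2\<close>, squared to
  \<open>4\<close>.\<close>

lemma ln_1_plus_sq_le:
  fixes t z :: real assumes "z \<ge> 1" "1 + t \<ge> 1 / z"
  shows "ln (1 + t) ^ 2 \<le> 4 * t^2 + 16 * ln z ^ 2 * t^4"
proof (cases "t \<ge> -1/2")
  case True
  have "ln (1 + t) \<le> t" using True by (intro ln_add_one_self_le_self2) auto
  moreover have "1 - 1 / (1 + t) \<le> ln (1 + t)"
    using ln_add_one_self_le_self2[of "1 / (1 + t) - 1"] True by (simp add: ln_div field_simps)
  moreover have "1 - 1 / (1 + t) = t / (1 + t)" using True by (simp add: field_simps)
  moreover have "\<bar>t / (1 + t)\<bar> \<le> 2 * \<bar>t\<bar>"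
  proof -
    have "\<bar>t\<bar> * 1 \<le> \<bar>t\<bar> * (2 * (1 + t))" using True by (intro mult_left_mono) auto
    then show ?thesis using True by (simp add: divide_le_eq algebra_simps)
  qed
  ultimately have "\<bar>ln (1 + t)\<bar> \<le> 2 * \<bar>t\<bar>" by linarith
  from power_mono[OF this, of 2] have "ln (1 + t) ^ 2 \<le> 4 * t^2" by (simp add: power_mult_distrib)
  moreover have "0 \<le> 16 * ln z ^ 2 * t^4" by simp
  ultimately show ?thesis by linarith
next
  case False
  have "ln (1 / z) \<le> ln (1 + t)" using assms by (intro ln_mono) auto
  then have 1: "- ln z \<le> ln (1 + t)" using assms by (simp add: ln_div)
  have "0 < 1 / z" using assms by simp
  then have "0 < 1 + t" using assms by linarith
  then have "ln (1 + t) \<le> 0" using False by (subst ln_le_zero_iff) auto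
  with 1 have "\<bar>ln (1 + t)\<bar> \<le> ln z" by simp
  from power_mono[OF this, of 2] have 2: "ln (1 + t) ^ 2 \<le> ln z ^ 2" by simp
  have "\<bar>t\<bar>^4 \<ge> (1/2)^4" using False by (intro power_mono) auto
  then have "16 * t^4 \<ge> 1" by (simp add: power_divide)
  then have "ln z ^ 2 * (16 * t^4) \<ge> ln z ^ 2 * 1" by (intro mult_left_mono) auto
  moreover have "ln z ^ 2 * (16 * t^4) = 16 * ln z ^ 2 * t^4" by simp
  moreover have "0 \<le> 4 * t^2" by simp
  ultimately show ?thesis using 2 by linarith
qed

text \<open>For \<open>t \<ge> 0\<close> this follows from
  \<open>t / (1 + t) \<le> ln (1 + t)\<close> and \<open>(1 - 2 * t) * (1 + t)^2 \<le> 1\<close>;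
  for \<open>t < 0\<close> already
  \<open>\<bar>t\<bar> \<le> \<bar>ln (1 + t)\<bar>\<close>.\<close>

lemma ln_1_plus_sq_ge:
  fixes t :: real assumes "t > -1"
  shows "t^2 - 2 * \<bar>t\<bar>^3 \<le> ln (1 + t) ^ 2"
proof (cases "t \<ge> 0")
  case True
  have "t / (1 + t) \<le> ln (1 + t)"
    using ln_add_one_self_le_self2[of "1 / (1 + t) - 1"] True by (simp add: ln_div field_simps)
  then have 1: "(t / (1 + t))^2 \<le> ln (1 + t)^2" using True by (intro power_mono) auto
  have "(1 - 2 * t) * (1 + t)^2 \<le> 1"
  proof -
    have "1 - (1 - 2 * t) * (1 + t)^2 = 2 * t * t * t + 3 * t * t" by algebra
    also have "\<dots> \<ge> 0" using True by simp
    finally show ?thesis by simp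
  qed
  then have "t^2 * ((1 - 2 * t) * (1 + t)^2) \<le> t^2 * 1" by (intro mult_left_mono) auto
  then have "t^2 * (1 - 2 * t) \<le> (t / (1 + t))^2" using True by (simp add: power_divide pos_le_divide_eq mult.assoc)
  moreover have "t^2 * (1 - 2 * t) = t^2 - 2 * \<bar>t\<bar>^3" using True by (simp add: algebra_simps power2_eq_square power3_eq_cube)
  ultimately show ?thesis using 1 by simp
next
  case False
  have "ln (1 + t) \<le> t" using assms by (intro ln_add_one_self_le_self2) auto
  with False have "\<bar>t\<bar> \<le> \<bar>ln (1 + t)\<bar>" by simp
  from power_mono[OF this, of 2] have "t^2 \<le> ln (1 + t)^2" by simp
  moreover have "0 \<le> \<bar>t\<bar>^3" by simp
  ultimately show ?thesis by linarith
qed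

text \<open>The square of the cubic Taylor polynomial exceeds \<open>1 + t\<close> by
  \<open>t^4 * ((t - 2)^2 + 16) / 256\<close>, so it remains to check that the polynomial itself is
  nonnegative for \<open>t \<ge> -1\<close>.\<close>

lemma sqrt_1_plus_le:
  fixes t :: real assumes "t \<ge> -1"
  shows "sqrt (1 + t) \<le> 1 + t/2 - t^2/8 + t^3/16"
proof (rule real_le_lsqrt)
  have "(1 + t/2 - t^2/8 + t^3/16)^2 - (1 + t) = t^4 * ((t - 2)^2 + 16) / 256"
    by (simp add: power_numeral_reduce field_simps)
  also have "\<dots> \<ge> 0" by simp
  finally show "1 + t \<le> (1 + t/2 - t^2/8 + t^3/16)^2" by simp
  have "1 + t/2 - t^2/8 + t^3/16 = ((1 + t) * (t^2 - 3 * t + 11) + 5) / 16"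
    by (simp add: power_numeral_reduce field_simps)
  also have "t^2 - 3 * t + 11 = (t - 3/2)^2 + 35/4" by (simp add: power2_eq_square field_simps)
  also have "((1 + t) * ((t - 3/2)^2 + 35/4) + 5) / 16 \<ge> 0" using assms by simp
  finally show "0 \<le> 1 + t/2 - t^2/8 + t^3/16" .
qed

text \<open>In terms of \<open>n / z - 1\<close> the Taylor expansions of the Lyapunov functions
  take place at a fixed point. The third absolute moment is interpolated between the second and the
  fourth.\<close>

lemma urn_chain_relative_moments:
  assumes k4: "integrable (measure_pmf \<kappa>) (\<lambda>k. real_of_int k ^ 4)"
  defines "a \<equiv> 2/3 - measure_pmf.expectation \<kappa> real_of_int"
  obtains C where "C \<ge> 1"
    and "\<And>z. z \<ge> 1 \<Longrightarrow> integrable (measure_pmf (urn_chain \<kappa> z)) (\<lambda>n. (real n / real z - 1) ^ 4)"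
    and "\<And>z. z \<ge> 1 \<Longrightarrow>
      \<bar>measure_pmf.expectation (urn_chain \<kappa> z) (\<lambda>n. real n / real z - 1) - a / real z\<bar> \<le> C / sqrt (real z) ^ 3"
    and "\<And>z. z \<ge> 1 \<Longrightarrow>
      \<bar>measure_pmf.expectation (urn_chain \<kappa> z) (\<lambda>n. (real n / real z - 1)^2) - 2/3 / real z\<bar> \<le> C / sqrt (real z) ^ 3"
    and "\<And>z. z \<ge> 1 \<Longrightarrow>
      measure_pmf.expectation (urn_chain \<kappa> z) (\<lambda>n. \<bar>real n / real z - 1\<bar>^3) \<le> C / sqrt (real z) ^ 3"
    and "\<And>z. z \<ge> 1 \<Longrightarrow>
      measure_pmf.expectation (urn_chain \<kappa> z) (\<lambda>n. (real n / real z - 1)^4) \<le> C / real z ^ 2"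
proof -
  obtain C where C: "C \<ge> 1"
    "\<And>z. z \<ge> 1 \<Longrightarrow> integrable (measure_pmf (urn_chain \<kappa> z)) (\<lambda>n. (real n - real z) ^ 4)"
    "\<And>z. z \<ge> 1 \<Longrightarrow>
      \<bar>measure_pmf.expectation (urn_chain \<kappa> z) (\<lambda>n. real n - real z) - a\<bar> \<le> C / sqrt z"
    "\<And>z. z \<ge> 1 \<Longrightarrow>
      \<bar>measure_pmf.expectation (urn_chain \<kappa> z) (\<lambda>n. (real n - real z)^2) - 2/3 * real z\<bar> \<le> C * sqrt z"
    "\<And>z. z \<ge> 1 \<Longrightarrow>
      measure_pmf.expectation (urn_chain \<kappa> z) (\<lambda>n. (real n - real z)^4) \<le> C * real z ^ 2"
    using urn_chain_moments[OF k4] unfolding a_def by blast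
  show thesis
  proof (rule that[of "2 * C"])
    show "2 * C \<ge> 1" using C by simp
    fix z :: nat assume z: "z \<ge> 1"
    define q where "q = sqrt z"
    have q: "q \<ge> 1" "real z = q^2" using z by (auto simp: q_def)
    then have q_abs [simp]: "\<bar>q\<bar> = q" by simp
    let ?E = "measure_pmf.expectation (urn_chain \<kappa> z)"
    define D where "D n = real n - real z" for n
    have t: "(\<lambda>n. (real n / real z - 1) ^ j) = (\<lambda>n. D n ^ j / q ^ (2 * j))" for j
      using q by (auto simp: D_def power_divide[symmetric] power_mult diff_divide_distrib)
    have t3: "(\<lambda>n. \<bar>real n / real z - 1\<bar> ^ 3) = (\<lambda>n. \<bar>D n\<bar> ^ 3 / q ^ 6)"
    proof
      fix n
      have "real n / real z - 1 = D n / q^2" using q by (simp add: D_def diff_divide_distrib)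
      then show "\<bar>real n / real z - 1\<bar> ^ 3 = \<bar>D n\<bar> ^ 3 / q ^ 6" by (simp add: power_divide)
    qed
    have iD4: "integrable (measure_pmf (urn_chain \<kappa> z)) (\<lambda>n. D n ^ 4)" using C(2)[OF z] by (simp add: D_def)
    note iD = integrable_pow_le4[OF iD4]
    show "integrable (measure_pmf (urn_chain \<kappa> z)) (\<lambda>n. (real n / real z - 1) ^ 4)"
      unfolding t using iD4 by simp
    have m1: "\<bar>?E D - a\<bar> \<le> C / q" and m2: "\<bar>?E (\<lambda>n. D n ^ 2) - 2/3 * q^2\<bar> \<le> C * q"
      and m4: "?E (\<lambda>n. D n ^ 4) \<le> C * q ^ 4"
      using C(3-5)[OF z] by (auto simp: D_def[abs_def] q_def power_mult[symmetric] q(2)[symmetric])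
         (simp add: q(2) power_mult[symmetric] flip: q_def)?
    have "?E (\<lambda>n. real n / real z - 1) - a / real z = (?E D - a) / q^2"
      using t[of 1] iD(1)[of 1] by (simp add: q diff_divide_distrib)
    also have "\<bar>\<dots>\<bar> \<le> C / q / q^2" unfolding abs_divide using m1 q by (intro frac_le) auto
    also have "\<dots> \<le> 2 * C / q^3" using q C by (simp add: power_numeral_reduce divide_right_mono)
    finally show "\<bar>?E (\<lambda>n. real n / real z - 1) - a / real z\<bar> \<le> 2 * C / sqrt (real z) ^ 3" by (simp add: q_def)
    have "?E (\<lambda>n. (real n / real z - 1)^2) - 2/3 / real z = (?E (\<lambda>n. D n ^ 2) - 2/3 * q^2) / q^4"
      unfolding t using q by (simp add: diff_divide_distrib power_numeral_reduce)
    also have "\<bar>\<dots>\<bar> \<le> C * q / q^4" unfolding abs_divide using m2 q by (intro frac_le) auto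
    also have "\<dots> \<le> 2 * C / q^3" using q C by (simp add: power_numeral_reduce divide_right_mono)
    finally show "\<bar>?E (\<lambda>n. (real n / real z - 1)^2) - 2/3 / real z\<bar> \<le> 2 * C / sqrt (real z) ^ 3" by (simp add: q_def)
    have "?E (\<lambda>n. \<bar>D n\<bar>^3) \<le> ?E (\<lambda>n. (q * D n ^ 2 + D n ^ 4 / q) / 2)"
    proof (rule integral_mono)
      fix n
      have "0 \<le> \<bar>D n\<bar>^2 * (\<bar>D n\<bar> - q)^2" by simp
      also have "\<dots> = \<bar>D n\<bar>^4 - 2 * q * \<bar>D n\<bar>^3 + q * q * \<bar>D n\<bar>^2" by algebra
      finally show "\<bar>D n\<bar>^3 \<le> (q * D n ^ 2 + D n ^ 4 / q) / 2" using q by (simp add: field_simps)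
    qed (use iD iD4 in auto)
    also have "\<dots> = (q * ?E (\<lambda>n. D n ^ 2) + ?E (\<lambda>n. D n ^ 4) / q) / 2" using iD(1)[of 2] iD4 by simp
    also have "\<dots> \<le> (q * (2/3 * q^2 + C * q) + C * q^4 / q) / 2"
      using m2 m4 q by (intro divide_right_mono add_mono mult_left_mono) auto
    also have "\<dots> \<le> 2 * C * q^3"
    proof -
      have "C * q^2 \<le> C * q^3" "1 * q^3 \<le> C * q^3" using q C by (auto intro!: mult_left_mono mult_right_mono power_increasing)
      moreover have "(q * (2/3 * q^2 + C * q) + C * q^4 / q) / 2 = (2/3 * q^3 + C * q^2 + C * q^3) / 2"
        using q by (simp add: power_numeral_reduce field_simps)
      moreover have "2 * C * q^3 = 2 * (C * q^3)" "q^3 \<ge> 0" using q by auto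
      ultimately show ?thesis by argo
    qed
    finally have "?E (\<lambda>n. \<bar>D n\<bar>^3) / q^6 \<le> 2 * C * q^3 / q^6" using q by (intro divide_right_mono) auto
    also have "\<dots> = 2 * C / q^3" using q by (simp add: power_numeral_reduce)
    finally show "?E (\<lambda>n. \<bar>real n / real z - 1\<bar>^3) \<le> 2 * C / sqrt (real z) ^ 3" unfolding t3 by (simp add: q_def)
    have "?E (\<lambda>n. D n ^ 4) / q^8 \<le> C * q^4 / q^8" using m4 q by (intro divide_right_mono) auto
    also have "\<dots> = C / q^4" using q by (simp add: power_numeral_reduce)
    also have "\<dots> \<le> 2 * C / q^4" using C q by (intro divide_right_mono) auto
    finally show "?E (\<lambda>n. (real n / real z - 1)^4) \<le> 2 * C / real z ^ 2"
      unfolding t by (simp add: q power_mult[symmetric])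
  qed
qed

section \<open>Drift of the Lyapunov functions\<close>

lemma expectation_le_of_poly:
  fixes f t :: "nat \<Rightarrow> real"
  assumes f: "integrable (measure_pmf p) f" and t: "integrable (measure_pmf p) (\<lambda>n. t n ^ 4)"
    and le: "\<And>n. n \<in> set_pmf p \<Longrightarrow>
      f n \<le> c0 + c1 * t n + c2 * t n ^ 2 + c3 * \<bar>t n\<bar> ^ 3 + c4 * t n ^ 4"
  shows "measure_pmf.expectation p f \<le> c0 + c1 * measure_pmf.expectation p t
      + c2 * measure_pmf.expectation p (\<lambda>n. t n ^ 2) + c3 * measure_pmf.expectation p (\<lambda>n. \<bar>t n\<bar> ^ 3)
      + c4 * measure_pmf.expectation p (\<lambda>n. t n ^ 4)"
proof -
  note i = integrable_pow_le4(1)[OF t, of 1] integrable_pow_le4(1)[OF t, of 2]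
    integrable_pow_le4(2)[OF t, of 3] t
  have "measure_pmf.expectation p f \<le> measure_pmf.expectation p
     (\<lambda>n. c0 + c1 * t n + c2 * t n ^ 2 + c3 * \<bar>t n\<bar> ^ 3 + c4 * t n ^ 4)"
    using f i by (intro integral_mono_AE) (auto intro!: AE_pmfI le)
  also have "\<dots> = c0 + c1 * measure_pmf.expectation p t
      + c2 * measure_pmf.expectation p (\<lambda>n. t n ^ 2) + c3 * measure_pmf.expectation p (\<lambda>n. \<bar>t n\<bar> ^ 3)
      + c4 * measure_pmf.expectation p (\<lambda>n. t n ^ 4)"
    using i by simp
  finally show ?thesis .
qed

lemma integrable_urn_chain:
  fixes f :: "nat \<Rightarrow> real"
  assumes k4: "integrable (measure_pmf \<kappa>) (\<lambda>k. real_of_int k ^ 4)"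
    and "z \<ge> 1" and f: "\<And>n. n \<ge> 1 \<Longrightarrow> \<bar>f n\<bar> \<le> c * (1 + real n ^ 4)"
  shows "integrable (measure_pmf (urn_chain \<kappa> z)) f"
proof (rule Bochner_Integration.integrable_bound)
  obtain C where C: "\<And>z. z \<ge> 1 \<Longrightarrow> integrable (measure_pmf (urn_chain \<kappa> z)) (\<lambda>n. (real n - real z) ^ 4)"
    using urn_chain_moments[OF k4] by metis
  have "integrable (measure_pmf (urn_chain \<kappa> z)) (\<lambda>n. real n ^ 4)"
    using integrable_add_pow4[OF C[OF \<open>z \<ge> 1\<close>], of "\<lambda>_. real z"] by simp
  then show "integrable (measure_pmf (urn_chain \<kappa> z)) (\<lambda>n. c * (1 + real n ^ 4))" by simp
  show "AE n in urn_chain \<kappa> z. norm (f n) \<le> norm (c * (1 + real n ^ 4))"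
    using f by (intro AE_pmfI) (auto dest!: urn_chain_pos intro: order_trans[OF _ abs_ge_self])
qed simp

lemma real_le_1_pow4: "real n \<le> 1 + real n ^ 4"
  using pow_le_pow4[of 1 "real n"] by simp

text \<open>Up to the factor \<open>1 / (A + ln z)^2\<close> the drift is that of
  \<open>- ln z\<close>, which is \<open>(1/3 - a) / z\<close> to leading order, plus a curvature
  term that a large \<open>A\<close> makes small.\<close>

lemma lyapunov_transient:
  assumes k4: "integrable (measure_pmf \<kappa>) (\<lambda>k. real_of_int k ^ 4)"
    and mean: "measure_pmf.expectation \<kappa> real_of_int < 1/3"
  obtains A N where "A \<ge> 1" "N \<ge> 1"
    and "\<And>z. z \<ge> N \<Longrightarrow> measure_pmf.expectation (urn_chain \<kappa> z) (\<lambda>n. 1 / (A + ln (real n))) < 1 / (A + ln (real z))"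
proof -
  define a where "a = 2/3 - measure_pmf.expectation \<kappa> real_of_int"
  define c where "c = a - 1/3"
  have c: "c > 0" using mean by (simp add: c_def a_def)
  obtain C where C: "C \<ge> 1"
    "\<And>z. z \<ge> 1 \<Longrightarrow> integrable (measure_pmf (urn_chain \<kappa> z)) (\<lambda>n. (real n / real z - 1) ^ 4)"
    "\<And>z. z \<ge> 1 \<Longrightarrow>
      \<bar>measure_pmf.expectation (urn_chain \<kappa> z) (\<lambda>n. real n / real z - 1) - a / real z\<bar> \<le> C / sqrt (real z) ^ 3"
    "\<And>z. z \<ge> 1 \<Longrightarrow>
      \<bar>measure_pmf.expectation (urn_chain \<kappa> z) (\<lambda>n. (real n / real z - 1)^2) - 2/3 / real z\<bar> \<le> C / sqrt (real z) ^ 3"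
    "\<And>z. z \<ge> 1 \<Longrightarrow>
      measure_pmf.expectation (urn_chain \<kappa> z) (\<lambda>n. \<bar>real n / real z - 1\<bar>^3) \<le> C / sqrt (real z) ^ 3"
    "\<And>z. z \<ge> 1 \<Longrightarrow>
      measure_pmf.expectation (urn_chain \<kappa> z) (\<lambda>n. (real n / real z - 1)^4) \<le> C / real z ^ 2"
    using urn_chain_relative_moments[OF k4] unfolding a_def by blast
  \<comment> \<open>The curvature contributes \<open>4 / A * 2/3 = 8/3 / A\<close> to the
    coefficient of \<open>1 / z\<close>; this choice makes it at most \<open>c / 4\<close>, and the
    remaining errors are kept below \<open>c / 2\<close> by \<open>N\<close>.\<close>
  define A where "A = max 1 (32 / (3 * c))"
  have A: "A \<ge> 1" "8/3 / A \<le> c / 4"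
    using c by (auto simp: A_def field_simps max_def)
  have "(\<lambda>z. 7 * C / sqrt (real z) + 16 * C * (ln (real z) + ln (real z) ^ 2) / real z) \<longlonglongrightarrow> 0"
    by real_asymp
  then have "eventually (\<lambda>z. 7 * C / sqrt (real z) + 16 * C * (ln (real z) + ln (real z) ^ 2) / real z < c / 2) sequentially"
    using c by (intro order_tendstoD) auto
  then obtain N where N: "\<And>z. z \<ge> N \<Longrightarrow> 7 * C / sqrt (real z) + 16 * C * (ln (real z) + ln (real z) ^ 2) / real z < c / 2"
    unfolding eventually_sequentially by blast
  show thesis
  proof (rule that[of A "max 1 N"])
    show "A \<ge> 1" by (rule A)
    fix z assume "z \<ge> max 1 N"
    then have z: "z \<ge> 1" "z \<ge> N" by auto
    let ?E = "measure_pmf.expectation (urn_chain \<kappa> z)"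
    define t where "t n = real n / real z - 1" for n
    define L where "L = ln (real z)"
    define q where "q = sqrt z"
    have q: "q \<ge> 1" "real z = q^2" using z by (auto simp: q_def)
    then have q_abs [simp]: "\<bar>q\<bar> = q" by simp
    have L: "L \<ge> 0" using z by (simp add: L_def)
    have le: "1 / (A + ln (real n)) \<le> 1 / (A + L) + - 1 / (A + L)^2 * t n + (1/2 + 4/A) / (A + L)^2 * t n ^ 2
        + 1 / (A + L)^2 * \<bar>t n\<bar> ^ 3 + (16 * L + 16 * L^2 / A) / (A + L)^2 * t n ^ 4" if n: "n \<ge> 1" for n
    proof -
      define l where "l = ln (1 + t n)"
      have tn: "1 + t n = real n / real z" by (simp add: t_def)
      have ln: "ln (real n) = L + l" using n z by (simp add: l_def tn ln_div L_def)
      have nn: "L + l \<ge> 0" using n by (simp flip: ln)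
      have tz: "1 + t n \<ge> 1 / real z" using n z by (simp add: tn divide_right_mono)
      have 1: "l \<ge> t n - t n^2/2 - \<bar>t n\<bar>^3 - 16 * L * t n^4"
        unfolding l_def L_def using tz z by (intro ln_1_plus_ge) auto
      have 2: "l^2 \<le> 4 * t n^2 + 16 * L^2 * t n^4"
        unfolding l_def L_def using tz z by (intro ln_1_plus_sq_le) auto
      \<comment> \<open>Exact expansion to second order. The denominator of its remainder is at
        least \<open>A\<close>, since \<open>L + l = ln n \<ge> 0\<close>.\<close>
      have "1 / (A + L + l) - 1 / (A + L) = (- l + l^2 / (A + L + l)) / (A + L)^2"
        using A nn L by (simp add: divide_simps) algebra
      also have "\<dots> \<le> (- l + l^2 / A) / (A + L)^2"
        using A nn by (intro divide_right_mono add_left_mono divide_left_mono) auto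
      also have "\<dots> \<le> (- (t n - t n^2/2 - \<bar>t n\<bar>^3 - 16 * L * t n^4) + (4 * t n^2 + 16 * L^2 * t n^4) / A) / (A + L)^2"
        using A 1 2 by (intro divide_right_mono add_mono) auto
      also have "\<dots> = - 1 / (A + L)^2 * t n + (1/2 + 4/A) / (A + L)^2 * t n ^ 2
        + 1 / (A + L)^2 * \<bar>t n\<bar> ^ 3 + (16 * L + 16 * L^2 / A) / (A + L)^2 * t n ^ 4"
        by (simp add: add_divide_distrib diff_divide_distrib distrib_right)
      finally show ?thesis unfolding ln by (simp add: add.assoc)
    qed
    have int: "integrable (measure_pmf (urn_chain \<kappa> z)) (\<lambda>n. 1 / (A + ln (real n)))"
    proof (rule integrable_urn_chain[OF k4 z(1), where c=1])
      fix n :: nat assume "n \<ge> 1"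
      then have "A + ln (real n) \<ge> 1" using A by (simp add: add_increasing2)
      then have "1 / (A + ln (real n)) \<le> 1" "0 \<le> 1 / (A + ln (real n))" by auto
      moreover have "0 \<le> real n ^ 4" by simp
      ultimately show "\<bar>1 / (A + ln (real n))\<bar> \<le> 1 * (1 + real n ^ 4)"
        by (simp only: abs_of_nonneg mult_1)
    qed
    define e where "e = C / q^3"
    have e: "e > 0" using C q by (simp add: e_def)
    have m: "?E t \<ge> a / q^2 - e" "?E (\<lambda>n. t n ^ 2) \<le> 2/3 / q^2 + e" "?E (\<lambda>n. \<bar>t n\<bar>^3) \<le> e" "?E (\<lambda>n. t n ^ 4) \<le> C / q^4"
      using C(3-6)[OF z(1)] unfolding t_def[abs_def] e_def q_def[symmetric] q(2)
      by (auto simp: abs_le_iff algebra_simps power_mult[symmetric])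
    have s: "(1/2 + 4/A) \<ge> 0" "16 * L + 16 * L^2 / A \<ge> 0" "16 * L + 16 * L^2 / A \<le> 16 * (L + L^2)" using A L mult_right_mono[of 1 A "L^2"] by (auto simp: field_simps)
    have "?E (\<lambda>n. 1 / (A + ln (real n))) \<le> 1 / (A + L) + - 1 / (A + L)^2 * ?E t
        + (1/2 + 4/A) / (A + L)^2 * ?E (\<lambda>n. t n ^ 2)
        + 1 / (A + L)^2 * ?E (\<lambda>n. \<bar>t n\<bar> ^ 3) + (16 * L + 16 * L^2 / A) / (A + L)^2 * ?E (\<lambda>n. t n ^ 4)"
    proof (rule expectation_le_of_poly[OF int])
      show "integrable (measure_pmf (urn_chain \<kappa> z)) (\<lambda>n. t n ^ 4)" using C(2)[OF z(1)] by (simp add: t_def)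
    qed (use le urn_chain_pos in blast)
    also have "\<dots> = 1 / (A + L) + (- ?E t + (1/2 + 4/A) * ?E (\<lambda>n. t n ^ 2) + ?E (\<lambda>n. \<bar>t n\<bar> ^ 3)
        + (16 * L + 16 * L^2 / A) * ?E (\<lambda>n. t n ^ 4)) / (A + L)^2"
    proof -
      have "x + - 1 / s * u + p / s * v + 1 / s * w + r / s * y = x + (- u + p * v + w + r * y) / s"
        for x s u p v w r y :: real by (simp add: add_divide_distrib diff_divide_distrib)
      then show ?thesis .
    qed
    also have "\<dots> < 1 / (A + L)"
    proof -
      have "- ?E t + (1/2 + 4/A) * ?E (\<lambda>n. t n ^ 2) + ?E (\<lambda>n. \<bar>t n\<bar> ^ 3) + (16 * L + 16 * L^2 / A) * ?E (\<lambda>n. t n ^ 4)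
        \<le> - (a / q^2 - e) + (1/2 + 4/A) * (2/3 / q^2 + e) + e + (16 * (L + L^2)) * (C / q^4)"
        using m s C q by (intro add_mono mult_mono) (auto intro!: integral_nonneg_AE)
      also have "\<dots> = - c / q^2 + (8/3 / A) / q^2 + (5/2 + 4/A) * e + (16 * (L + L^2)) * (C / q^4)"
      proof -
        have "- (a * i - e) + (1/2 + 4 * k) * (2/3 * i + e) + e + y
           = - (a - 1/3) * i + (8/3 * k) * i + (5/2 + 4 * k) * e + y" for i k y :: real
          by (simp add: algebra_simps)
        from this[of "1 / q^2" "1 / A"] show ?thesis by (simp add: c_def)
      qed
      also have "\<dots> \<le> - c / q^2 + (c / 4) / q^2 + 7 * e + (16 * (L + L^2)) * (C / q^4)"
        using A e q L C(1) by (intro add_mono divide_right_mono mult_right_mono) (auto simp: field_simps)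
      also have "\<dots> = (- c + c / 4 + (7 * C / q + 16 * C * (L + L^2) / q^2)) / q^2"
        using q by (simp add: e_def add_divide_distrib power_numeral_reduce) (simp add: field_simps)?
      also have "\<dots> < 0"
      proof (rule divide_neg_pos)
        have "7 * C / q + 16 * C * (L + L^2) / q^2 < c / 2"
          using N[OF z(2)] by (simp add: L_def q_def)
        then show "- c + c / 4 + (7 * C / q + 16 * C * (L + L^2) / q^2) < 0" using c by linarith
      qed (use q in simp)
      finally show ?thesis using A L by (simp add: divide_neg_pos)
    qed
    finally show "?E (\<lambda>n. 1 / (A + ln (real n))) < 1 / (A + ln (real z))" by (simp add: L_def)
  qed simp
qed

text \<open>At \<open>a = 1/3\<close> the drift of \<open>ln z\<close> has no leading term, only an
  error of unknown sign of order \<open>1 / (z * sqrt z)\<close>. Inside the common factor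
  \<open>1 / B\<close> with \<open>B = 1 + ln z\<close>, concavity of the outer logarithm
  contributes \<open>- 1 / (3 * B * z)\<close>, which dominates that error.\<close>

lemma lyapunov_recurrent:
  assumes k4: "integrable (measure_pmf \<kappa>) (\<lambda>k. real_of_int k ^ 4)"
    and mean: "measure_pmf.expectation \<kappa> real_of_int \<ge> 1/3"
  obtains N where "N \<ge> 1"
    and "\<And>z. z \<ge> N \<Longrightarrow>
      measure_pmf.expectation (urn_chain \<kappa> z) (\<lambda>n. ln (1 + ln (real n))) \<le> ln (1 + ln (real z))"
proof -
  define a where "a = 2/3 - measure_pmf.expectation \<kappa> real_of_int"
  have a: "a \<le> 1/3" using mean by (simp add: a_def)
  obtain C where C: "C \<ge> 1"
    "\<And>z. z \<ge> 1 \<Longrightarrow> integrable (measure_pmf (urn_chain \<kappa> z)) (\<lambda>n. (real n / real z - 1) ^ 4)"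
    "\<And>z. z \<ge> 1 \<Longrightarrow>
      \<bar>measure_pmf.expectation (urn_chain \<kappa> z) (\<lambda>n. real n / real z - 1) - a / real z\<bar> \<le> C / sqrt (real z) ^ 3"
    "\<And>z. z \<ge> 1 \<Longrightarrow>
      \<bar>measure_pmf.expectation (urn_chain \<kappa> z) (\<lambda>n. (real n / real z - 1)^2) - 2/3 / real z\<bar> \<le> C / sqrt (real z) ^ 3"
    "\<And>z. z \<ge> 1 \<Longrightarrow>
      measure_pmf.expectation (urn_chain \<kappa> z) (\<lambda>n. \<bar>real n / real z - 1\<bar>^3) \<le> C / sqrt (real z) ^ 3"
    "\<And>z. z \<ge> 1 \<Longrightarrow>
      measure_pmf.expectation (urn_chain \<kappa> z) (\<lambda>n. (real n / real z - 1)^4) \<le> C / real z ^ 2"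
    using urn_chain_relative_moments[OF k4] unfolding a_def by blast
  \<comment> \<open>With \<open>e = C / q^3\<close> the errors amount to \<open>4 * e\<close>: one
    from the mean, one from the second moment, two from the third. \<open>12 * C * B \<le> q\<close>
    says \<open>4 * e \<le> 1 / (3 * B * q^2)\<close>.\<close>
  have "(\<lambda>z. 12 * C * (1 + ln (real z)) / sqrt (real z)) \<longlonglongrightarrow> 0" by real_asymp
  then have "eventually (\<lambda>z. 12 * C * (1 + ln (real z)) / sqrt (real z) < 1) sequentially"
    by (intro order_tendstoD) auto
  then obtain N where N: "\<And>z. z \<ge> N \<Longrightarrow> 12 * C * (1 + ln (real z)) / sqrt (real z) < 1"
    unfolding eventually_sequentially by blast
  show thesis
  proof (rule that[of "max 1 N"])
    fix z assume "z \<ge> max 1 N"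
    then have z: "z \<ge> 1" "z \<ge> N" by auto
    let ?E = "measure_pmf.expectation (urn_chain \<kappa> z)"
    define t where "t n = real n / real z - 1" for n
    define B where "B = 1 + ln (real z)"
    define q where "q = sqrt z"
    have q: "q \<ge> 1" "real z = q^2" using z by (auto simp: q_def)
    then have q_abs [simp]: "\<bar>q\<bar> = q" by simp
    have B: "B \<ge> 1" using z by (simp add: B_def)
    have le: "ln (1 + ln (real n)) \<le> ln B + 1/B * t n + - (1/2 + 1/(2*B)) / B * t n ^ 2 + 2/B * \<bar>t n\<bar> ^ 3 + 0 * t n ^ 4"
      if n: "n \<ge> 1" for n
    proof -
      define l where "l = ln (1 + t n)"
      have tn: "1 + t n = real n / real z" by (simp add: t_def)
      have "0 < real n / real z" using n z by simp
      then have tn1: "t n > -1" by (simp add: t_def)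
      have ln: "1 + ln (real n) = B + l" using n z by (simp add: l_def tn ln_div B_def)
      define u where "u = l / B"
      have "ln (real n) \<ge> 0" using n by simp
      then have Bl: "B + l \<ge> 1" unfolding ln[symmetric] by simp
      have u: "1 + u = (B + l) / B" using B by (simp add: u_def field_simps)
      then have u1: "u > -1" using B Bl by (smt (verit) divide_pos_pos)
      have lnu: "ln (1 + ln (real n)) = ln B + ln (1 + u)"
        unfolding ln u using B Bl by (simp add: ln_div)
      have cub: "ln (1 + u) \<le> u - u^2/2 + u^3/3" using u1 by (rule ln_1_plus_le_cubic)
      have c1: "u \<le> (t n - t n^2/2 + \<bar>t n\<bar>^3/3) / B"
      proof -
        have "l \<le> t n - t n^2/2 + t n^3/3" unfolding l_def using tn1 by (rule ln_1_plus_le_cubic)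
        moreover have "t n^3 \<le> \<bar>t n\<bar>^3" by (simp add: power_abs[symmetric])
        ultimately show ?thesis unfolding u_def using B by (intro divide_right_mono) auto
      qed
      \<comment> \<open>The bound is one-sided, so for \<open>t n < 0\<close> the sign of
        \<open>u^3\<close> suffices and the singularity of the logarithm does not matter.\<close>
      have c3: "u^3 \<le> \<bar>t n\<bar>^3 / B"
      proof (cases "t n \<ge> 0")
        case True
        have "l \<le> t n" unfolding l_def using tn1 by (intro ln_add_one_self_le_self2) auto
        moreover have "0 \<le> l" unfolding l_def using True by simp
        ultimately have "l^3 \<le> \<bar>t n\<bar>^3" by (intro power_mono) auto
        then have "l^3 / B^3 \<le> \<bar>t n\<bar>^3 / B^3" using B by (intro divide_right_mono) auto
        also have "\<dots> \<le> \<bar>t n\<bar>^3 / B" using B by (intro divide_left_mono) (auto simp: self_le_power)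
        finally show ?thesis by (simp add: u_def power_divide)
      next
        case False
        have "l \<le> 0" unfolding l_def using tn1 False by (subst ln_le_zero_iff) auto
        then have "u \<le> 0" using B by (simp add: u_def divide_nonpos_nonneg)
        then have "u^3 \<le> 0" by (simp add: power3_eq_cube mult_nonneg_nonpos mult_nonpos_nonpos)
        also have "0 \<le> \<bar>t n\<bar>^3 / B" using B by simp
        finally show ?thesis .
      qed
      have c2: "(t n^2 - 2 * \<bar>t n\<bar>^3) / B^2 \<le> u^2"
        unfolding u_def power_divide using ln_1_plus_sq_ge[OF tn1] B by (simp add: l_def divide_right_mono)
      have "u - u^2/2 + u^3/3 \<le> x - y/2 + z/3" if "u \<le> x" "y \<le> u^2" "u^3 \<le> z" for x y z
        using that by simp
      from this[OF c1 c2 c3] cub have "ln (1 + ln (real n)) \<le> ln B + ((t n - t n^2/2 + \<bar>t n\<bar>^3/3) / B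
          - (t n^2 - 2 * \<bar>t n\<bar>^3) / B^2 / 2 + \<bar>t n\<bar>^3 / B / 3)"
        unfolding lnu by (simp only: add_le_cancel_left)
      also have "\<dots> = ln B + 1/B * t n + - (1/2 + 1/(2*B)) / B * t n ^ 2 + (2/3/B * \<bar>t n\<bar>^3 + \<bar>t n\<bar>^3 / B^2)"
        using B by (simp add: field_simps power2_eq_square)
      also have "\<bar>t n\<bar>^3 / B^2 \<le> \<bar>t n\<bar>^3 / B" using B by (intro divide_left_mono) (auto simp: self_le_power)
      also have "2/3/B * \<bar>t n\<bar>^3 + \<bar>t n\<bar>^3 / B \<le> 2/B * \<bar>t n\<bar> ^ 3"
        using B by (simp add: divide_right_mono field_simps)
      finally show ?thesis by simp
    qed
    have int: "integrable (measure_pmf (urn_chain \<kappa> z)) (\<lambda>n. ln (1 + ln (real n)))"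
    proof (rule integrable_urn_chain[OF k4 z(1), where c=1])
      fix n :: nat assume n: "n \<ge> 1"
      then have "0 \<le> ln (real n)" "ln (real n) \<le> real n" by (auto intro!: order_trans[OF ln_le_minus_one])
      moreover from this have "ln (1 + ln (real n)) \<le> ln (real n)" by (intro ln_add_one_self_le_self) auto
      ultimately show "\<bar>ln (1 + ln (real n))\<bar> \<le> 1 * (1 + real n ^ 4)" using real_le_1_pow4[of n] by simp
    qed
    define e where "e = C / q^3"
    have e: "e > 0" using C q by (simp add: e_def)
    have m: "?E t \<le> a / q^2 + e" "?E (\<lambda>n. t n ^ 2) \<ge> 2/3 / q^2 - e" "?E (\<lambda>n. \<bar>t n\<bar>^3) \<le> e"
      using C(3-5)[OF z(1)] unfolding t_def[abs_def] e_def q_def[symmetric] q(2)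
      by (auto simp: abs_le_iff algebra_simps)
    have "?E (\<lambda>n. ln (1 + ln (real n))) \<le> ln B + 1/B * ?E t + - (1/2 + 1/(2*B)) / B * ?E (\<lambda>n. t n ^ 2)
       + 2/B * ?E (\<lambda>n. \<bar>t n\<bar> ^ 3) + 0 * ?E (\<lambda>n. t n ^ 4)"
    proof (rule expectation_le_of_poly[OF int])
      show "integrable (measure_pmf (urn_chain \<kappa> z)) (\<lambda>n. t n ^ 4)" using C(2)[OF z(1)] by (simp add: t_def)
    qed (use le urn_chain_pos in blast)
    also have "\<dots> = ln B + (?E t - (1/2 + 1/(2*B)) * ?E (\<lambda>n. t n ^ 2) + 2 * ?E (\<lambda>n. \<bar>t n\<bar> ^ 3)) / B"
    proof -
      have "x + 1 / s * u + - p / s * v + 2 / s * w + 0 * y = x + (u - p * v + 2 * w) / s"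
        for x s u p v w y :: real by (simp add: add_divide_distrib diff_divide_distrib)
      then show ?thesis .
    qed
    also have "\<dots> \<le> ln B + 0 / B"
    proof (intro add_left_mono divide_right_mono)
      have "1 / (2 * B) \<le> 1 / 2" using B by (simp add: field_simps)
      moreover have "0 \<le> 1 / (2 * B)" using B by simp
      ultimately have B2: "0 \<le> 1/2 + 1/(2*B)" "1/2 + 1/(2*B) \<le> 1" by linarith+
      have "(1/2 + 1/(2*B)) * (2/3 / q^2 - e) \<le> (1/2 + 1/(2*B)) * ?E (\<lambda>n. t n ^ 2)"
        using m B2 by (intro mult_left_mono) auto
      moreover have "(1/2 + 1/(2*B)) * (2/3 / q^2 - e) = 1/3 / q^2 + 1/(3*B) / q^2 - (1/2 + 1/(2*B)) * e"
      proof -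
        have "(1/2 + k / 2) * (2/3 * i - e) = 1/3 * i + k / 3 * i - (1/2 + k / 2) * e" for i k :: real
          by (simp add: algebra_simps)
        from this[of "1 / B" "1 / q^2"] show ?thesis by (simp add: mult.commute)
      qed
      moreover have "(1/2 + 1/(2*B)) * e \<le> 1 * e" using B2 e by (intro mult_right_mono) auto
      moreover have "a / q^2 \<le> 1/3 / q^2" using a by (intro divide_right_mono) auto
      moreover have "4 * e \<le> 1/(3*B) / q^2"
      proof -
        have "12 * C * B / q \<le> 1" using N[OF z(2)] by (simp add: B_def q_def)
        then have "12 * C * B \<le> q" using q by (simp add: field_simps)
        then have "12 * C * B * q^2 \<le> q * q^2" using q by (intro mult_right_mono) auto
        then show ?thesis using q B by (simp add: e_def field_simps power3_eq_cube power2_eq_square)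
      qed
      ultimately show "?E t - (1/2 + 1/(2*B)) * ?E (\<lambda>n. t n ^ 2) + 2 * ?E (\<lambda>n. \<bar>t n\<bar> ^ 3) \<le> 0"
        using m by linarith
    qed (use B in auto)
    finally show "?E (\<lambda>n. ln (1 + ln (real n))) \<le> ln (1 + ln (real z))" by (simp add: B_def)
  qed simp
qed

lemma lyapunov_positive:
  assumes k4: "integrable (measure_pmf \<kappa>) (\<lambda>k. real_of_int k ^ 4)"
    and mean: "measure_pmf.expectation \<kappa> real_of_int > 2/3"
  obtains c N where "c > 0"
    and "\<And>z. z \<ge> N \<Longrightarrow> measure_pmf.expectation (urn_chain \<kappa> z) real \<le> real z - c"
proof -
  define a where "a = 2/3 - measure_pmf.expectation \<kappa> real_of_int"
  have a: "a < 0" using mean by (simp add: a_def)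
  obtain C where C: "\<And>z. z \<ge> 1 \<Longrightarrow>
      \<bar>measure_pmf.expectation (urn_chain \<kappa> z) (\<lambda>n. real n - real z) - a\<bar> \<le> C / sqrt z"
    using urn_chain_moments[OF k4, folded a_def, of thesis] by meson
  have "(\<lambda>z. 1 / sqrt (real z)) \<longlonglongrightarrow> 0" by real_asymp
  from tendsto_mult_left[OF this, of C] have "(\<lambda>z. C / sqrt (real z)) \<longlonglongrightarrow> 0" by simp
  then have "eventually (\<lambda>z. C / sqrt (real z) < - a / 2) sequentially"
    using a by (intro order_tendstoD) auto
  then obtain N where N: "\<And>z. z \<ge> N \<Longrightarrow> C / sqrt (real z) < - a / 2"
    unfolding eventually_sequentially by blast
  show thesis
  proof (rule that[of "- a / 2" "max 1 N"])
    fix z assume "z \<ge> max 1 N"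
    then have z: "z \<ge> 1" "z \<ge> N" by auto
    have "integrable (measure_pmf (urn_chain \<kappa> z)) real"
      by (rule integrable_urn_chain[OF k4 z(1), where c=1]) (simp add: real_le_1_pow4)
    then have "measure_pmf.expectation (urn_chain \<kappa> z) (\<lambda>n. real n - real z)
       = measure_pmf.expectation (urn_chain \<kappa> z) real - real z" by simp
    with C[OF z(1)] N[OF z(2)] show "measure_pmf.expectation (urn_chain \<kappa> z) real \<le> real z - - a / 2"
      by linarith
  qed (use a in auto)
qed

text \<open>A submartingale with linear growth. The correction \<open>- K * sqrt z\<close> to the identity has drift of
  order \<open>1 / sqrt z\<close>, which absorbs the error term in the drift of the chain.\<close>

lemma lyapunov_null:
  assumes k4: "integrable (measure_pmf \<kappa>) (\<lambda>k. real_of_int k ^ 4)"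
    and mean: "measure_pmf.expectation \<kappa> real_of_int \<le> 2/3"
  obtains h :: "nat \<Rightarrow> real" and N :: nat and C :: real where "h 0 = 0" "h 1 = 0" "\<And>z. 0 \<le> h z"
    and "\<And>z. z \<ge> N \<Longrightarrow> h z > 0"
    and "\<And>z. z \<ge> 1 \<Longrightarrow> integrable (measure_pmf (urn_chain \<kappa> z)) (\<lambda>n. (h n - h z)^2)"
    and "\<And>z. z \<ge> 1 \<Longrightarrow> integrable (measure_pmf (urn_chain \<kappa> z)) h"
    and "\<And>z. z \<ge> 1 \<Longrightarrow> h z \<le> measure_pmf.expectation (urn_chain \<kappa> z) h"
    and "\<And>z. z \<ge> 1 \<Longrightarrow> measure_pmf.expectation (urn_chain \<kappa> z) h \<le> h z + C"
    and "\<And>z. z \<ge> 1 \<Longrightarrow> measure_pmf.expectation (urn_chain \<kappa> z) (\<lambda>n. (h n - h z)^2) \<le> C * (1 + h z)"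
proof -
  define a where "a = 2/3 - measure_pmf.expectation \<kappa> real_of_int"
  have a: "a \<ge> 0" using mean by (simp add: a_def)
  obtain C where C: "C \<ge> 1"
    "\<And>z. z \<ge> 1 \<Longrightarrow> integrable (measure_pmf (urn_chain \<kappa> z)) (\<lambda>n. (real n / real z - 1) ^ 4)"
    "\<And>z. z \<ge> 1 \<Longrightarrow>
      \<bar>measure_pmf.expectation (urn_chain \<kappa> z) (\<lambda>n. real n / real z - 1) - a / real z\<bar> \<le> C / sqrt (real z) ^ 3"
    "\<And>z. z \<ge> 1 \<Longrightarrow>
      \<bar>measure_pmf.expectation (urn_chain \<kappa> z) (\<lambda>n. (real n / real z - 1)^2) - 2/3 / real z\<bar> \<le> C / sqrt (real z) ^ 3"
    "\<And>z. z \<ge> 1 \<Longrightarrow>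
      measure_pmf.expectation (urn_chain \<kappa> z) (\<lambda>n. \<bar>real n / real z - 1\<bar>^3) \<le> C / sqrt (real z) ^ 3"
    "\<And>z. z \<ge> 1 \<Longrightarrow>
      measure_pmf.expectation (urn_chain \<kappa> z) (\<lambda>n. (real n / real z - 1)^4) \<le> C / real z ^ 2"
    using urn_chain_relative_moments[OF k4] unfolding a_def by blast
  \<comment> \<open>Concavity of \<open>sqrt\<close> gives \<open>- K * sqrt z\<close> the drift
    \<open>K / (12 * sqrt z)\<close>, from \<open>K / 8\<close> times \<open>2/3\<close>. It has to
    exceed the error \<open>C / sqrt z\<close> of the linear part; \<open>24\<close> leaves a factor
    two.\<close>
  define K where "K = 24 * C"
  \<comment> \<open>Beyond \<open>N\<close> one has \<open>sqrt z \<ge> K\<close>, so the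
    coefficient \<open>z - K * sqrt z / 2\<close> of the relative increment is nonnegative. Up to
    \<open>N\<close> the function \<open>h\<close> vanishes and the submartingale inequality is
    trivial.\<close>
  define N where "N = nat \<lceil>K^2\<rceil>"
  define f where "f z = real z - K * sqrt (real z)" for z
  define h where "h z = max 0 (f z - real N)" for z
  have K: "K \<ge> 24" using C by (simp add: K_def)
  have N1: "real N \<ge> K^2" by (simp add: N_def)
  have "1 \<le> K^2" using K by (simp add: one_le_power)
  with N1 have N1': "real N \<ge> 1" by linarith
  have fle: "f z \<le> real z" for z using K by (simp add: f_def)
  have h_small: "h z = 0" if "z \<le> N" for z
    using that fle[of z] by (simp add: h_def)
  have f_ge: "f z \<ge> real z / 2 - K^2 / 2" for z
  proof -
    have "0 \<le> (sqrt (real z) - K)^2" by simp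
    then have "2 * (K * sqrt (real z)) \<le> real z + K^2" by (simp add: power2_diff algebra_simps)
    then show ?thesis by (simp add: f_def)
  qed
  define C1 where "C1 = real N + K^2 + a + C + K * (2 + C)"
  define C2 where "C2 = (1 + K)^2 * (2/3 + C) * (2 * real N + K^2 + 2)"
  have C1: "C1 \<ge> 0" using K C a by (simp add: C1_def)
  have C2: "C2 \<ge> 0" using K C by (simp add: C2_def)
  show thesis
  proof (rule that[of h "nat \<lceil>4 * real N + K^2\<rceil> + 1" "C1 + C2"])
    show "h 0 = 0" "h 1 = 0" using h_small N1' by auto
    show h0: "0 \<le> h z" for z by (simp add: h_def)
    show "h z > 0" if "z \<ge> nat \<lceil>4 * real N + K^2\<rceil> + 1" for z
    proof -
      have "real z > 4 * real N + K^2" using that by linarith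
      with f_ge[of z] N1' show ?thesis by (simp add: h_def)
    qed
    fix z :: nat assume z: "z \<ge> 1"
    let ?E = "measure_pmf.expectation (urn_chain \<kappa> z)"
    define t where "t n = real n / real z - 1" for n
    define q where "q = sqrt z"
    have q: "q \<ge> 1" "real z = q^2" using z by (auto simp: q_def)
    then have q_abs [simp]: "\<bar>q\<bar> = q" by simp
    have t4: "integrable (measure_pmf (urn_chain \<kappa> z)) (\<lambda>n. t n ^ 4)" using C(2)[OF z] by (simp add: t_def)
    note ti = integrable_pow_le4[OF t4]
    have ti1: "integrable (measure_pmf (urn_chain \<kappa> z)) t" and ti2: "integrable (measure_pmf (urn_chain \<kappa> z)) (\<lambda>n. t n ^ 2)"
      using ti(1)[of 1] ti(1)[of 2] by auto
    define e where "e = C / q^3"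
    have e: "e > 0" using C q by (simp add: e_def)
    have m: "\<bar>?E t - a / q^2\<bar> \<le> e" "\<bar>?E (\<lambda>n. t n ^ 2) - 2/3 / q^2\<bar> \<le> e" "?E (\<lambda>n. \<bar>t n\<bar>^3) \<le> e"
      using C(3-5)[OF z] unfolding t_def[abs_def] e_def q_def[symmetric] q(2) by auto
    have nt: "real n - real z = q^2 * t n" for n using z q by (simp add: t_def right_diff_distrib)
    have absh: "\<bar>h n\<bar> \<le> 1 * (1 + real n ^ 4)" for n
      using fle[of n] real_le_1_pow4[of n] N1' by (auto simp: h_def)
    show ih: "integrable (measure_pmf (urn_chain \<kappa> z)) h"
      by (rule integrable_urn_chain[OF k4 z absh])
    have sq: "\<bar>sqrt (real n) - sqrt (real z)\<bar> \<le> \<bar>real n - real z\<bar> / q" for n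
    proof -
      have "real n - real z = (sqrt (real n) - q) * (sqrt (real n) + q)"
        using q by (simp add: algebra_simps power2_eq_square)
      then have "\<bar>real n - real z\<bar> = \<bar>sqrt (real n) - q\<bar> * (sqrt (real n) + q)"
        using q by (simp add: abs_mult)
      also have "\<dots> \<ge> \<bar>sqrt (real n) - q\<bar> * q" by (intro mult_left_mono) auto
      finally show ?thesis using q by (simp add: q_def[symmetric] field_simps)
    qed
    have fdiff: "\<bar>f n - f z\<bar> \<le> (1 + K) * \<bar>real n - real z\<bar>" for n
    proof -
      have "\<bar>real n - real z\<bar> / q \<le> \<bar>real n - real z\<bar>"
        using divide_left_mono[of 1 q "\<bar>real n - real z\<bar>"] q by simp
      with sq[of n] have "\<bar>sqrt (real n) - sqrt (real z)\<bar> \<le> \<bar>real n - real z\<bar>" by linarith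
      then have "K * \<bar>sqrt (real n) - sqrt (real z)\<bar> \<le> K * \<bar>real n - real z\<bar>" using K by (intro mult_left_mono) auto
      moreover have "f n - f z = (real n - real z) - K * (sqrt (real n) - sqrt (real z))"
        by (simp add: f_def algebra_simps)
      moreover have "\<bar>K * (sqrt (real n) - sqrt (real z))\<bar> = K * \<bar>sqrt (real n) - sqrt (real z)\<bar>"
        using K by (simp add: abs_mult)
      ultimately show ?thesis by (simp add: distrib_right)
    qed
    have hdiff: "(h n - h z)^2 \<le> (1 + K)^2 * q^4 * t n ^ 2" for n
    proof -
      have "\<bar>h n - h z\<bar> \<le> \<bar>f n - f z\<bar>" by (auto simp: h_def)
      also note fdiff
      finally have "\<bar>h n - h z\<bar>^2 \<le> ((1 + K) * \<bar>real n - real z\<bar>)^2" by (intro power_mono) auto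
      also have "\<dots> = (1 + K)^2 * (real n - real z)^2" by (simp add: power_mult_distrib)
      also have "\<dots> = (1 + K)^2 * q^4 * t n ^ 2" unfolding nt by (simp add: power_mult_distrib power_mult[symmetric])
      finally show ?thesis by simp
    qed
    show ihh: "integrable (measure_pmf (urn_chain \<kappa> z)) (\<lambda>n. (h n - h z)^2)"
      by (rule Bochner_Integration.integrable_bound[of _ "\<lambda>n. (1 + K)^2 * q^4 * t n ^ 2"])
        (use ti2 hdiff in auto)
    have Et2: "?E (\<lambda>n. t n ^ 2) \<le> (2/3 + C) / q^2"
    proof -
      have "e \<le> C / q^2" unfolding e_def using q C by (intro divide_left_mono power_increasing) auto
      with m(2) show ?thesis unfolding add_divide_distrib by linarith
    qed
    have "?E (\<lambda>n. (h n - h z)^2) \<le> ?E (\<lambda>n. (1 + K)^2 * q^4 * t n ^ 2)"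
      using ihh ti2 hdiff by (intro integral_mono) auto
    also have "\<dots> = (1 + K)^2 * q^4 * ?E (\<lambda>n. t n ^ 2)" using ti2 by simp
    also have "\<dots> \<le> (1 + K)^2 * q^4 * ((2/3 + C) / q^2)" using Et2 by (intro mult_left_mono) auto
    also have "\<dots> = (1 + K)^2 * (2/3 + C) * q^2" using q by (simp add: power_numeral_reduce)
    \<comment> \<open>\<open>h\<close> is at least \<open>z / 2\<close> minus a constant, so a
      second moment that is linear in \<open>z\<close> is linear in \<open>1 + h z\<close>.\<close>
    also have "q^2 \<le> (2 * real N + K^2 + 2) * (1 + h z)"
    proof -
      have "real z / 2 - K^2 / 2 - real N \<le> h z" using f_ge[of z] by (simp add: h_def)
      then have "q^2 \<le> (2 * real N + K^2) * 1 + 2 * h z" using q by simp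
      also have "\<dots> \<le> (2 * real N + K^2) * (1 + h z) + 2 * (1 + h z)"
        using h0[of z] by (intro add_mono mult_left_mono) auto
      finally show ?thesis by (simp add: algebra_simps)
    qed
    also have "(1 + K)^2 * (2/3 + C) * ((2 * real N + K^2 + 2) * (1 + h z)) = C2 * (1 + h z)"
      by (simp add: C2_def)
    also have "\<dots> \<le> (C1 + C2) * (1 + h z)" using C1 h0[of z] by (intro mult_right_mono) auto
    finally show "?E (\<lambda>n. (h n - h z)^2) \<le> (C1 + C2) * (1 + h z)"
      using C K by (simp add: mult_left_mono)
    have if': "integrable (measure_pmf (urn_chain \<kappa> z)) f"
    proof -
      have "integrable (measure_pmf (urn_chain \<kappa> z)) (\<lambda>n. sqrt (real n))"
      proof (rule integrable_urn_chain[OF k4 z, where c=1])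
        fix n :: nat assume "n \<ge> 1"
        then have "sqrt (real n) \<le> real n" by (intro real_le_lsqrt) (auto simp: power2_eq_square)
        with real_le_1_pow4[of n] show "\<bar>sqrt (real n)\<bar> \<le> 1 * (1 + real n ^ 4)" by simp
      qed
      moreover have "integrable (measure_pmf (urn_chain \<kappa> z)) real"
        by (rule integrable_urn_chain[OF k4 z, where c=1]) (simp add: real_le_1_pow4)
      ultimately show ?thesis unfolding f_def[abs_def] by simp
    qed
    show "h z \<le> ?E h"
    proof (cases "z \<le> N")
      case True
      then show ?thesis using h_small h0 by (simp add: integral_nonneg_AE)
    next
      case False
      then have "real z \<ge> K^2" using N1 by linarith
      then have qK: "q \<ge> K" using q K by (simp add: abs_le_square_iff[symmetric])
      have "?E (\<lambda>n. - f n) \<le> - f z + (K * q / 2 - q^2) * ?E t + - (K * q / 8) * ?E (\<lambda>n. t n ^ 2)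
          + K * q / 16 * ?E (\<lambda>n. \<bar>t n\<bar>^3) + 0 * ?E (\<lambda>n. t n ^ 4)"
      proof (rule expectation_le_of_poly[OF _ t4])
        show "integrable (measure_pmf (urn_chain \<kappa> z)) (\<lambda>n. - f n)" using if' by simp
        fix n assume "n \<in> set_pmf (urn_chain \<kappa> z)"
        have tn: "1 + t n = real n / real z" by (simp add: t_def)
        then have tn1: "t n \<ge> -1" using z by (smt (verit) divide_nonneg_nonneg of_nat_0_le_iff)
        have "sqrt (real n) = q * sqrt (1 + t n)" unfolding tn q_def using z by (simp add: real_sqrt_divide)
        also have "\<dots> \<le> q * (1 + t n / 2 - t n^2 / 8 + t n^3 / 16)"
          using q tn1 by (intro mult_left_mono sqrt_1_plus_le) auto
        also have "\<dots> \<le> q * (1 + t n / 2 - t n^2 / 8 + \<bar>t n\<bar>^3 / 16)"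
          using q by (intro mult_left_mono) (auto simp: power_abs[symmetric])
        finally have "K * sqrt (real n) \<le> K * (q * (1 + t n / 2 - t n^2 / 8 + \<bar>t n\<bar>^3 / 16))"
          using K by (intro mult_left_mono) auto
        moreover have "real n = real z + q^2 * t n" using nt[of n] by simp
        ultimately show "- f n \<le> - f z + (K * q / 2 - q^2) * t n + - (K * q / 8) * t n ^ 2
          + K * q / 16 * \<bar>t n\<bar>^3 + 0 * t n ^ 4"
          by (simp add: f_def q_def[symmetric] algebra_simps)
      qed
      also have "\<dots> \<le> - f z + (K * q / 2 - q^2) * (a / q^2 - e) + - (K * q / 8) * (2/3 / q^2 - e) + K * q / 16 * e + 0"
      proof -
        have "K * q / 2 - q^2 \<le> 0" using qK K q by (simp add: power2_eq_square mult_right_mono)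
        moreover have "a / q^2 - e \<le> ?E t" "2/3 / q^2 - e \<le> ?E (\<lambda>n. t n ^ 2)" using m by (auto simp: abs_le_iff)
        moreover have "- (K * q / 8) \<le> 0" "0 \<le> K * q / 16" using K q by auto
        ultimately show ?thesis
          using m(3) by (intro add_mono mult_left_mono_neg mult_left_mono[of _ _ "K * q / 16"]) auto
      qed
      also have "\<dots> = - f z - a * (1 - K / 2 / q) - (K/12 - C - (- (1/2) + 1/8 + 1/16) * K * C / q) / q"
        using q by (simp add: e_def field_simps power2_eq_square power3_eq_cube)
      also have "\<dots> \<le> - f z - 0 - 0"
      proof (intro diff_mono)
        show "0 \<le> a * (1 - K / 2 / q)" using a qK K by (intro mult_nonneg_nonneg) (auto simp: field_simps)
        have "0 \<le> K * C / q" using K C q by simp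
        then show "0 \<le> (K/12 - C - (- (1/2) + 1/8 + 1/16) * K * C / q) / q"
          using q C by (intro divide_nonneg_pos) (auto simp: K_def)
      qed simp
      finally have "f z \<le> ?E f" by simp
      moreover have "?E f - real N \<le> ?E h"
      proof -
        have "?E f - real N = ?E (\<lambda>n. f n - real N)" using if' by simp
        also have "\<dots> \<le> ?E h" using if' ih by (intro integral_mono) (auto simp: h_def)
        finally show ?thesis .
      qed
      moreover have "0 \<le> ?E h" using h0 by (simp add: integral_nonneg_AE)
      ultimately show ?thesis by (simp add: h_def)
    qed
    have "?E h \<le> ?E (\<lambda>n. h z + real N + K^2 + q^2 * t n + K * (1 + q^2 * t n ^ 2))"
    proof (rule integral_mono[OF ih])
      show "integrable (measure_pmf (urn_chain \<kappa> z)) (\<lambda>n. h z + real N + K^2 + q^2 * t n + K * (1 + q^2 * t n ^ 2))"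
        using ti1 ti2 by simp
      fix n
      have "0 \<le> K^2" by simp
      then have "f n \<ge> - (K^2)" using f_ge[of n] of_nat_0_le_iff[of n, where 'a=real] by linarith
      have "f n - real N \<le> f n + K^2" using N1' \<open>0 \<le> K^2\<close> by linarith
      moreover have "0 \<le> f n + K^2" using \<open>f n \<ge> - (K^2)\<close> by linarith
      ultimately have "h n \<le> f n + K^2" unfolding h_def by (rule max.boundedI[rotated])
      moreover have "h z \<ge> f z - real N" by (simp add: h_def)
      moreover have "f n - f z = q^2 * t n - K * (sqrt (real n) - sqrt (real z))"
        using nt[of n] by (simp add: f_def algebra_simps)
      moreover have "- K * (sqrt (real n) - sqrt (real z)) \<le> K * (1 + q^2 * t n ^ 2)"
      proof -
        have "\<bar>sqrt (real n) - sqrt (real z)\<bar> \<le> \<bar>q * t n\<bar>"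
          using sq[of n] q unfolding nt by (simp add: abs_mult power2_eq_square)
        also have "\<dots> \<le> 1 + (q * t n)^2" using pow_le_pow4[of 1] zero_le_power2[of "\<bar>q * t n\<bar> - 1"]
          by (simp add: power2_diff)
        finally have "- (sqrt (real n) - sqrt (real z)) \<le> 1 + q^2 * t n ^ 2" by (simp add: power_mult_distrib)
        from mult_left_mono[OF this, of K] K show ?thesis by (simp only: minus_mult_commute)
      qed
      ultimately show "h n \<le> h z + real N + K^2 + q^2 * t n + K * (1 + q^2 * t n ^ 2)" by linarith
    qed
    also have "\<dots> = h z + real N + K^2 + q^2 * ?E t + K * (1 + q^2 * ?E (\<lambda>n. t n ^ 2))"
      using ti1 ti2 by simp
    also have "\<dots> \<le> h z + real N + K^2 + (a + C) + K * (1 + (1 + C))"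
    proof (intro add_mono mult_left_mono order_refl)
      have "q^2 * ?E t \<le> q^2 * (a / q^2 + e)" using m by (intro mult_left_mono) (auto simp: abs_le_iff)
      also have "\<dots> = a + C / q" using q by (simp add: e_def field_simps power2_eq_square power3_eq_cube)
      also have "\<dots> \<le> a + C" using q C by (simp add: field_simps)
      finally show "q^2 * ?E t \<le> a + C" .
      have "q^2 * ?E (\<lambda>n. t n ^ 2) \<le> q^2 * ((2/3 + C) / q^2)" using Et2 by (intro mult_left_mono) auto
      then show "q^2 * ?E (\<lambda>n. t n ^ 2) \<le> 1 + C" using q by simp
    qed (use K in auto)
    also have "\<dots> \<le> h z + (C1 + C2)" using C2 by (simp add: C1_def)
    finally show "?E h \<le> h z + (C1 + C2)" .
  qed
qed

section \<open>Taboo probabilities\<close>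

text \<open>\<open>taboo P c \<phi> n z\<close> is the expectation of \<open>\<phi>\<close> at time \<open>n\<close> on the event that the chain with
  kernel \<open>P\<close> started at \<open>z\<close> does not visit \<open>c\<close> at the times \<open>1, \<dots>, n\<close>.\<close>

primrec taboo :: "('s \<Rightarrow> 's pmf) \<Rightarrow> 's \<Rightarrow> ('s \<Rightarrow> real) \<Rightarrow> nat \<Rightarrow> 's \<Rightarrow> real" where
  "taboo P c \<phi> 0 = \<phi>"
| "taboo P c \<phi> (Suc n) = (\<lambda>z. measure_pmf.expectation (P z) (\<lambda>w. if w = c then 0 else taboo P c \<phi> n w))"

abbreviation avoid :: "('s \<Rightarrow> 's pmf) \<Rightarrow> 's \<Rightarrow> nat \<Rightarrow> 's \<Rightarrow> real" where
  "avoid P c \<equiv> taboo P c (\<lambda>_. 1)"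

section \<open>Bounds, monotonicity and limits of taboo expectations\<close>

lemma integrable_pmf_bounded:
  fixes f :: "'s \<Rightarrow> real"
  assumes "\<And>x. \<bar>f x\<bar> \<le> B"
  shows "integrable (measure_pmf p) f"
  by (rule measure_pmf.integrable_const_bound[where B=B]) (use assms in auto)

lemma expectation_le_const:
  fixes f :: "'s \<Rightarrow> real"
  assumes "integrable (measure_pmf p) f" "\<And>x. f x \<le> B"
  shows "measure_pmf.expectation p f \<le> B"
proof -
  have "measure_pmf.expectation p f \<le> measure_pmf.expectation p (\<lambda>_. B)"
    using assms by (intro integral_mono) auto
  then show ?thesis by simp
qed

lemma expectation_indicator_point: "measure_pmf.expectation p (\<lambda>w. if w = c then a else 0) = pmf p c * a"
  by (subst integral_measure_pmf[of "{c}"]) (auto split: if_splits)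

lemma avoid_bounds: "0 \<le> avoid P c n z \<and> avoid P c n z \<le> 1"
proof (induction n arbitrary: z)
  case (Suc n)
  have i: "integrable (measure_pmf (P z)) (\<lambda>w. if w = c then 0 else avoid P c n w)"
  proof (rule integrable_pmf_bounded)
    show "\<bar>if w = c then 0 else avoid P c n w\<bar> \<le> 1" for w using Suc[of w] by auto
  qed
  show ?case using Suc by (auto intro!: integral_nonneg_AE expectation_le_const[OF i])
qed simp

lemma taboo_bound:
  assumes "\<And>z. \<bar>\<phi> z\<bar> \<le> B"
  shows "\<bar>taboo P c \<phi> n z\<bar> \<le> B * avoid P c n z"
proof (induction n arbitrary: z)
  case 0
  then show ?case using assms by simp
next
  case (Suc n)
  have B: "0 \<le> B" using assms[of z] by linarith
  have *: "\<bar>if w = c then 0 else taboo P c \<phi> n w\<bar> \<le> B * (if w = c then 0 else avoid P c n w)" for w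
    using Suc by simp
  have **: "\<bar>if w = c then 0 else avoid P c n w\<bar> \<le> 1" for w
    using avoid_bounds[of P c n w] by auto
  have "\<bar>if w = c then 0 else taboo P c \<phi> n w\<bar> \<le> B" for w
    using order_trans[OF *[of w] mult_left_mono[OF order_trans[OF abs_ge_self **[of w]] B]] by simp
  then have i: "integrable (measure_pmf (P z)) (\<lambda>w. if w = c then 0 else taboo P c \<phi> n w)"
    by (rule integrable_pmf_bounded)
  have j: "integrable (measure_pmf (P z)) (\<lambda>w. if w = c then 0 else avoid P c n w)"
    by (rule integrable_pmf_bounded[OF **])
  have "\<bar>taboo P c \<phi> (Suc n) z\<bar> \<le> measure_pmf.expectation (P z) (\<lambda>w. \<bar>if w = c then 0 else taboo P c \<phi> n w\<bar>)"
    by simp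
  also have "\<dots> \<le> measure_pmf.expectation (P z) (\<lambda>w. B * (if w = c then 0 else avoid P c n w))"
    using i j * by (intro integral_mono) (auto intro: integrable_abs simp del: abs_if)
  also have "\<dots> = B * avoid P c (Suc n) z" by simp
  finally show ?case .
qed

lemma taboo_bound_const:
  assumes "\<And>z. \<bar>\<phi> z\<bar> \<le> B"
  shows "\<bar>taboo P c \<phi> n z\<bar> \<le> B"
proof -
  have "0 \<le> B" using assms[of z] by linarith
  then have "B * avoid P c n z \<le> B * 1" using avoid_bounds[of P c n z] by (intro mult_left_mono) auto
  with taboo_bound[of \<phi> B P c n z, OF assms] show ?thesis by simp
qed

lemma integrable_taboo:
  assumes "\<And>z. \<bar>\<phi> z\<bar> \<le> B"
  shows "integrable (measure_pmf p) (\<lambda>w. if w = c then 0 else taboo P c \<phi> n w)"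
proof (rule integrable_pmf_bounded)
  have "0 \<le> B" using assms[of undefined] by linarith
  then show "\<bar>if w = c then 0 else taboo P c \<phi> n w\<bar> \<le> B" for w
    using taboo_bound_const[of \<phi> B P c n w, OF assms] by simp
qed

lemma integrable_avoid: "integrable (measure_pmf p) (\<lambda>w. if w = c then 0 else avoid P c n w)"
  by (rule integrable_taboo[where B=1]) simp

lemma avoid_decseq: "avoid P c (Suc n) z \<le> avoid P c n z"
proof (induction n arbitrary: z)
  case 0
  then show ?case using avoid_bounds[of P c "Suc 0" z] by simp
next
  case (Suc n)
  have "measure_pmf.expectation (P z) (\<lambda>w. if w = c then 0 else avoid P c (Suc n) w)
      \<le> measure_pmf.expectation (P z) (\<lambda>w. if w = c then 0 else avoid P c n w)"
    using Suc by (intro integral_mono integrable_avoid) (auto simp del: taboo.simps)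
  then show ?case by simp
qed

lemma taboo_mono:
  assumes "\<And>z. \<bar>\<phi> z\<bar> \<le> B" "\<And>z. 0 \<le> \<phi> z"
  shows "0 \<le> taboo P c \<phi> n z"
  by (induction n arbitrary: z) (auto simp: assms(2) intro!: integral_nonneg_AE)

text \<open>The definition peels off the first step, here it is the last one: so the change from
  time \<open>n\<close> to \<open>Suc n\<close> becomes a taboo expectation of a one-step
  drift.\<close>

lemma taboo_Suc_right: "taboo P c \<phi> (Suc n) = taboo P c (taboo P c \<phi> 1) n"
proof (induction n)
  case (Suc n)
  show ?case
    by (simp only: taboo.simps(2)[of P c \<phi> "Suc n"] Suc taboo.simps(2)[of P c "taboo P c \<phi> 1" n])
qed simp

lemma taboo_diff:
  assumes "\<And>z. \<bar>\<phi> z\<bar> \<le> B" "\<And>z. \<bar>\<psi> z\<bar> \<le> B'"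
  shows "taboo P c (\<lambda>z. \<phi> z - \<psi> z) n z = taboo P c \<phi> n z - taboo P c \<psi> n z"
proof (induction n arbitrary: z)
  case (Suc n)
  have "taboo P c (\<lambda>z. \<phi> z - \<psi> z) (Suc n) z = measure_pmf.expectation (P z)
     (\<lambda>w. (if w = c then 0 else taboo P c \<phi> n w) - (if w = c then 0 else taboo P c \<psi> n w))"
    by (simp add: Suc if_distrib cong: if_cong)
  also have "\<dots> = taboo P c \<phi> (Suc n) z - taboo P c \<psi> (Suc n) z"
    using integrable_taboo[of \<phi>, OF assms(1)] integrable_taboo[of \<psi>, OF assms(2)] by simp
  finally show ?case .
qed simp

lemma taboo_tendsto:
  assumes b: "\<And>N z. \<bar>\<phi> N z\<bar> \<le> B" and lim: "\<And>z. (\<lambda>N. \<phi> N z) \<longlonglongrightarrow> \<psi> z"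
  shows "(\<lambda>N. taboo P c (\<phi> N) n z) \<longlonglongrightarrow> taboo P c \<psi> n z"
proof (induction n arbitrary: z)
  case (Suc n)
  have "0 \<le> B" using b[of undefined undefined] by linarith
  then have "norm (if w = c then 0 else taboo P c (\<phi> N) n w) \<le> B" for w N
    using taboo_bound_const[of "\<phi> N" B P c n w, OF b] by simp
  then show ?case unfolding taboo.simps
    by (intro integral_dominated_convergence[where w="\<lambda>_. B"]) (auto intro: Suc)
qed (simp add: lim)

text \<open>Maximum principle for the limit \<open>u\<close> of the avoidance probabilities, which
  equals the mean of its modification \<open>u'\<close> vanishing at \<open>c\<close>. Subtracting
  \<open>e * f\<close> with \<open>f\<close> tending to infinity makes the maximum attained, and it
  can be taken in \<open>F\<close> because every state moves to \<open>c\<close> with positive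
  probability. As \<open>e\<close> tends to \<open>0\<close>, \<open>u\<close> is bounded by its
  maximum \<open>M\<close> over \<open>F\<close>, and the step to \<open>c\<close> forces
  \<open>M \<le> 0\<close>.\<close>

lemma avoid_tendsto_0:
  fixes P :: "nat \<Rightarrow> nat pmf" and f :: "nat \<Rightarrow> real"
  assumes pos: "\<And>z. pmf (P z) c > 0" and "finite F" "c \<in> F"
    and f: "filterlim f at_top sequentially" "\<And>z. integrable (measure_pmf (P z)) f"
    and super: "\<And>z. z \<notin> F \<Longrightarrow> measure_pmf.expectation (P z) f \<le> f z"
  shows "(\<lambda>n. avoid P c n z) \<longlonglongrightarrow> 0"
proof -
  define u where "u z = lim (\<lambda>n. avoid P c n z)" for z
  have lim: "(\<lambda>n. avoid P c n z) \<longlonglongrightarrow> u z" for z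
  proof -
    have "decseq (\<lambda>n. avoid P c n z)" by (rule decseq_SucI) (rule avoid_decseq)
    then have "convergent (\<lambda>n. avoid P c n z)"
      using avoid_bounds by (metis decseq_convergent convergentI)
    then show ?thesis by (simp add: u_def convergent_LIMSEQ_iff)
  qed
  have u: "0 \<le> u z" "u z \<le> 1" for z
    by (rule LIMSEQ_le_const[OF lim] LIMSEQ_le_const2[OF lim], simp add: avoid_bounds)+
  define u' where "u' w = (if w = c then 0 else u w)" for w
  have iu': "integrable (measure_pmf (P z)) u'" for z
    by (rule integrable_pmf_bounded[of _ 1]) (use u in \<open>auto simp: u'_def\<close>)
  have ueq: "u z = measure_pmf.expectation (P z) u'" for z
  proof (rule LIMSEQ_unique)
    show "(\<lambda>n. avoid P c (Suc n) z) \<longlonglongrightarrow> u z" using LIMSEQ_Suc[OF lim] .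
    have "norm (if w = c then 0 else avoid P c n w) \<le> 1" for n w
      using avoid_bounds[of P c n w] by auto
    then show "(\<lambda>n. avoid P c (Suc n) z) \<longlonglongrightarrow> measure_pmf.expectation (P z) u'"
      unfolding taboo.simps u'_def
      by (intro integral_dominated_convergence[where w="\<lambda>_. 1"]) (auto intro: lim)
  qed
  define M where "M = Max (u ` F)"
  have FM: "x \<in> F \<Longrightarrow> u x \<le> M" for x using \<open>finite F\<close> by (simp add: M_def)
  have key: "\<exists>x\<in>F. u z - e * f z \<le> u x - e * f x" if e: "e > 0" for e z
  proof -
    define v where "v w = u w - e * f w" for w
    have "eventually (\<lambda>w. f w > (1 - v c) / e) sequentially"
      using f(1) by (simp add: filterlim_at_top_dense)
    then obtain W where W: "\<And>w. w \<ge> W \<Longrightarrow> f w > (1 - v c) / e"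
      unfolding eventually_sequentially by blast
    have vW: "v w < v c" if "w \<ge> W" for w
    proof -
      have "1 - v c < e * f w" using W[OF that] e by (simp add: field_simps)
      then show ?thesis using u(2)[of w] by (simp add: v_def)
    qed
    \<comment> \<open>From \<open>W\<close> on the values of \<open>v\<close> are below
      \<open>v c\<close>, so with \<open>c\<close> included the maximum over this finite set is
      global.\<close>
    define S where "S = insert c {..<W}"
    have S: "finite (v ` S)" "v ` S \<noteq> {}" by (auto simp: S_def)
    from Max_in[OF this] obtain y where y: "y \<in> S" "Max (v ` S) = v y" by blast
    then have y: "y \<in> S" "\<And>w. w \<in> S \<Longrightarrow> v w \<le> v y" using Max_ge[OF S(1)] by auto
    have ymax: "v w \<le> v y" for w
      using y(2)[of w] y(2)[of c] vW[of w] by (cases "w < W") (auto simp: S_def)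
    show ?thesis
    proof (cases "y \<in> F")
      case True
      then show ?thesis using ymax[of z] by (auto simp: v_def)
    next
      case False
      \<comment> \<open>\<open>g\<close> differs from \<open>v\<close> only at \<open>c\<close>. The
        supermartingale property makes \<open>v y\<close> at most the mean of \<open>g\<close>,
        whose values do not exceed \<open>v y\<close>; positive mass at \<open>c\<close> gives
        \<open>v y \<le> g c\<close>, so \<open>c\<close> is itself a maximiser.\<close>
      define g where "g w = u' w - e * f w" for w
      have ig: "integrable (measure_pmf (P y)) g" unfolding g_def[abs_def] using iu' f(2) by auto
      have "v y \<le> measure_pmf.expectation (P y) u' - e * measure_pmf.expectation (P y) f"
        using super[OF False] e by (simp add: v_def ueq[of y] mult_left_mono)
      also have "\<dots> = measure_pmf.expectation (P y) g"
        unfolding g_def[abs_def] using iu' f(2) by simp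
      also have "\<dots> \<le> measure_pmf.expectation (P y) (\<lambda>w. v y - (if w = c then v y - g c else 0))"
      proof (rule integral_mono[OF ig])
        have "integrable (measure_pmf (P y)) (\<lambda>w. if w = c then v y - g c else 0)"
          by (rule integrable_pmf_bounded[of _ "\<bar>v y - g c\<bar>"]) auto
        then show "integrable (measure_pmf (P y)) (\<lambda>w. v y - (if w = c then v y - g c else 0))" by simp
        show "g w \<le> v y - (if w = c then v y - g c else 0)" for w
          using ymax[of w] u(1)[of w] by (auto simp: g_def v_def u'_def)
      qed
      also have "\<dots> = v y - pmf (P y) c * (v y - g c)"
      proof -
        have "integrable (measure_pmf (P y)) (\<lambda>w. if w = c then v y - g c else 0)"
          by (rule integrable_pmf_bounded[of _ "\<bar>v y - g c\<bar>"]) auto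
        then show ?thesis by (simp add: expectation_indicator_point)
      qed
      finally have "v y \<le> g c" using pos[of y] by (simp add: mult_le_0_iff)
      also have "g c \<le> v c" using u(1)[of c] by (simp add: g_def u'_def v_def)
      finally have "v y \<le> v c" .
      then show ?thesis using ymax[of z] \<open>c \<in> F\<close> by (intro bexI[of _ c]) (auto simp: v_def)
    qed
  qed
  define m where "m = Min (f ` F)"
  have Fm: "x \<in> F \<Longrightarrow> m \<le> f x" for x using \<open>finite F\<close> by (simp add: m_def)
  have uM: "u z \<le> M" for z
  proof (rule field_le_epsilon)
    fix d :: real assume d: "d > 0"
    define e where "e = d / (\<bar>f z - m\<bar> + 1)"
    have e: "e > 0" using d by (simp add: e_def)
    obtain x where x: "x \<in> F" "u z - e * f z \<le> u x - e * f x" using key[OF e] by blast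
    have "u z \<le> u x + e * (f z - f x)" using x(2) by (simp add: algebra_simps)
    also have "\<dots> \<le> M + e * (\<bar>f z - m\<bar> + 1)"
      using FM[OF x(1)] Fm[OF x(1)] e by (intro add_mono mult_left_mono) auto
    also have "e * (\<bar>f z - m\<bar> + 1) = d" by (simp add: e_def)
    finally show "u z \<le> M + d" .
  qed
  have "F \<noteq> {}" using \<open>c \<in> F\<close> by auto
  then have "M \<in> u ` F" unfolding M_def using \<open>finite F\<close> by (intro Max_in) auto
  then obtain x where x: "M = u x" by auto
  have "M = measure_pmf.expectation (P x) u'" unfolding x by (rule ueq)
  also have "\<dots> \<le> measure_pmf.expectation (P x) (\<lambda>w. M - (if w = c then M else 0))"
  proof (rule integral_mono[OF iu'])
    have "integrable (measure_pmf (P x)) (\<lambda>w. if w = c then M else 0)"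
      by (rule integrable_pmf_bounded[of _ "\<bar>M\<bar>"]) auto
    then show "integrable (measure_pmf (P x)) (\<lambda>w. M - (if w = c then M else 0))" by simp
    show "u' w \<le> M - (if w = c then M else 0)" for w using uM[of w] by (simp add: u'_def)
  qed
  also have "\<dots> = M - pmf (P x) c * M"
  proof -
    have "integrable (measure_pmf (P x)) (\<lambda>w. if w = c then M else 0)"
      by (rule integrable_pmf_bounded[of _ "\<bar>M\<bar>"]) auto
    then show ?thesis by (simp add: expectation_indicator_point)
  qed
  finally have "M \<le> 0" using pos[of x] by (simp add: mult_le_0_iff)
  then have "u z = 0" using uM[of z] u(1)[of z] by linarith
  then show ?thesis using lim[of z] by simp
qed

text \<open>Foster's criterion: the partial sums are expected return times cut at \<open>N\<close>,
  and \<open>f z / d + B\<close> dominates them by induction. Off \<open>F\<close> the decrease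
  \<open>d\<close> of \<open>f\<close> pays for the unit step; on \<open>F\<close> the payment is
  \<open>B\<close> times the probability of a step to \<open>c\<close>, where the sum ends.\<close>

lemma avoid_summable:
  fixes P :: "'s \<Rightarrow> 's pmf" and f :: "'s \<Rightarrow> real"
  assumes pos: "\<And>z. pmf (P z) c > 0" and "finite F" and "d > 0"
    and f: "\<And>z. 0 \<le> f z" "\<And>z. integrable (measure_pmf (P z)) f"
    and super: "\<And>z. z \<notin> F \<Longrightarrow> measure_pmf.expectation (P z) f \<le> f z - d"
  shows "summable (\<lambda>n. avoid P c n z)"
proof -
  define B where "B = (\<Sum>x\<in>F. (1 + measure_pmf.expectation (P x) f / d) / pmf (P x) c)"
  have nn: "0 \<le> (1 + measure_pmf.expectation (P x) f / d) / pmf (P x) c" for x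
    using f(1) \<open>d > 0\<close> by (intro divide_nonneg_nonneg add_nonneg_nonneg integral_nonneg_AE) auto
  have B0: "0 \<le> B" unfolding B_def by (intro sum_nonneg nn)
  have B: "1 + measure_pmf.expectation (P x) f / d \<le> B * pmf (P x) c" if "x \<in> F" for x
  proof -
    have "(1 + measure_pmf.expectation (P x) f / d) / pmf (P x) c \<le> B"
      unfolding B_def using that nn \<open>finite F\<close> by (intro member_le_sum) auto
    then show ?thesis using pos[of x] by (simp add: divide_le_eq)
  qed
  have "(\<Sum>n<N. avoid P c n z) \<le> f z / d + B" for N z
  proof (induction N arbitrary: z)
    case 0
    then show ?case using f(1)[of z] \<open>d > 0\<close> B0 by simp
  next
    case (Suc N)
    have "(\<Sum>n<Suc N. avoid P c n z) = 1 + (\<Sum>n<N. avoid P c (Suc n) z)"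
      by (subst sum.lessThan_Suc_shift) simp
    also have "(\<Sum>n<N. avoid P c (Suc n) z) = measure_pmf.expectation (P z) (\<lambda>w. \<Sum>n<N. if w = c then 0 else avoid P c n w)"
      by (subst Bochner_Integration.integral_sum) (auto intro: integrable_avoid)
    also have "\<dots> \<le> measure_pmf.expectation (P z) (\<lambda>w. f w / d + (B - (if w = c then B else 0)))"
    proof (rule integral_mono)
      show "integrable (measure_pmf (P z)) (\<lambda>w. \<Sum>n<N. if w = c then 0 else avoid P c n w)"
        by (intro Bochner_Integration.integrable_sum integrable_avoid)
      have "integrable (measure_pmf (P z)) (\<lambda>w. if w = c then B else 0)"
        by (rule integrable_pmf_bounded[of _ "\<bar>B\<bar>"]) auto
      then show "integrable (measure_pmf (P z)) (\<lambda>w. f w / d + (B - (if w = c then B else 0)))"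
        using f(2) by simp
      show "(\<Sum>n<N. if w = c then 0 else avoid P c n w) \<le> f w / d + (B - (if w = c then B else 0))" for w
        using Suc[of w] f(1)[of w] \<open>d > 0\<close> by (cases "w = c") auto
    qed
    also have "\<dots> = measure_pmf.expectation (P z) f / d + (B - pmf (P z) c * B)"
    proof -
      have "integrable (measure_pmf (P z)) (\<lambda>w. if w = c then B else 0)"
        by (rule integrable_pmf_bounded[of _ "\<bar>B\<bar>"]) auto
      then show ?thesis using f(2) by (simp add: expectation_indicator_point)
    qed
    also have "1 + (measure_pmf.expectation (P z) f / d + (B - pmf (P z) c * B)) \<le> f z / d + B"
    proof (cases "z \<in> F")
      case True
      then show ?thesis using B[OF True] f(1)[of z] \<open>d > 0\<close> by (simp add: mult.commute add_increasing)
    next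
      case False
      have "measure_pmf.expectation (P z) f / d \<le> (f z - d) / d"
        using super[OF False] \<open>d > 0\<close> by (intro divide_right_mono) auto
      also have "\<dots> = f z / d - 1" using \<open>d > 0\<close> by (simp add: diff_divide_distrib)
      finally have "measure_pmf.expectation (P z) f / d \<le> f z / d - 1" .
      moreover have "0 \<le> pmf (P z) c * B" using B0 by simp
      ultimately show ?thesis by linarith
    qed
    finally show ?case by simp
  qed
  then show ?thesis
    by (intro bounded_imp_summable[where B="f z / d + B"]) (auto simp: avoid_bounds lessThan_Suc_atMost[symmetric] simp del: sum.lessThan_Suc)
qed

text \<open>If the mean return time were finite, then optional stopping at the return time would apply to the
  bounded functions \<open>h / (1 + h / N)\<close>, whose drift is bounded uniformly in \<open>N\<close>; in the limit the
  drift of \<open>h\<close> accumulated during an excursion from \<open>c\<close> would be zero.\<close>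

lemma avoid_not_summable:
  fixes P :: "'s \<Rightarrow> 's pmf" and h :: "'s \<Rightarrow> real"
  assumes h: "h c = 0" "\<And>z. 0 \<le> h z"
    and i1: "\<And>z. integrable (measure_pmf (P z)) h"
    and i2: "\<And>z. integrable (measure_pmf (P z)) (\<lambda>w. (h w - h z)^2)"
    and sub: "\<And>z. h z \<le> measure_pmf.expectation (P z) h"
    and up: "\<And>z. measure_pmf.expectation (P z) h \<le> h z + C"
    and var: "\<And>z. measure_pmf.expectation (P z) (\<lambda>w. (h w - h z)^2) \<le> C * (1 + h z)"
    and pos: "measure_pmf.expectation (P c) h > 0"
  shows "\<not> summable (\<lambda>n. avoid P c n c)"
proof
  assume sm: "summable (\<lambda>n. avoid P c n c)"
  define g where "g N z = h z / (1 + h z / real (Suc N))" for N z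
  define \<phi> where "\<phi> N z = measure_pmf.expectation (P z) (g N) - g N z" for N z
  define \<psi> where "\<psi> z = measure_pmf.expectation (P z) h - h z" for z
  have den: "1 + h z / real (Suc N) \<ge> 1" for N z using h(2)[of z] by simp
  have g: "0 \<le> g N z" "g N z \<le> real (Suc N)" "g N z \<le> h z" for N z
  proof -
    show "0 \<le> g N z" unfolding g_def using h(2)[of z] den[of z N] by (intro divide_nonneg_nonneg) linarith+
    have "h z = real (Suc N) * (h z / real (Suc N))" by simp
    also have "\<dots> \<le> real (Suc N) * (1 + h z / real (Suc N))" by (intro mult_left_mono) auto
    finally show "g N z \<le> real (Suc N)" unfolding g_def using den[of z N] by (subst divide_le_eq) auto
    have "h z * 1 \<le> h z * (1 + h z / real (Suc N))" using h(2)[of z] den[of z N] by (intro mult_left_mono) auto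
    then show "g N z \<le> h z" unfolding g_def using den[of z N] by (subst divide_le_eq) auto
  qed
  have gabs: "\<bar>g N z\<bar> \<le> real (Suc N)" for N z using g[of N z] by simp
  have gi: "integrable (measure_pmf p) (g N)" for p N by (rule integrable_pmf_bounded[OF gabs])
  have C: "0 \<le> C" using sub[of c] up[of c] by linarith
  \<comment> \<open>The upper bound \<open>C\<close> comes from concavity of
    \<open>x / (1 + x / n)\<close> and the bounded drift of \<open>h\<close>, the lower bound
    \<open>- 2 * C\<close> from the quadratic remainder and \<open>var\<close>. Neither depends on
    \<open>N\<close>.\<close>
  have \<phi>_bound: "\<bar>\<phi> N z\<bar> \<le> 3 * C" for N z
  proof -
    define x where "x = h z"
    define n where "n = real (Suc N)"
    define a where "a = 1 + x / n"
    have n: "n \<ge> 1" by (simp add: n_def)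
    have x: "x \<ge> 0" using h by (simp add: x_def)
    have a: "a \<ge> 1" using x n by (simp add: a_def)
    \<comment> \<open>Exact expansion about \<open>x\<close>, where \<open>x / (1 + x / n)\<close>
      has derivative \<open>1 / a^2\<close>.\<close>
    have diff: "g N w - g N z = (h w - x) / a^2 - ((h w - x)^2 / n) / (a^2 * (1 + h w / n))" for w
    proof -
      define b where "b = 1 + h w / n"
      have b: "b \<ge> 1" using h(2)[of w] n by (simp add: b_def)
      have y: "h w = (b - 1) * n" and xx: "x = (a - 1) * n" using n by (auto simp: a_def b_def)
      have "g N w - g N z = h w / b - x / a" by (simp add: g_def a_def b_def n_def x_def)
      also have "\<dots> = (h w - x) / a^2 - ((h w - x)^2 / n) / (a^2 * b)"
        unfolding y xx using a b n by (simp add: divide_simps) (simp add: power2_eq_square algebra_simps)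
      finally show ?thesis by (simp add: b_def)
    qed
    have le: "g N w - g N z \<le> (h w - x) / a^2" "(h w - x) / a^2 - (h w - x)^2 / (n * a^2) \<le> g N w - g N z" for w
    proof -
      have b: "1 + h w / n \<ge> 1" using h(2)[of w] n by simp
      show "g N w - g N z \<le> (h w - x) / a^2" unfolding diff using a b n by simp
      have "((h w - x)^2 / n) / (a^2 * (1 + h w / n)) \<le> ((h w - x)^2 / n) / (a^2 * 1)"
        using a b n by (intro divide_left_mono mult_left_mono) auto
      then show "(h w - x) / a^2 - (h w - x)^2 / (n * a^2) \<le> g N w - g N z" unfolding diff by simp
    qed
    have \<phi>E: "\<phi> N z = measure_pmf.expectation (P z) (\<lambda>w. g N w - g N z)"
      unfolding \<phi>_def using gi by simp
    have "\<phi> N z \<le> measure_pmf.expectation (P z) (\<lambda>w. (h w - x) / a^2)"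
      unfolding \<phi>E using gi i1 le(1) by (intro integral_mono) auto
    also have "\<dots> = (measure_pmf.expectation (P z) h - x) / a^2" using i1 by simp
    also have "\<dots> \<le> C / 1" using up[of z] sub[of z] a C by (intro frac_le) (auto simp: x_def one_le_power)
    finally have 1: "\<phi> N z \<le> C" by simp
    have "(measure_pmf.expectation (P z) h - x) / a^2
        - measure_pmf.expectation (P z) (\<lambda>w. (h w - x)^2) / (n * a^2)
        = measure_pmf.expectation (P z) (\<lambda>w. (h w - x) / a^2 - (h w - x)^2 / (n * a^2))"
      using i1 i2[of z] by (simp add: x_def)
    also have "\<dots> \<le> \<phi> N z"
      unfolding \<phi>E using gi i1 i2[of z] le(2) by (intro integral_mono) (auto simp: x_def)
    finally have "(measure_pmf.expectation (P z) h - x) / a^2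
        - measure_pmf.expectation (P z) (\<lambda>w. (h w - x)^2) / (n * a^2) \<le> \<phi> N z" .
    moreover have "0 \<le> (measure_pmf.expectation (P z) h - x) / a^2" using sub[of z] by (simp add: x_def)
    moreover have "measure_pmf.expectation (P z) (\<lambda>w. (h w - x)^2) / (n * a^2) \<le> 2 * C"
    proof -
      \<comment> \<open>The weight \<open>1 / (n * a^2)\<close> of the quadratic remainder
        compensates the growth of the variance bound, since \<open>n * a = n + x\<close>.\<close>
      have "1 + x \<le> 2 * (n * a^2)"
      proof -
        have "n * a = n + x" using n by (simp add: a_def distrib_left)
        moreover have "n * a * 1 \<le> n * a * a" using n a by (intro mult_left_mono) auto
        ultimately have "1 + x \<le> n * a^2" using n unfolding power2_eq_square mult.assoc[symmetric] by linarith
        moreover have "0 \<le> n * a^2" using n by simp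
        ultimately show ?thesis by linarith
      qed
      then have "C * (1 + x) \<le> C * (2 * (n * a^2))" using C by (intro mult_left_mono)
      with var[of z] have "measure_pmf.expectation (P z) (\<lambda>w. (h w - x)^2) \<le> 2 * C * (n * a^2)"
        by (simp add: x_def)
      then show ?thesis using n a by (subst divide_le_eq) auto
    qed
    ultimately show ?thesis using 1 C by linarith
  qed
  have \<phi>_lim: "(\<lambda>N. \<phi> N z) \<longlonglongrightarrow> \<psi> z" for z
  proof -
    have gl: "(\<lambda>N. g N z) \<longlonglongrightarrow> h z" for z
    proof -
      have "(\<lambda>N. h z / (1 + h z / real (Suc N))) \<longlonglongrightarrow> h z / (1 + 0)"
        by (intro tendsto_intros LIMSEQ_Suc[OF lim_const_over_n]) auto
      then show ?thesis by (simp add: g_def)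
    qed
    have "(\<lambda>N. measure_pmf.expectation (P z) (g N)) \<longlonglongrightarrow> measure_pmf.expectation (P z) h"
      by (rule integral_dominated_convergence[where w=h]) (use i1 gl g in auto)
    then show ?thesis unfolding \<phi>_def \<psi>_def by (intro tendsto_diff gl)
  qed
  have \<psi>: "0 \<le> \<psi> z" "\<bar>\<psi> z\<bar> \<le> C" for z using sub[of z] up[of z] by (auto simp: \<psi>_def)
  \<comment> \<open>Optional stopping as a telescoping sum; as \<open>g N\<close> vanishes at
    \<open>c\<close>, killing at the return loses nothing.\<close>
  have sum_eq: "(\<Sum>k<n. taboo P c (\<phi> N) k c) = taboo P c (g N) n c" for N n
  proof (induction n)
    case 0
    then show ?case by (simp add: g_def h)
  next
    case (Suc n)
    have T1: "taboo P c (g N) 1 z = measure_pmf.expectation (P z) (g N)" for z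
      by (auto simp: g_def h intro!: Bochner_Integration.integral_cong)
    have "\<phi> N = (\<lambda>z. taboo P c (g N) 1 z - g N z)" by (simp only: T1) (simp add: \<phi>_def fun_eq_iff)
    then have "taboo P c (\<phi> N) n c = taboo P c (taboo P c (g N) 1) n c - taboo P c (g N) n c"
      by (simp only:) (rule taboo_diff[OF taboo_bound_const[OF gabs] gabs])
    then show ?case using Suc by (simp only: sum.lessThan_Suc taboo_Suc_right)
  qed
  have zero: "(\<Sum>k. taboo P c (\<phi> N) k c) = 0" for N
  proof -
    have "(\<lambda>n. taboo P c (g N) n c) \<longlonglongrightarrow> 0"
    proof (rule Lim_null_comparison)
      show "eventually (\<lambda>n. norm (taboo P c (g N) n c) \<le> real (Suc N) * avoid P c n c) sequentially"
        using taboo_bound[of "g N", OF gabs] by simp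
      show "(\<lambda>n. real (Suc N) * avoid P c n c) \<longlonglongrightarrow> 0"
        using tendsto_mult_left[OF summable_LIMSEQ_zero[OF sm], of "real (Suc N)"] by simp
    qed
    then have "(\<lambda>k. taboo P c (\<phi> N) k c) sums 0" by (simp add: sums_def sum_eq)
    then show ?thesis by (simp add: sums_iff)
  qed
  \<comment> \<open>The uniform bound on the drifts and summability of the avoidance probabilities
    dominate the series, so the limit in \<open>N\<close> is taken termwise.\<close>
  have T: "summable (\<lambda>k. norm (taboo P c \<psi> k c)) \<and>
      (\<lambda>N. \<Sum>k. taboo P c (\<phi> N) k c) \<longlonglongrightarrow> (\<Sum>k. taboo P c \<psi> k c)"
  proof (rule conjunct2[OF tannerys_theorem[where M="\<lambda>k. 3 * C * avoid P c k c"]])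
    show "(\<lambda>N. taboo P c (\<phi> N) k c) \<longlonglongrightarrow> taboo P c \<psi> k c" for k
      by (rule taboo_tendsto[OF \<phi>_bound \<phi>_lim])
    show "summable (\<lambda>k. 3 * C * avoid P c k c)" using sm by (rule summable_mult)
    show "\<forall>\<^sub>F (k, n) in sequentially \<times>\<^sub>F sequentially. norm (taboo P c (\<phi> n) k c) \<le> 3 * C * avoid P c k c"
      using taboo_bound[of "\<phi> n" for n, OF \<phi>_bound] by (intro always_eventually) auto
  qed simp
  then have "(\<Sum>k. taboo P c \<psi> k c) = 0" using zero by (simp add: LIMSEQ_const_iff)
  \<comment> \<open>All terms are nonnegative because \<open>h\<close> is a submartingale, and the
    initial one is the positive drift at \<open>c\<close>.\<close>
  moreover have "taboo P c \<psi> 0 c \<le> (\<Sum>k. taboo P c \<psi> k c)"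
  proof -
    have "(\<Sum>k\<in>{0}. taboo P c \<psi> k c) \<le> (\<Sum>k. taboo P c \<psi> k c)"
      using T taboo_mono[of \<psi>, OF \<psi>(2) \<psi>(1)] by (intro sum_le_suminf) (auto dest: summable_norm_cancel)
    then show ?thesis by simp
  qed
  ultimately show False using pos by (simp add: \<psi>_def h)
qed

section \<open>Markov chains and their path events\<close>

text \<open>The counterpart, for predicates on paths, of the sigma-algebra of the states up to time
  \<open>n\<close>. With countably many states such an event is a countable union of cylinders,
  indexed by lists.\<close>

definition depends_upto :: "nat \<Rightarrow> ((nat \<Rightarrow> 's) \<Rightarrow> bool) \<Rightarrow> bool" where
  "depends_upto n Q \<longleftrightarrow> (\<forall>p q. (\<forall>i\<le>n. p i = q i) \<longrightarrow> Q p = Q q)"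

lemma depends_uptoI: "(\<And>p q. (\<And>i. i \<le> n \<Longrightarrow> p i = q i) \<Longrightarrow> Q p \<Longrightarrow> Q q) \<Longrightarrow> depends_upto n Q"
  unfolding depends_upto_def by (metis (no_types, lifting))

lemma depends_uptoD: "depends_upto n Q \<Longrightarrow> (\<And>i. i \<le> n \<Longrightarrow> p i = q i) \<Longrightarrow> Q p = Q q"
  unfolding depends_upto_def by blast

locale mchain = prob_space M for M :: "'a measure" +
  fixes K :: "'s::countable \<Rightarrow> 's pmf" and s0 :: 's and S :: "nat \<Rightarrow> 'a \<Rightarrow> 's"
  assumes mc: "markov_chain M K s0 S"
begin

definition pr :: "((nat \<Rightarrow> 's) \<Rightarrow> bool) \<Rightarrow> ennreal" where
  "pr Q = emeasure M {\<omega> \<in> space M. Q (\<lambda>i. S i \<omega>)}"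

lemma S_measurable [measurable]: "S n \<in> measurable M (count_space UNIV)"
  using mc by (simp add: markov_chain_def)

lemma S_0: "AE \<omega> in M. S 0 \<omega> = s0"
  using mc by (simp add: markov_chain_def)

lemma cyl_measurable: "{\<omega> \<in> space M. \<forall>i\<le>n. S i \<omega> = s i} \<in> sets M"
  by measurable

lemma depends_Union:
  assumes "depends_upto n Q"
  shows "{\<omega> \<in> space M. Q (\<lambda>i. S i \<omega>) \<and> R \<omega>} =
    (\<Union>l\<in>{l. length l = Suc n \<and> Q ((!) l)}. {\<omega> \<in> space M. (\<forall>i\<le>n. S i \<omega> = l ! i) \<and> R \<omega>})"
proof (intro equalityI subsetI)
  fix \<omega> assume "\<omega> \<in> {\<omega> \<in> space M. Q (\<lambda>i. S i \<omega>) \<and> R \<omega>}"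
  then have \<omega>: "\<omega> \<in> space M" "Q (\<lambda>i. S i \<omega>)" "R \<omega>" by auto
  define l where "l = map (\<lambda>i. S i \<omega>) [0..<Suc n]"
  have l: "length l = Suc n" "\<And>i. i \<le> n \<Longrightarrow> l ! i = S i \<omega>"
    by (auto simp: l_def simp del: upt_Suc)
  have "Q ((!) l)" using depends_uptoD[OF assms, of "(!) l" "\<lambda>i. S i \<omega>"] l \<omega> by auto
  then show "\<omega> \<in> (\<Union>l\<in>{l. length l = Suc n \<and> Q ((!) l)}. {\<omega> \<in> space M. (\<forall>i\<le>n. S i \<omega> = l ! i) \<and> R \<omega>})"
    using l \<omega> by auto
next
  fix \<omega> assume "\<omega> \<in> (\<Union>l\<in>{l. length l = Suc n \<and> Q ((!) l)}. {\<omega> \<in> space M. (\<forall>i\<le>n. S i \<omega> = l ! i) \<and> R \<omega>})"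
  then obtain l where l: "Q ((!) l)" "\<forall>i\<le>n. S i \<omega> = l ! i" "\<omega> \<in> space M" "R \<omega>" by auto
  then show "\<omega> \<in> {\<omega> \<in> space M. Q (\<lambda>i. S i \<omega>) \<and> R \<omega>}"
    using depends_uptoD[OF assms, of "(!) l" "\<lambda>i. S i \<omega>"] by auto
qed

lemma depends_measurable:
  assumes "depends_upto n Q"
  shows "{\<omega> \<in> space M. Q (\<lambda>i. S i \<omega>)} \<in> sets M"
  using depends_Union[OF assms, of "\<lambda>_. True"] cyl_measurable
  by (auto intro!: sets.countable_UN' simp: countableI_type)

lemma emeasure_depends_Union:
  assumes "depends_upto n Q" and [measurable]: "Measurable.pred M R"
  shows "emeasure M {\<omega> \<in> space M. Q (\<lambda>i. S i \<omega>) \<and> R \<omega>} =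
    (\<integral>\<^sup>+l. emeasure M {\<omega> \<in> space M. (\<forall>i\<le>n. S i \<omega> = l ! i) \<and> R \<omega>}
      \<partial>count_space {l. length l = Suc n \<and> Q ((!) l)})"
  unfolding depends_Union[OF assms(1)]
proof (rule emeasure_UN_countable)
  show "disjoint_family_on (\<lambda>l. {\<omega> \<in> space M. (\<forall>i\<le>n. S i \<omega> = l ! i) \<and> R \<omega>}) {l. length l = Suc n \<and> Q ((!) l)}"
    unfolding disjoint_family_on_def
  proof (intro ballI impI)
    fix l l' :: "'s list"
    assume "l \<in> {l. length l = Suc n \<and> Q ((!) l)}" "l' \<in> {l. length l = Suc n \<and> Q ((!) l)}" "l \<noteq> l'"
    then obtain i where "i \<le> n" "l ! i \<noteq> l' ! i"
      by (metis (mono_tags, lifting) less_Suc_eq_le mem_Collect_eq nth_equalityI)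
    then show "{\<omega> \<in> space M. (\<forall>i\<le>n. S i \<omega> = l ! i) \<and> R \<omega>} \<inter> {\<omega> \<in> space M. (\<forall>i\<le>n. S i \<omega> = l' ! i) \<and> R \<omega>} = {}"
      by auto
  qed
qed (auto simp: countableI_type)

text \<open>Multiplied out, the Markov property also covers cylinders of probability zero, on which
  the definition imposes no condition: there both sides vanish.\<close>

lemma cyl_step:
  "emeasure M {\<omega> \<in> space M. (\<forall>i\<le>n. S i \<omega> = s i) \<and> S (Suc n) \<omega> = t}
    = emeasure M {\<omega> \<in> space M. \<forall>i\<le>n. S i \<omega> = s i} * ennreal (pmf (K (s n)) t)"
proof (cases "prob {\<omega> \<in> space M. \<forall>i\<le>n. S i \<omega> = s i} > 0")
  case True
  then have "\<P>(\<omega> in M. S (Suc n) \<omega> = t \<bar> \<forall>i\<le>n. S i \<omega> = s i) = pmf (K (s n)) t"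
    using mc unfolding markov_chain_def by blast
  then have "prob {\<omega> \<in> space M. S (Suc n) \<omega> = t \<and> (\<forall>i\<le>n. S i \<omega> = s i)}
     = prob {\<omega> \<in> space M. \<forall>i\<le>n. S i \<omega> = s i} * pmf (K (s n)) t"
    using True by (simp add: cond_prob_def field_simps)
  then show ?thesis
    by (simp add: emeasure_eq_measure ennreal_mult[symmetric] conj_commute)
next
  case False
  then have z: "emeasure M {\<omega> \<in> space M. \<forall>i\<le>n. S i \<omega> = s i} = 0"
    by (simp add: emeasure_eq_measure zero_less_measure_iff)
  moreover have "emeasure M {\<omega> \<in> space M. (\<forall>i\<le>n. S i \<omega> = s i) \<and> S (Suc n) \<omega> = t}
      \<le> emeasure M {\<omega> \<in> space M. \<forall>i\<le>n. S i \<omega> = s i}"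
    by (intro emeasure_mono) auto
  ultimately show ?thesis by simp
qed

text \<open>All cylinders that make up the past event end in \<open>s\<close>, so the transition
  probability is a common factor of the sum.\<close>

lemma pr_step:
  assumes Q: "depends_upto n Q"
  shows "pr (\<lambda>p. Q p \<and> p n = s \<and> p (Suc n) = t) = pr (\<lambda>p. Q p \<and> p n = s) * ennreal (pmf (K s) t)"
proof -
  let ?L = "{l. length l = Suc n \<and> Q ((!) l) \<and> l ! n = s}"
  have Q': "depends_upto n (\<lambda>p. Q p \<and> p n = s)"
    using Q unfolding depends_upto_def by (metis order_refl)
  have "pr (\<lambda>p. Q p \<and> p n = s \<and> p (Suc n) = t)
     = (\<integral>\<^sup>+l. emeasure M {\<omega> \<in> space M. (\<forall>i\<le>n. S i \<omega> = l ! i) \<and> S (Suc n) \<omega> = t} \<partial>count_space ?L)"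
    unfolding pr_def using emeasure_depends_Union[OF Q', of "\<lambda>\<omega>. S (Suc n) \<omega> = t"] by (simp add: conj_assoc)
  also have "\<dots> = (\<integral>\<^sup>+l. emeasure M {\<omega> \<in> space M. \<forall>i\<le>n. S i \<omega> = l ! i} * ennreal (pmf (K s) t) \<partial>count_space ?L)"
    by (intro nn_integral_cong) (auto simp: cyl_step)
  also have "\<dots> = (\<integral>\<^sup>+l. emeasure M {\<omega> \<in> space M. \<forall>i\<le>n. S i \<omega> = l ! i} \<partial>count_space ?L) * ennreal (pmf (K s) t)"
    by (simp add: nn_integral_multc)
  also have "(\<integral>\<^sup>+l. emeasure M {\<omega> \<in> space M. \<forall>i\<le>n. S i \<omega> = l ! i} \<partial>count_space ?L) = pr (\<lambda>p. Q p \<and> p n = s)"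
    unfolding pr_def using emeasure_depends_Union[OF Q', of "\<lambda>\<omega>. True"] by (simp add: conj_assoc)
  finally show ?thesis .
qed

lemma pr_sum_state:
  assumes "{\<omega> \<in> space M. Q (\<lambda>i. S i \<omega>)} \<in> sets M"
  shows "pr Q = (\<integral>\<^sup>+s. pr (\<lambda>p. Q p \<and> p n = s) \<partial>count_space UNIV)"
proof -
  have [measurable]: "Measurable.pred M (\<lambda>\<omega>. Q (\<lambda>i. S i \<omega>))" using assms by (simp add: pred_def)
  have "{\<omega> \<in> space M. Q (\<lambda>i. S i \<omega>)} = (\<Union>s\<in>UNIV. {\<omega> \<in> space M. Q (\<lambda>i. S i \<omega>) \<and> S n \<omega> = s})" by auto
  then show ?thesis
    unfolding pr_def
    by (simp only:) (rule emeasure_UN_countable, auto simp: disjoint_family_on_def countableI_type)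
qed

text \<open>\<open>d t\<close> is the conditional probability of the future event \<open>G\<close> given that the next state is \<open>t\<close>.\<close>

lemma pr_future:
  assumes Q: "depends_upto n Q"
    and G: "{\<omega> \<in> space M. G (\<lambda>i. S i \<omega>)} \<in> sets M"
    and d: "\<And>Q' t. depends_upto (Suc n) Q' \<Longrightarrow>
       pr (\<lambda>p. Q' p \<and> p (Suc n) = t \<and> G p) = pr (\<lambda>p. Q' p \<and> p (Suc n) = t) * ennreal (d t)"
    and d0: "\<And>t. 0 \<le> d t" and db: "\<And>t. d t \<le> B"
  shows "pr (\<lambda>p. Q p \<and> p n = s \<and> G p) = pr (\<lambda>p. Q p \<and> p n = s) * ennreal (measure_pmf.expectation (K s) d)"
proof -
  have [measurable]: "Measurable.pred M (\<lambda>\<omega>. G (\<lambda>i. S i \<omega>))" using G by (simp add: pred_def)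
  have [measurable]: "Measurable.pred M (\<lambda>\<omega>. Q (\<lambda>i. S i \<omega>))"
    using depends_measurable[OF Q] by (simp add: pred_def)
  have Q': "depends_upto (Suc n) (\<lambda>p. Q p \<and> p n = s)"
    using Q unfolding depends_upto_def by (metis le_SucI order_refl)
  have "pr (\<lambda>p. Q p \<and> p n = s \<and> G p) = (\<integral>\<^sup>+t. pr (\<lambda>p. (Q p \<and> p n = s \<and> G p) \<and> p (Suc n) = t) \<partial>count_space UNIV)"
    by (rule pr_sum_state) measurable
  also have "\<dots> = (\<integral>\<^sup>+t. pr (\<lambda>p. Q p \<and> p n = s) * (ennreal (pmf (K s) t) * ennreal (d t)) \<partial>count_space UNIV)"
  proof (rule nn_integral_cong)
    fix t
    have "(\<lambda>p. (Q p \<and> p n = s \<and> G p) \<and> p (Suc n) = t) = (\<lambda>p. (Q p \<and> p n = s) \<and> p (Suc n) = t \<and> G p)" by auto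
    then have "pr (\<lambda>p. (Q p \<and> p n = s \<and> G p) \<and> p (Suc n) = t) = pr (\<lambda>p. (Q p \<and> p n = s) \<and> p (Suc n) = t) * ennreal (d t)"
      by (simp only: d[OF Q'])
    also have "pr (\<lambda>p. (Q p \<and> p n = s) \<and> p (Suc n) = t) = pr (\<lambda>p. Q p \<and> p n = s) * ennreal (pmf (K s) t)"
      using pr_step[OF Q, of s t] by (simp add: conj_assoc)
    finally show "pr (\<lambda>p. (Q p \<and> p n = s \<and> G p) \<and> p (Suc n) = t) = pr (\<lambda>p. Q p \<and> p n = s) * (ennreal (pmf (K s) t) * ennreal (d t))"
      by (simp add: mult.assoc)
  qed
  also have "\<dots> = pr (\<lambda>p. Q p \<and> p n = s) * (\<integral>\<^sup>+t. ennreal (d t) \<partial>K s)"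
    by (simp add: nn_integral_cmult nn_integral_measure_pmf)
  also have "(\<integral>\<^sup>+t. ennreal (d t) \<partial>K s) = ennreal (measure_pmf.expectation (K s) d)"
    using d0 db by (intro nn_integral_eq_integral integrable_pmf_bounded[of _ B]) (auto simp: abs_le_iff intro: order_trans)
  finally show ?thesis .
qed

text \<open>Induction on \<open>m\<close> with time and past event generalised, since each step
  moves one coordinate from the future to the past.\<close>

lemma pr_avoid:
  assumes "depends_upto n Q"
  shows "pr (\<lambda>p. Q p \<and> p n = s \<and> (\<forall>i. n < i \<and> i \<le> n + m \<longrightarrow> p i \<noteq> c)) = pr (\<lambda>p. Q p \<and> p n = s) * ennreal (avoid K c m s)"
  using assms
proof (induction m arbitrary: n Q s)
  case 0
  have "(\<lambda>p. Q p \<and> p n = s \<and> (\<forall>i. n < i \<and> i \<le> n + 0 \<longrightarrow> p i \<noteq> c)) = (\<lambda>p. Q p \<and> p n = s)"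
    by (auto simp: fun_eq_iff)
  then show ?case by (simp only:) simp
next
  case (Suc m)
  define G where "G p \<longleftrightarrow> (\<forall>i. n < i \<and> i \<le> n + Suc m \<longrightarrow> p i \<noteq> c)" for p :: "nat \<Rightarrow> 's"
  have "pr (\<lambda>p. Q p \<and> p n = s \<and> G p) = pr (\<lambda>p. Q p \<and> p n = s) *
      ennreal (measure_pmf.expectation (K s) (\<lambda>w. if w = c then 0 else avoid K c m w))"
  proof (rule pr_future[OF Suc.prems, where B=1])
    show "{\<omega> \<in> space M. G (\<lambda>i. S i \<omega>)} \<in> sets M"
      by (rule depends_measurable[of "n + Suc m"]) (auto simp: depends_upto_def G_def)
    fix Q' :: "(nat \<Rightarrow> 's) \<Rightarrow> bool" and t assume Q': "depends_upto (Suc n) Q'"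
    show "pr (\<lambda>p. Q' p \<and> p (Suc n) = t \<and> G p) = pr (\<lambda>p. Q' p \<and> p (Suc n) = t) * ennreal (if t = c then 0 else avoid K c m t)"
    proof (cases "t = c")
      case True
      then have "(\<lambda>p. Q' p \<and> p (Suc n) = t \<and> G p) = (\<lambda>_. False)" by (auto simp: G_def fun_eq_iff)
      then show ?thesis using True by (simp add: pr_def)
    next
      case False
      have "(p (Suc n) = t \<and> G p) = (p (Suc n) = t \<and> (\<forall>i. Suc n < i \<and> i \<le> Suc n + m \<longrightarrow> p i \<noteq> c))"
        for p :: "nat \<Rightarrow> 's"
        unfolding G_def using False
        by (metis Suc_lessD Suc_lessI add_Suc_right add_Suc)
      then show ?thesis using Suc.IH[OF Q', of t] False by (simp only: if_False)
    qed
  qed (auto simp: avoid_bounds)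
  then show ?case by (simp add: G_def)
qed

lemma pr_le_1: "pr Q \<le> 1"
  unfolding pr_def by (rule emeasure_le_1)

text \<open>For fixed \<open>n\<close> and \<open>s\<close>, being in \<open>s\<close> at time
  \<open>n\<close> and missing \<open>c\<close> ever after has probability at most
  \<open>avoid K c m s\<close> for all \<open>m\<close>, hence zero; there are countably many such
  pairs.\<close>

lemma AE_visits:
  assumes av: "\<And>z. (\<lambda>n. avoid K c n z) \<longlonglongrightarrow> 0"
  shows "AE \<omega> in M. \<exists>\<^sub>\<infinity>k. S k \<omega> = c"
proof -
  have "AE \<omega> in M. \<not> (S n \<omega> = s \<and> (\<forall>i>n. S i \<omega> \<noteq> c))" for n s
  proof -
    let ?A = "{\<omega> \<in> space M. S n \<omega> = s \<and> (\<forall>i>n. S i \<omega> \<noteq> c)}"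
    have "emeasure M ?A \<le> ennreal (avoid K c m s)" for m
    proof -
      have "emeasure M ?A \<le> pr (\<lambda>p. True \<and> p n = s \<and> (\<forall>i. n < i \<and> i \<le> n + m \<longrightarrow> p i \<noteq> c))"
        unfolding pr_def by (intro emeasure_mono) auto
      also have "\<dots> = pr (\<lambda>p. True \<and> p n = s) * ennreal (avoid K c m s)"
        by (rule pr_avoid) (simp add: depends_upto_def)
      also have "\<dots> \<le> 1 * ennreal (avoid K c m s)" by (intro mult_right_mono pr_le_1) auto
      finally show ?thesis by simp
    qed
    moreover have "(\<lambda>m. ennreal (avoid K c m s)) \<longlonglongrightarrow> ennreal 0" by (intro tendsto_ennrealI av)
    ultimately have "emeasure M ?A \<le> ennreal 0" by (intro LIMSEQ_le_const) auto
    then show ?thesis by (intro AE_I[of _ _ ?A]) auto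
  qed
  then have "AE \<omega> in M. \<forall>n s. \<not> (S n \<omega> = s \<and> (\<forall>i>n. S i \<omega> \<noteq> c))"
    unfolding AE_all_countable by blast
  then show ?thesis by eventually_elim (auto simp: INFM_nat)
qed

text \<open>The expected decreases of \<open>F\<close> along the chain sum to at most
  \<open>B\<close>, and each visit to \<open>c\<close> accounts for \<open>D c > 0\<close>. So the
  visit probabilities are summable and the Borel-Cantelli lemma applies.\<close>

lemma AE_not_frequently:
  fixes F :: "'s \<Rightarrow> real"
  assumes F: "\<And>z. 0 \<le> F z" "\<And>z. F z \<le> B"
    and dec: "\<And>z. measure_pmf.expectation (K z) F < F z"
  shows "AE \<omega> in M. \<forall>\<^sub>F k in sequentially. S k \<omega> \<noteq> c"
proof -
  define law where "law = rec_nat (return_pmf s0) (\<lambda>_ p. bind_pmf p K)"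
  have law: "law 0 = return_pmf s0" "\<And>k. law (Suc k) = bind_pmf (law k) K" by (auto simp: law_def)
  have pl: "pr (\<lambda>p. p k = s) = ennreal (pmf (law k) s)" for k s
  proof (induction k arbitrary: s)
    case 0
    have "pr (\<lambda>p. p 0 = s) = emeasure M {\<omega> \<in> space M. s0 = s}"
      unfolding pr_def using S_0 by (intro emeasure_eq_AE) auto
    then show ?case using emeasure_space_1 by (cases "s0 = s") (auto simp: law)
  next
    case (Suc k)
    have "pr (\<lambda>p. p (Suc k) = s) = (\<integral>\<^sup>+t. pr (\<lambda>p. p (Suc k) = s \<and> p k = t) \<partial>count_space UNIV)"
      by (rule pr_sum_state) measurable
    also have "\<dots> = (\<integral>\<^sup>+t. ennreal (pmf (law k) t) * ennreal (pmf (K t) s) \<partial>count_space UNIV)"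
    proof (rule nn_integral_cong)
      fix t
      show "pr (\<lambda>p. p (Suc k) = s \<and> p k = t) = ennreal (pmf (law k) t) * ennreal (pmf (K t) s)"
        using pr_step[of k "\<lambda>_. True" t s] Suc[of t] by (simp add: depends_upto_def conj_commute)
    qed
    also have "\<dots> = ennreal (pmf (law (Suc k)) s)"
      unfolding law ennreal_pmf_bind by (simp add: nn_integral_measure_pmf)
    finally show ?case .
  qed
  have iF: "integrable (measure_pmf p) F" for p
    by (rule integrable_pmf_bounded[of _ B]) (use F in \<open>auto simp: abs_le_iff intro: order_trans\<close>)
  define D where "D z = F z - measure_pmf.expectation (K z) F" for z
  have D: "0 < D z" "D z \<le> B" for z
  proof -
    have "0 \<le> measure_pmf.expectation (K z) F" using F(1) by (intro integral_nonneg_AE) auto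
    then show "0 < D z" "D z \<le> B" using dec[of z] F(2)[of z] by (auto simp: D_def)
  qed
  have iD: "integrable (measure_pmf p) D" for p
    by (rule integrable_pmf_bounded[of _ B]) (use D in \<open>auto simp: abs_le_iff less_imp_le intro: order_trans\<close>)
  have step: "measure_pmf.expectation (law k) D = measure_pmf.expectation (law k) F - measure_pmf.expectation (law (Suc k)) F" for k
  proof -
    have "integrable (measure_pmf (law k)) (\<lambda>z. measure_pmf.expectation (K z) F)"
      by (rule integrable_pmf_bounded[of _ B])
        (use F iF in \<open>auto simp: integral_nonneg_AE intro!: expectation_le_const\<close>)
    moreover have "measure_pmf.expectation (law (Suc k)) F = measure_pmf.expectation (law k) (\<lambda>z. measure_pmf.expectation (K z) F)"
      unfolding law using iF F by (intro pmf_integral_bind_nonneg(3)) auto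
    ultimately show ?thesis unfolding D_def using iF by simp
  qed
  have sum: "(\<Sum>k<n. measure_pmf.expectation (law k) D) = F s0 - measure_pmf.expectation (law n) F" for n
    by (induction n) (auto simp: step law)
  have point: "pmf (law k) c \<le> measure_pmf.expectation (law k) D / D c" for k
  proof -
    have "pmf (law k) c * D c = measure_pmf.expectation (law k) (\<lambda>z. if z = c then D c else 0)"
      by (simp add: expectation_indicator_point)
    also have "\<dots> \<le> measure_pmf.expectation (law k) D"
      using D by (intro integral_mono iD integrable_pmf_bounded[of _ "D c"]) (auto simp: less_imp_le)
    finally show ?thesis using D(1)[of c] by (simp add: pos_le_divide_eq)
  qed
  have "summable (\<lambda>k. measure_pmf.expectation (law k) D)"
  proof (rule bounded_imp_summable[where B=B])
    show "0 \<le> measure_pmf.expectation (law k) D" for k using D by (intro integral_nonneg_AE) (auto simp: less_imp_le)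
    show "(\<Sum>k\<le>n. measure_pmf.expectation (law k) D) \<le> B" for n
    proof -
      have "0 \<le> measure_pmf.expectation (law (Suc n)) F" using F(1) by (intro integral_nonneg_AE) auto
      then show ?thesis using sum[of "Suc n"] F(2)[of s0] by (simp add: lessThan_Suc_atMost)
    qed
  qed
  from summable_divide[OF this, of "D c"] have sm: "summable (\<lambda>k. pmf (law k) c)"
  proof (rule summable_comparison_test'[where N=0])
    show "norm (pmf (law k) c) \<le> measure_pmf.expectation (law k) D / D c" for k using point[of k] by simp
  qed
  have "AE \<omega> in M. eventually (\<lambda>k. \<omega> \<in> space M - {\<omega> \<in> space M. S k \<omega> = c}) sequentially"
  proof (rule borel_cantelli_AE1)
    show "{\<omega> \<in> space M. S k \<omega> = c} \<in> sets M" for k by measurable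
    have eq: "emeasure M {\<omega> \<in> space M. S k \<omega> = c} = ennreal (pmf (law k) c)" for k using pl[of k c] by (simp add: pr_def)
    then show "emeasure M {\<omega> \<in> space M. S k \<omega> = c} < \<infinity>" for k by simp
    show "summable (\<lambda>k. measure M {\<omega> \<in> space M. S k \<omega> = c})"
      using sm eq by (simp add: measure_def)
  qed
  then show ?thesis by (rule AE_mp) (auto intro!: AE_I2 elim: eventually_mono)
qed

end

lemma transient_criterion:
  fixes F :: "nat \<Rightarrow> real" and Z :: "nat \<Rightarrow> 'a \<Rightarrow> nat"
  assumes "mchain M P z0 Z" and "\<And>z. 0 \<le> F z" "\<And>z. F z \<le> B"
    and "\<And>z. measure_pmf.expectation (P z) F < F z"
  shows "transient M Z"
proof -
  interpret mchain M P z0 Z by fact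
  have "AE \<omega> in M. \<forall>c. \<forall>\<^sub>F k in sequentially. Z k \<omega> \<noteq> c"
    unfolding AE_all_countable using AE_not_frequently[of F B] assms by blast
  then have "AE \<omega> in M. filterlim (\<lambda>k. Z k \<omega>) at_top sequentially"
  proof eventually_elim
    case (elim \<omega>)
    have "\<forall>\<^sub>F k in sequentially. Z k \<omega> \<ge> N" for N
    proof -
      have "\<forall>\<^sub>F k in sequentially. \<forall>c\<in>{..<N}. Z k \<omega> \<noteq> c"
        using elim by (intro eventually_ball_finite) auto
      then show ?thesis by (rule eventually_mono) (metis lessThan_iff not_le)
    qed
    then show ?case by (simp add: filterlim_at_top)
  qed
  then show ?thesis by (simp add: transient_def)
qed

section \<open>Return times\<close>

lemma Inf_enat_eq_iff:
  "Inf {enat k | k. Q k} = enat m \<longleftrightarrow> Q m \<and> (\<forall>i<m. \<not> Q i)"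
proof
  assume *: "Inf {enat k | k. Q k} = enat m"
  then have ne: "{enat k | k. Q k} \<noteq> {}" by (metis Inf_empty enat.distinct(1) top_enat_def)
  from wellorder_InfI[of _ "{enat k | k. Q k}"] ne * have "enat m \<in> {enat k | k. Q k}" by auto
  moreover have "\<not> Q i" if "i < m" for i
  proof
    assume "Q i"
    then have "Inf {enat k | k. Q k} \<le> enat i" by (intro Inf_lower) auto
    with * that show False by simp
  qed
  ultimately show "Q m \<and> (\<forall>i<m. \<not> Q i)" by auto
next
  assume *: "Q m \<and> (\<forall>i<m. \<not> Q i)"
  show "Inf {enat k | k. Q k} = enat m"
  proof (rule antisym)
    show "Inf {enat k | k. Q k} \<le> enat m" using * by (intro Inf_lower) auto
    show "enat m \<le> Inf {enat k | k. Q k}" using * by (intro Inf_greatest) (auto simp: not_less[symmetric])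
  qed
qed

text \<open>Shows the visit time to be a stopping time: whether it equals \<open>k\<close> is
  decided by the states up to time \<open>k\<close>.\<close>

lemma visit_time_eq_iff:
  "visit_time z s j = enat k \<longleftrightarrow> z k = s \<and> card {i. i < k \<and> z i = s} = j"
proof (induction j arbitrary: k)
  case 0
  show ?case by (auto simp: Inf_enat_eq_iff)
next
  case (Suc j)
  have "visit_time z s (Suc j) = enat k \<longleftrightarrow>
      (visit_time z s j < enat k \<and> z k = s) \<and> (\<forall>i<k. \<not> (visit_time z s j < enat i \<and> z i = s))"
    by (simp only: visit_time.simps Inf_enat_eq_iff)
  also have "\<dots> \<longleftrightarrow> z k = s \<and> card {i. i < k \<and> z i = s} = Suc j"
  proof
    assume *: "(visit_time z s j < enat k \<and> z k = s) \<and> (\<forall>i<k. \<not> (visit_time z s j < enat i \<and> z i = s))"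
    then obtain m where m: "visit_time z s j = enat m" "m < k" by (cases "visit_time z s j") auto
    then have ms: "z m = s" "card {i. i < m \<and> z i = s} = j" using Suc by auto
    have "{i. i < k \<and> z i = s} = insert m {i. i < m \<and> z i = s}"
      using * m ms by (auto simp: not_less)
    then show "z k = s \<and> card {i. i < k \<and> z i = s} = Suc j" using * ms by simp
  next
    assume *: "z k = s \<and> card {i. i < k \<and> z i = s} = Suc j"
    define A where "A = {i. i < k \<and> z i = s}"
    have cA: "card A = Suc j" using * by (simp add: A_def)
    then have "A \<noteq> {}" by auto
    moreover have "finite A" by (simp add: A_def)
    ultimately have A: "finite A" "A \<noteq> {}" by auto
    define m where "m = Max A"
    have m: "m < k" "z m = s" using Max_in[OF A] by (auto simp: m_def A_def)
    have max: "i \<le> m" if "i < k" "z i = s" for i using Max_ge[OF A(1)] that by (auto simp: m_def A_def)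
    have "A = insert m {i. i < m \<and> z i = s}"
      using m max by (force simp: A_def order_less_le)
    with cA have "card {i. i < m \<and> z i = s} = j" by simp
    then have "visit_time z s j = enat m" using Suc m by simp
    then show "(visit_time z s j < enat k \<and> z k = s) \<and> (\<forall>i<k. \<not> (visit_time z s j < enat i \<and> z i = s))"
      using * m max by (auto simp: not_less)
  qed
  finally show ?case .
qed

lemma visit_time_finite:
  assumes "\<exists>\<^sub>\<infinity>k. z k = s"
  obtains k where "visit_time z s j = enat k"
proof (induction j arbitrary: thesis)
  case 0
  obtain k where "z k = s" using assms by (auto simp: INFM_nat)
  then have "Inf {enat k | k. z k = s} \<le> enat k" by (intro Inf_lower) auto
  then show ?case using 0 by (cases "Inf {enat k | k. z k = s}") auto
next
  case (Suc j)
  obtain m where m: "visit_time z s j = enat m" by (rule Suc.IH)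
  obtain k where "m < k" "z k = s" using assms by (auto simp: INFM_nat)
  then have "visit_time z s (Suc j) \<le> enat k" using m by (auto intro!: Inf_lower)
  then show ?case using Suc.prems by (cases "visit_time z s (Suc j)") auto
qed

lemma return_time_finite:
  assumes "\<exists>\<^sub>\<infinity>k. z k = s"
  shows "return_time z s j < \<infinity>"
proof -
  obtain k where "visit_time z s j = enat k" by (rule visit_time_finite[OF assms])
  moreover obtain m where "visit_time z s (Suc j) = enat m" by (rule visit_time_finite[OF assms])
  ultimately show ?thesis unfolding return_time_def by (simp only: idiff_enat_enat) simp
qed

lemma less_return_time_iff:
  assumes "\<exists>\<^sub>\<infinity>k. z k = s" "visit_time z s j = enat k"
  shows "enat n < return_time z s j \<longleftrightarrow> (\<forall>i. k < i \<and> i \<le> k + n \<longrightarrow> z i \<noteq> s)"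
proof -
  obtain m where m: "visit_time z s (Suc j) = enat m" by (rule visit_time_finite[OF assms(1)])
  then have km: "(k < m \<and> z m = s) \<and> (\<forall>i<m. \<not> (k < i \<and> z i = s))"
    using assms(2) by (simp only: visit_time.simps Inf_enat_eq_iff) simp
  have "return_time z s j = enat (m - k)"
    using m assms(2) unfolding return_time_def by (simp only: idiff_enat_enat)
  then have "enat n < return_time z s j \<longleftrightarrow> k + n < m" by auto
  also have "\<dots> \<longleftrightarrow> (\<forall>i. k < i \<and> i \<le> k + n \<longrightarrow> z i \<noteq> s)"
  proof
    assume "k + n < m"
    then show "\<forall>i. k < i \<and> i \<le> k + n \<longrightarrow> z i \<noteq> s" using km by simp
  next
    assume "\<forall>i. k < i \<and> i \<le> k + n \<longrightarrow> z i \<noteq> s"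
    then have "\<not> m \<le> k + n" using km by blast
    then show "k + n < m" by simp
  qed
  finally show ?thesis .
qed

context mchain
begin

lemma visit_time_measurable: "(\<lambda>\<omega>. visit_time (\<lambda>k. S k \<omega>) c j) \<in> measurable M (count_space UNIV)"
proof -
  have fin: "{\<omega> \<in> space M. visit_time (\<lambda>k. S k \<omega>) c j = enat k} \<in> sets M" for k
  proof -
    have "depends_upto k (\<lambda>p. p k = c \<and> card {i. i < k \<and> p i = c} = j)"
    proof (rule depends_uptoI)
      fix p q :: "nat \<Rightarrow> 's" assume *: "\<And>i. i \<le> k \<Longrightarrow> p i = q i" "p k = c \<and> card {i. i < k \<and> p i = c} = j"
      have "{i. i < k \<and> p i = c} = {i. i < k \<and> q i = c}" using * by auto
      with * show "q k = c \<and> card {i. i < k \<and> q i = c} = j" by auto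
    qed
    from depends_measurable[OF this] show ?thesis by (simp only: visit_time_eq_iff)
  qed
  show ?thesis
  proof (rule measurableI)
    fix A :: "enat set"
    have "(\<lambda>\<omega>. visit_time (\<lambda>k. S k \<omega>) c j) -` A \<inter> space M =
      (\<Union>k\<in>{k. enat k \<in> A}. {\<omega> \<in> space M. visit_time (\<lambda>k. S k \<omega>) c j = enat k}) \<union>
      (if \<infinity> \<in> A then space M - (\<Union>k. {\<omega> \<in> space M. visit_time (\<lambda>k. S k \<omega>) c j = enat k}) else {})"
    proof (intro equalityI subsetI)
      fix \<omega> assume "\<omega> \<in> (\<lambda>\<omega>. visit_time (\<lambda>k. S k \<omega>) c j) -` A \<inter> space M"
      then show "\<omega> \<in> (\<Union>k\<in>{k. enat k \<in> A}. {\<omega> \<in> space M. visit_time (\<lambda>k. S k \<omega>) c j = enat k}) \<union>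
        (if \<infinity> \<in> A then space M - (\<Union>k. {\<omega> \<in> space M. visit_time (\<lambda>k. S k \<omega>) c j = enat k}) else {})"
        by (cases "visit_time (\<lambda>k. S k \<omega>) c j") auto
    next
      fix \<omega> assume "\<omega> \<in> (\<Union>k\<in>{k. enat k \<in> A}. {\<omega> \<in> space M. visit_time (\<lambda>k. S k \<omega>) c j = enat k}) \<union>
        (if \<infinity> \<in> A then space M - (\<Union>k. {\<omega> \<in> space M. visit_time (\<lambda>k. S k \<omega>) c j = enat k}) else {})"
      then show "\<omega> \<in> (\<lambda>\<omega>. visit_time (\<lambda>k. S k \<omega>) c j) -` A \<inter> space M"
        by (cases "visit_time (\<lambda>k. S k \<omega>) c j") (auto split: if_splits)
    qed
    also have "\<dots> \<in> sets M" using fin by auto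
    finally show "(\<lambda>\<omega>. visit_time (\<lambda>k. S k \<omega>) c j) -` A \<inter> space M \<in> sets M" .
  qed simp
qed

lemma return_time_measurable: "(\<lambda>\<omega>. return_time (\<lambda>k. S k \<omega>) c j) \<in> measurable M (count_space UNIV)"
proof -
  note [measurable] = visit_time_measurable
  have "(\<lambda>\<omega>. (\<lambda>x \<omega>. x - visit_time (\<lambda>k. S k \<omega>) c j) (visit_time (\<lambda>k. S k \<omega>) c (Suc j)) \<omega>) \<in> measurable M (count_space UNIV)"
    by (rule measurable_compose_countable[OF _ visit_time_measurable]) measurable
  then show ?thesis by (simp add: return_time_def)
qed

text \<open>Strong Markov property at \<open>visit_time _ c j\<close>, by summing over its value
  \<open>k\<close>: on each piece the ordinary Markov property gives the same factor
  \<open>avoid K c n c\<close>, and by recurrence the probabilities of the pieces add up to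
  one.\<close>

lemma emeasure_less_return_time:
  assumes inf: "AE \<omega> in M. \<exists>\<^sub>\<infinity>k. S k \<omega> = c"
  shows "emeasure M {\<omega> \<in> space M. enat n < return_time (\<lambda>k. S k \<omega>) c j} = ennreal (avoid K c n c)"
proof -
  define Q where "Q k p \<longleftrightarrow> card {i. i < k \<and> p i = c} = j" for k and p :: "nat \<Rightarrow> 's"
  have Q: "depends_upto k (Q k)" for k
  proof (rule depends_uptoI)
    fix p q :: "nat \<Rightarrow> 's" assume *: "\<And>i. i \<le> k \<Longrightarrow> p i = q i" "Q k p"
    have "{i. i < k \<and> p i = c} = {i. i < k \<and> q i = c}" using * by auto
    with * show "Q k q" by (auto simp: Q_def)
  qed
  \<comment> \<open>Applied to the tail event and, at the end, to the sure event, where it says that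
    the pieces exhaust the space.\<close>
  have sum: "emeasure M {\<omega> \<in> space M. R (\<lambda>i. S i \<omega>)} = (\<Sum>k. pr (\<lambda>p. Q k p \<and> p k = c \<and> G k p))"
    if R: "{\<omega> \<in> space M. R (\<lambda>i. S i \<omega>)} \<in> sets M"
      and G: "\<And>k. {\<omega> \<in> space M. G k (\<lambda>i. S i \<omega>)} \<in> sets M"
      and RG: "\<And>p k. \<exists>\<^sub>\<infinity>k. p k = c \<Longrightarrow> Q k p \<Longrightarrow> p k = c \<Longrightarrow> R p \<longleftrightarrow> G k p"
    for R G
  proof -
    define B where "B k = {\<omega> \<in> space M. Q k (\<lambda>i. S i \<omega>) \<and> S k \<omega> = c \<and> G k (\<lambda>i. S i \<omega>)}" for k
    have [measurable]: "Measurable.pred M (\<lambda>\<omega>. Q k (\<lambda>i. S i \<omega>))" "Measurable.pred M (\<lambda>\<omega>. G k (\<lambda>i. S i \<omega>))" for k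
      using depends_measurable[OF Q] G by (auto simp: pred_def)
    have Bm: "B k \<in> sets M" for k unfolding B_def by measurable
    have vt: "Q k p \<and> p k = c \<longleftrightarrow> visit_time p c j = enat k" for k p
      unfolding Q_def by (auto simp: visit_time_eq_iff)
    have dj: "disjoint_family B"
      unfolding disjoint_family_on_def B_def using vt by (auto, metis enat.inject)
    have "emeasure M {\<omega> \<in> space M. R (\<lambda>i. S i \<omega>)} = emeasure M (\<Union>k. B k)"
    proof (rule emeasure_eq_AE)
      show "AE \<omega> in M. \<omega> \<in> {\<omega> \<in> space M. R (\<lambda>i. S i \<omega>)} \<longleftrightarrow> \<omega> \<in> (\<Union>k. B k)"
        using inf
      proof (rule AE_mp, intro AE_I2 impI)
        fix \<omega> assume \<omega>: "\<omega> \<in> space M" "\<exists>\<^sub>\<infinity>k. S k \<omega> = c"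
        obtain k where "visit_time (\<lambda>i. S i \<omega>) c j = enat k" by (rule visit_time_finite[OF \<omega>(2)])
        then have k: "Q k (\<lambda>i. S i \<omega>)" "S k \<omega> = c" using vt[of k "\<lambda>i. S i \<omega>"] by auto
        show "\<omega> \<in> {\<omega> \<in> space M. R (\<lambda>i. S i \<omega>)} \<longleftrightarrow> \<omega> \<in> (\<Union>k. B k)"
          using RG[OF \<omega>(2)] k \<omega>(1) by (auto simp: B_def)
      qed
      show "{\<omega> \<in> space M. R (\<lambda>i. S i \<omega>)} \<in> sets M" by (rule R)
      show "(\<Union>k. B k) \<in> sets M" using Bm by (intro sets.countable_UN) auto
    qed
    also have "\<dots> = (\<Sum>k. emeasure M (B k))" using Bm dj by (intro suminf_emeasure[symmetric]) auto
    finally show ?thesis by (simp add: B_def pr_def)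
  qed
  have "emeasure M {\<omega> \<in> space M. enat n < return_time (\<lambda>k. S k \<omega>) c j}
    = (\<Sum>k. pr (\<lambda>p. Q k p \<and> p k = c \<and> (\<forall>i. k < i \<and> i \<le> k + n \<longrightarrow> p i \<noteq> c)))"
  proof (rule sum)
    show "{\<omega> \<in> space M. enat n < return_time (\<lambda>k. S k \<omega>) c j} \<in> sets M"
      using return_time_measurable[of c j] by measurable
    show "{\<omega> \<in> space M. \<forall>i. k < i \<and> i \<le> k + n \<longrightarrow> S i \<omega> \<noteq> c} \<in> sets M" for k
      by (rule depends_measurable[of "k + n"]) (auto simp: depends_upto_def)
    show "enat n < return_time p c j \<longleftrightarrow> (\<forall>i. k < i \<and> i \<le> k + n \<longrightarrow> p i \<noteq> c)"
      if "\<exists>\<^sub>\<infinity>k. p k = c" "Q k p" "p k = c" for p k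
      using that by (intro less_return_time_iff) (auto simp: visit_time_eq_iff Q_def)
  qed
  also have "\<dots> = (\<Sum>k. pr (\<lambda>p. Q k p \<and> p k = c \<and> True) * ennreal (avoid K c n c))"
    by (simp add: pr_avoid[OF Q])
  also have "\<dots> = (\<Sum>k. pr (\<lambda>p. Q k p \<and> p k = c \<and> True)) * ennreal (avoid K c n c)"
    by (rule ennreal_suminf_multc)
  also have "(\<Sum>k. pr (\<lambda>p. Q k p \<and> p k = c \<and> True)) = emeasure M {\<omega> \<in> space M. True}"
    by (rule sum[symmetric]) auto
  finally show ?thesis using emeasure_space_1 by simp
qed

text \<open>Tail-sum formula. The value depends neither on \<open>j\<close> nor on the starting
  state, so the two kinds of recurrence differ by summability of the avoidance
  probabilities.\<close>

lemma mean_return_time: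
  assumes "AE \<omega> in M. \<exists>\<^sub>\<infinity>k. S k \<omega> = c"
  shows "(\<integral>\<^sup>+ \<omega>. ennreal_of_enat (return_time (\<lambda>k. S k \<omega>) c j) \<partial>M) = (\<Sum>n. ennreal (avoid K c n c))"
proof -
  have "(\<integral>\<^sup>+ \<omega>. ennreal_of_enat (return_time (\<lambda>k. S k \<omega>) c j) \<partial>M)
      = (\<Sum>n. emeasure M {\<omega> \<in> space M. enat n < return_time (\<lambda>k. S k \<omega>) c j})"
    by (rule nn_integral_enat_function[OF return_time_measurable])
  also have "\<dots> = (\<Sum>n. ennreal (avoid K c n c))"
    by (rule suminf_cong) (rule emeasure_less_return_time[OF assms])
  finally show ?thesis .
qed

end

lemma null_recurrent_criterion:
  assumes "mchain M P z0 Z" and av: "\<And>z. (\<lambda>n. avoid P 1 n z) \<longlonglongrightarrow> 0"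
    and ns: "\<not> summable (\<lambda>n. avoid P 1 n 1)"
  shows "null_recurrent M Z"
proof -
  interpret mchain M P z0 Z by fact
  note inf = AE_visits[OF av]
  have "(\<Sum>n. ennreal (avoid P 1 n 1)) = \<infinity>"
  proof (rule ccontr)
    assume "(\<Sum>n. ennreal (avoid P 1 n 1)) \<noteq> \<infinity>"
    then have "summable (\<lambda>n. avoid P 1 n 1)"
      by (intro summable_suminf_not_top) (simp_all add: avoid_bounds)
    with ns show False by contradiction
  qed
  moreover have "AE \<omega> in M. return_time (\<lambda>k. Z k \<omega>) 1 j < \<infinity>" for j
    using inf by eventually_elim (rule return_time_finite)
  ultimately show ?thesis unfolding null_recurrent_def mean_return_time[OF inf] by blast
qed

lemma positive_recurrent_criterion:
  assumes "mchain M P z0 Z" and sm: "\<And>z. summable (\<lambda>n. avoid P 1 n z)"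
  shows "positive_recurrent M Z"
proof -
  interpret mchain M P z0 Z by fact
  note inf = AE_visits[OF summable_LIMSEQ_zero[OF sm]]
  have "(\<Sum>n. ennreal (avoid P 1 n 1)) = ennreal (\<Sum>n. avoid P 1 n 1)"
    by (rule suminf_ennreal2[OF _ sm]) (simp add: avoid_bounds)
  then have "(\<Sum>n. ennreal (avoid P 1 n 1)) < \<infinity>" by simp
  moreover have "AE \<omega> in M. return_time (\<lambda>k. Z k \<omega>) 1 j < \<infinity>" for j
    using inf by eventually_elim (rule return_time_finite)
  ultimately show ?thesis unfolding positive_recurrent_def mean_return_time[OF inf] by blast
qed

section \<open>Folding the urn to a quadrant\<close>

lemma markov_chainI:
  fixes S :: "nat \<Rightarrow> 'a \<Rightarrow> 's::countable"
  assumes "prob_space M" and "\<And>n. S n \<in> measurable M (count_space UNIV)"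
    and "AE \<omega> in M. S 0 \<omega> = s0"
    and step: "\<And>n s t. emeasure M {\<omega> \<in> space M. (\<forall>i\<le>n. S i \<omega> = s i) \<and> S (Suc n) \<omega> = t}
      = emeasure M {\<omega> \<in> space M. \<forall>i\<le>n. S i \<omega> = s i} * ennreal (pmf (K (s n)) t)"
  shows "markov_chain M K s0 S"
  unfolding markov_chain_def
proof (intro conjI allI impI)
  interpret prob_space M by fact
  fix n s t assume pos: "\<P>(\<omega> in M. \<forall>i\<le>n. S i \<omega> = s i) > 0"
  have "{\<omega> \<in> space M. S (Suc n) \<omega> = t \<and> (\<forall>i\<le>n. S i \<omega> = s i)} = {\<omega> \<in> space M. (\<forall>i\<le>n. S i \<omega> = s i) \<and> S (Suc n) \<omega> = t}"
    by auto
  then have "prob {\<omega> \<in> space M. S (Suc n) \<omega> = t \<and> (\<forall>i\<le>n. S i \<omega> = s i)}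
     = prob {\<omega> \<in> space M. \<forall>i\<le>n. S i \<omega> = s i} * pmf (K (s n)) t"
    using step[of n s t] by (simp add: measure_def enn2real_mult)
  then show "\<P>(\<omega> in M. S (Suc n) \<omega> = t \<bar> \<forall>i\<le>n. S i \<omega> = s i) = pmf (K (s n)) t"
    using pos by (simp add: cond_prob_def)
qed (use assms in auto)

context mchain
begin

lemma AE_path: "AE \<omega> in M. \<forall>n. S (Suc n) \<omega> \<in> set_pmf (K (S n \<omega>))"
proof -
  have "AE \<omega> in M. \<forall>n s t. t \<notin> set_pmf (K s) \<longrightarrow> \<not> (S n \<omega> = s \<and> S (Suc n) \<omega> = t)"
    unfolding AE_all_countable
  proof (intro allI)
    fix n s t
    show "AE \<omega> in M. t \<notin> set_pmf (K s) \<longrightarrow> \<not> (S n \<omega> = s \<and> S (Suc n) \<omega> = t)"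
    proof (cases "t \<in> set_pmf (K s)")
      case False
      then have "pr (\<lambda>p. True \<and> p n = s \<and> p (Suc n) = t) = 0"
        using pr_step[of n "\<lambda>_. True" s t] by (simp add: depends_upto_def set_pmf_iff)
      then show ?thesis
        unfolding pr_def by (intro AE_I[of _ _ "{\<omega> \<in> space M. S n \<omega> = s \<and> S (Suc n) \<omega> = t}"]) auto
    qed simp
  qed
  then show ?thesis by eventually_elim blast
qed

text \<open>Lumpability: the image of \<open>K s\<close> depends on \<open>s\<close> only through
  \<open>\<rho> s\<close>, so in the sum over the hidden state at time \<open>n\<close> the
  transition probability is a common factor.\<close>

lemma lump:
  fixes \<rho> :: "'s \<Rightarrow> 't::countable"
  assumes \<rho>: "\<And>s. map_pmf \<rho> (K s) = K' (\<rho> s)"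
  shows "mchain M K' (\<rho> s0) (\<lambda>n \<omega>. \<rho> (S n \<omega>))"
proof (intro mchain.intro mchain_axioms.intro markov_chainI)
  show "prob_space M" "prob_space M" by unfold_locales
  show "(\<lambda>\<omega>. \<rho> (S n \<omega>)) \<in> measurable M (count_space UNIV)" for n by measurable
  show "AE \<omega> in M. \<rho> (S 0 \<omega>) = \<rho> s0" using S_0 by eventually_elim simp
  fix n :: nat and s :: "nat \<Rightarrow> 't" and t :: 't
  define Q where "Q p \<longleftrightarrow> (\<forall>i\<le>n. \<rho> (p i) = s i)" for p :: "nat \<Rightarrow> 's"
  define G where "G p \<longleftrightarrow> \<rho> (p (Suc n)) = t" for p :: "nat \<Rightarrow> 's"
  have Q: "depends_upto n Q" by (auto simp: depends_upto_def Q_def)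
  have Gm: "{\<omega> \<in> space M. G (\<lambda>i. S i \<omega>)} \<in> sets M" unfolding G_def by measurable
  have [measurable]: "Measurable.pred M (\<lambda>\<omega>. Q (\<lambda>i. S i \<omega>))" "Measurable.pred M (\<lambda>\<omega>. G (\<lambda>i. S i \<omega>))"
    using depends_measurable[OF Q] Gm by (auto simp: pred_def)
  have "pr (\<lambda>p. Q p \<and> G p) = (\<integral>\<^sup>+u. pr (\<lambda>p. (Q p \<and> G p) \<and> p n = u) \<partial>count_space UNIV)"
    by (rule pr_sum_state) measurable
  also have "\<dots> = (\<integral>\<^sup>+u. pr (\<lambda>p. Q p \<and> p n = u) * ennreal (pmf (K' (s n)) t) \<partial>count_space UNIV)"
  proof (rule nn_integral_cong)
    fix u
    have "pr (\<lambda>p. Q p \<and> p n = u \<and> G p) = pr (\<lambda>p. Q p \<and> p n = u) *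
        ennreal (measure_pmf.expectation (K u) (\<lambda>w. indicator {w. \<rho> w = t} w))"
    proof (rule pr_future[OF Q Gm, where B=1])
      fix Q' :: "(nat \<Rightarrow> 's) \<Rightarrow> bool" and w
      show "pr (\<lambda>p. Q' p \<and> p (Suc n) = w \<and> G p) = pr (\<lambda>p. Q' p \<and> p (Suc n) = w) * ennreal (indicator {w. \<rho> w = t} w)"
      proof (cases "\<rho> w = t")
        case True
        then have "(\<lambda>p. Q' p \<and> p (Suc n) = w \<and> G p) = (\<lambda>p. Q' p \<and> p (Suc n) = w)" by (auto simp: G_def)
        then show ?thesis using True by simp
      next
        case False
        then have "(\<lambda>p. Q' p \<and> p (Suc n) = w \<and> G p) = (\<lambda>_. False)" by (auto simp: G_def)
        then show ?thesis using False by (simp add: pr_def)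
      qed
    qed (auto simp: indicator_def)
    also have "measure_pmf.expectation (K u) (\<lambda>w. indicator {w. \<rho> w = t} w) = pmf (map_pmf \<rho> (K u)) t"
      by (simp add: pmf_map vimage_def)
    finally have *: "pr (\<lambda>p. Q p \<and> p n = u \<and> G p) = pr (\<lambda>p. Q p \<and> p n = u) * ennreal (pmf (K' (\<rho> u)) t)"
      unfolding \<rho> .
    have "(\<lambda>p. (Q p \<and> G p) \<and> p n = u) = (\<lambda>p. Q p \<and> p n = u \<and> G p)" by auto
    moreover have "pr (\<lambda>p. Q p \<and> p n = u) = 0" if "\<rho> u \<noteq> s n"
    proof -
      have "(\<lambda>p. Q p \<and> p n = u) = (\<lambda>_. False)" using that by (auto simp: Q_def fun_eq_iff)
      then show ?thesis by (simp add: pr_def)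
    qed
    ultimately show "pr (\<lambda>p. (Q p \<and> G p) \<and> p n = u) = pr (\<lambda>p. Q p \<and> p n = u) * ennreal (pmf (K' (s n)) t)"
      using * by (cases "\<rho> u = s n") auto
  qed
  also have "\<dots> = (\<integral>\<^sup>+u. pr (\<lambda>p. Q p \<and> p n = u) \<partial>count_space UNIV) * ennreal (pmf (K' (s n)) t)"
    by (simp add: nn_integral_multc)
  also have "(\<integral>\<^sup>+u. pr (\<lambda>p. Q p \<and> p n = u) \<partial>count_space UNIV) = pr Q"
    by (rule pr_sum_state[symmetric]) measurable
  finally show "emeasure M {\<omega> \<in> space M. (\<forall>i\<le>n. \<rho> (S i \<omega>) = s i) \<and> \<rho> (S (Suc n) \<omega>) = t}
      = emeasure M {\<omega> \<in> space M. \<forall>i\<le>n. \<rho> (S i \<omega>) = s i} * ennreal (pmf (K' (s n)) t)"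
    by (simp add: pr_def Q_def G_def)
qed

end

text \<open>The rotational symmetry of the urn allows to fold the plane onto the first quadrant:
  in \<open>(a, b)\<close>, the coordinate \<open>a\<close> is the one that decreases until the walk hits an axis.\<close>

definition quad :: "int \<times> int \<Rightarrow> nat \<times> nat" where
  "quad = (\<lambda>(x, y). if x = 0 \<or> y = 0 then (0, nat (\<bar>x\<bar> + \<bar>y\<bar>))
     else if x * y > 0 then (nat \<bar>x\<bar>, nat \<bar>y\<bar>) else (nat \<bar>y\<bar>, nat \<bar>x\<bar>))"

text \<open>At \<open>(0, 0)\<close> the absorbing value agrees with that of
  \<open>urn_kernel\<close> at the origin, so that folding commutes with the kernels without a side
  condition.\<close>

definition quad_kernel :: "int pmf \<Rightarrow> nat \<times> nat \<Rightarrow> (nat \<times> nat) pmf" where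
  "quad_kernel \<kappa> = (\<lambda>(a, b).
     if a = 0 then (if b = 0 then return_pmf (0, 0) else map_pmf (\<lambda>n. (n, 1)) (noisy_step \<kappa> b))
     else map_pmf (\<lambda>c. if c then (a, Suc b) else (a - 1, b)) (bernoulli_pmf (real a / real (a + b))))"

text \<open>In the second and fourth quadrants the outcome \<open>True\<close> of the coin in
  \<open>urn_kernel\<close> lowers the folded first coordinate instead of raising the second one;
  the coin has to be reversed.\<close>

lemma map_bernoulli_flip:
  assumes "0 \<le> p" "p \<le> 1"
  shows "map_pmf f (bernoulli_pmf p) = map_pmf (\<lambda>c. f (\<not> c)) (bernoulli_pmf (1 - p))"
proof -
  have "bernoulli_pmf p = map_pmf Not (bernoulli_pmf (1 - p))"
  proof (rule pmf_eqI)
    fix c :: bool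
    have "pmf (map_pmf Not (bernoulli_pmf (1 - p))) (\<not> \<not> c) = pmf (bernoulli_pmf (1 - p)) (\<not> c)"
      by (rule pmf_map_inj') (auto simp: inj_def)
    then show "pmf (bernoulli_pmf p) c = pmf (map_pmf Not (bernoulli_pmf (1 - p))) c"
      using assms by (cases c) auto
  qed
  then show ?thesis by (simp add: map_pmf_comp)
qed

lemma map_quad_urn_kernel: "map_pmf quad (urn_kernel \<kappa> s) = quad_kernel \<kappa> (quad s)"
proof -
  obtain x y where s: "s = (x, y)" by force
  consider "x = 0" "y = 0" | "x = 0" "y \<noteq> 0" | "x \<noteq> 0" "y = 0" | "x * y > 0" | "x \<noteq> 0" "y \<noteq> 0" "x * y < 0"
    by (metis linorder_neqE_linordered_idom mult_eq_0_iff)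
  then show ?thesis
  proof cases
    case 1
    then show ?thesis by (simp add: s urn_kernel_def quad_def quad_kernel_def)
  next
    case 2
    have "quad (- sgn y, sgn y * max 1 (\<bar>y\<bar> - k)) = (nat (max 1 (\<bar>y\<bar> - k)), 1)" for k
      using 2 by (auto simp: quad_def sgn_if max_def mult_less_0_iff zero_less_mult_iff)
    then show ?thesis
      using 2 by (simp add: s urn_kernel_def quad_def[of] quad_kernel_def map_pmf_comp noisy_step_def)
  next
    case 3
    have "quad (sgn x * max 1 (\<bar>x\<bar> - k), sgn x) = (nat (max 1 (\<bar>x\<bar> - k)), 1)" for k
      using 3 by (auto simp: quad_def sgn_if max_def mult_less_0_iff zero_less_mult_iff)
    then show ?thesis
      using 3 by (simp add: s urn_kernel_def quad_def[of] quad_kernel_def map_pmf_comp noisy_step_def)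
  next
    case 4
    then have nz: "x \<noteq> 0" "y \<noteq> 0" by auto
    have q: "quad s = (nat \<bar>x\<bar>, nat \<bar>y\<bar>)" using 4 nz by (simp add: s quad_def)
    have up: "quad (x, y + sgn x) = (nat \<bar>x\<bar>, Suc (nat \<bar>y\<bar>))"
      using 4 by (auto simp: quad_def sgn_if zero_less_mult_iff)
    have down: "quad (x - sgn y, y) = (nat \<bar>x\<bar> - 1, nat \<bar>y\<bar>)"
      using 4 by (auto simp: quad_def sgn_if zero_less_mult_iff)
    have "real_of_int \<bar>x\<bar> / real_of_int (\<bar>x\<bar> + \<bar>y\<bar>) = real (nat \<bar>x\<bar>) / real (nat \<bar>x\<bar> + nat \<bar>y\<bar>)" by simp
    moreover have "map_pmf quad (urn_kernel \<kappa> s) = map_pmf (\<lambda>c. if c then (nat \<bar>x\<bar>, Suc (nat \<bar>y\<bar>)) else (nat \<bar>x\<bar> - 1, nat \<bar>y\<bar>))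
        (bernoulli_pmf (real_of_int \<bar>x\<bar> / real_of_int (\<bar>x\<bar> + \<bar>y\<bar>)))"
      using nz by (simp add: s urn_kernel_def map_pmf_comp if_distrib[of quad] up down cong: if_cong)
    ultimately show ?thesis using nz by (simp only: q) (simp add: quad_kernel_def)
  next
    case 5
    have q: "quad s = (nat \<bar>y\<bar>, nat \<bar>x\<bar>)" using 5 by (simp add: s quad_def)
    have down: "quad (x, y + sgn x) = (nat \<bar>y\<bar> - 1, nat \<bar>x\<bar>)"
      using 5 by (auto simp: quad_def sgn_if mult_less_0_iff zero_less_mult_iff)
    have up: "quad (x - sgn y, y) = (nat \<bar>y\<bar>, Suc (nat \<bar>x\<bar>))"
      using 5 by (auto simp: quad_def sgn_if mult_less_0_iff zero_less_mult_iff)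
    have pr: "real (nat \<bar>y\<bar>) / real (nat \<bar>y\<bar> + nat \<bar>x\<bar>) = 1 - real_of_int \<bar>x\<bar> / real_of_int (\<bar>x\<bar> + \<bar>y\<bar>)"
    proof -
      have flip: "b / (b + a) = 1 - a / (a + b)" if "a + b \<noteq> 0" for a b :: real
        using that by (simp add: field_simps)
      have "real_of_int \<bar>x\<bar> + real_of_int \<bar>y\<bar> \<noteq> 0" using 5 by simp
      from flip[OF this] show ?thesis by simp
    qed
    have "map_pmf quad (urn_kernel \<kappa> s) = map_pmf (\<lambda>c. if c then (nat \<bar>y\<bar> - 1, nat \<bar>x\<bar>) else (nat \<bar>y\<bar>, Suc (nat \<bar>x\<bar>)))
        (bernoulli_pmf (real_of_int \<bar>x\<bar> / real_of_int (\<bar>x\<bar> + \<bar>y\<bar>)))"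
      using 5 by (simp add: s urn_kernel_def map_pmf_comp if_distrib[of quad] up down cong: if_cong)
    also have "\<dots> = map_pmf (\<lambda>c. if \<not> c then (nat \<bar>y\<bar> - 1, nat \<bar>x\<bar>) else (nat \<bar>y\<bar>, Suc (nat \<bar>x\<bar>)))
        (bernoulli_pmf (real (nat \<bar>y\<bar>) / real (nat \<bar>y\<bar> + nat \<bar>x\<bar>)))"
      unfolding pr using 5 by (intro map_bernoulli_flip) (auto simp: divide_le_eq)
    also have "(\<lambda>c. if \<not> c then (nat \<bar>y\<bar> - 1, nat \<bar>x\<bar>) else (nat \<bar>y\<bar>, Suc (nat \<bar>x\<bar>)))
        = (\<lambda>c. if c then (nat \<bar>y\<bar>, Suc (nat \<bar>x\<bar>)) else (nat \<bar>y\<bar> - 1, nat \<bar>x\<bar>))" by auto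
    also have "map_pmf \<dots> (bernoulli_pmf (real (nat \<bar>y\<bar>) / real (nat \<bar>y\<bar> + nat \<bar>x\<bar>))) = quad_kernel \<kappa> (quad s)"
      using 5 by (simp only: q) (simp add: quad_kernel_def)
    finally show ?thesis .
  qed
qed

text \<open>From the state \<open>s\<close>, \<open>no_hit \<kappa> m s\<close> is the probability that the axis \<open>fst = 0\<close> is not visited at the
  times \<open>0, \<dots>, m - 1\<close>, and \<open>exit_at \<kappa> t m s\<close> the probability that it is visited first at time \<open>m\<close> and left
  with a traversal of size \<open>t\<close>.\<close>

primrec no_hit :: "int pmf \<Rightarrow> nat \<Rightarrow> nat \<times> nat \<Rightarrow> real" where
  "no_hit \<kappa> 0 = (\<lambda>_. 1)"
| "no_hit \<kappa> (Suc m) = (\<lambda>s. if fst s = 0 then 0 else measure_pmf.expectation (quad_kernel \<kappa> s) (no_hit \<kappa> m))"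

primrec exit_at :: "int pmf \<Rightarrow> nat \<Rightarrow> nat \<Rightarrow> nat \<times> nat \<Rightarrow> real" where
  "exit_at \<kappa> t 0 = (\<lambda>s. if fst s = 0 then measure_pmf.expectation (quad_kernel \<kappa> s) (\<lambda>w. if fst w = t then 1 else 0) else 0)"
| "exit_at \<kappa> t (Suc m) = (\<lambda>s. if fst s = 0 then 0 else measure_pmf.expectation (quad_kernel \<kappa> s) (exit_at \<kappa> t m))"

section \<open>Leaving a quadrant step by step\<close>

lemma quad_kernel_expectation:
  "measure_pmf.expectation (quad_kernel \<kappa> (Suc a, b)) f =
     real (Suc a) / real (Suc a + b) * f (Suc a, Suc b) + real b / real (Suc a + b) * (f (a, b) :: real)"
proof -
  define q where "q = real (Suc a) / real (Suc a + b)"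
  have q: "q \<in> {0..1}" by (auto simp: q_def)
  have "quad_kernel \<kappa> (Suc a, b) = map_pmf (\<lambda>c. if c then (Suc a, Suc b) else (a, b)) (bernoulli_pmf q)"
    by (simp add: quad_kernel_def q_def add.assoc cong: if_cong)
  moreover have "real b / real (Suc a + b) = 1 - q" by (simp add: q_def field_simps)
  ultimately show ?thesis unfolding q_def[symmetric] using q by (simp add: mult.commute)
qed

lemma no_hit_bounds: "0 \<le> no_hit \<kappa> m s \<and> no_hit \<kappa> m s \<le> 1"
proof (induction m arbitrary: s)
  case (Suc m)
  have "\<bar>no_hit \<kappa> m w\<bar> \<le> 1" for w using Suc[of w] by auto
  from integrable_pmf_bounded[OF this] show ?case
    using Suc by (auto intro!: integral_nonneg_AE expectation_le_const)
qed simp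

lemma exit_at_bounds: "0 \<le> exit_at \<kappa> t m s \<and> exit_at \<kappa> t m s \<le> 1"
proof (induction m arbitrary: s)
  case 0
  have "integrable (measure_pmf (quad_kernel \<kappa> s)) (\<lambda>w. if fst w = t then 1 else 0 :: real)"
    by (rule integrable_pmf_bounded[of _ 1]) auto
  then show ?case by (auto intro!: integral_nonneg_AE expectation_le_const)
next
  case (Suc m)
  have "\<bar>exit_at \<kappa> t m w\<bar> \<le> 1" for w using Suc[of w] by auto
  from integrable_pmf_bounded[OF this] show ?case
    using Suc by (auto intro!: integral_nonneg_AE expectation_le_const)
qed

text \<open>Expected exit time with the potential \<open>1 + a * (a + 3) / 2\<close>: a drop from
  \<open>a' + 1\<close> lowers it by \<open>a' + 2\<close> and has probability at least
  \<open>1 / (a' + 2)\<close> when \<open>b \<ge> 1\<close>.\<close>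

lemma no_hit_sum_le:
  "b \<ge> 1 \<Longrightarrow> (\<Sum>m<N. no_hit \<kappa> m (a, b)) \<le> 1 + real a * (real a + 3) / 2"
proof (induction N arbitrary: a b)
  case (Suc N)
  have eq: "(\<Sum>m<Suc N. no_hit \<kappa> m (a, b)) = 1 + (\<Sum>m<N. no_hit \<kappa> (Suc m) (a, b))"
    by (subst sum.lessThan_Suc_shift) simp
  show ?case
  proof (cases a)
    case 0
    then show ?thesis unfolding eq by simp
  next
    case (Suc a')
    define p where "p = real b / real (Suc a' + b)"
    have p1: "real (Suc a') / real (Suc a' + b) = 1 - p" by (simp add: p_def field_simps)
    have p: "0 \<le> p" "p \<le> 1" by (auto simp: p_def)
    have "(\<Sum>m<N. no_hit \<kappa> (Suc m) (a, b)) = (1 - p) * (\<Sum>m<N. no_hit \<kappa> m (Suc a', Suc b)) + p * (\<Sum>m<N. no_hit \<kappa> m (a', b))"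
    proof -
      have "no_hit \<kappa> (Suc m) (a, b) = (1 - p) * no_hit \<kappa> m (Suc a', Suc b) + p * no_hit \<kappa> m (a', b)" for m
        unfolding Suc no_hit.simps quad_kernel_expectation p1 p_def[symmetric] by simp
      then show ?thesis by (simp only: sum.distrib sum_distrib_left)
    qed
    also have "\<dots> \<le> (1 - p) * (1 + real (Suc a') * (real (Suc a') + 3) / 2) + p * (1 + real a' * (real a' + 3) / 2)"
      using p Suc.prems by (intro add_mono mult_left_mono Suc.IH) auto
    also have "\<dots> = 1 + real (Suc a') * (real (Suc a') + 3) / 2 - p * (real a' + 2)"
      by (simp add: field_simps)
    also have "p * (real a' + 2) \<ge> 1"
    proof -
      have "real a' * real b + real b * 2 \<ge> real a' * 1 + real b + 1"
        using Suc.prems mult_left_mono[of 1 "real b" "real a'"] by simp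
      then show ?thesis by (simp add: p_def field_simps)
    qed
    finally show ?thesis unfolding eq using Suc by simp
  qed
qed simp

lemma no_hit_tendsto_0: "b \<ge> 1 \<Longrightarrow> (\<lambda>m. no_hit \<kappa> m (a, b)) \<longlonglongrightarrow> 0"
proof (rule summable_LIMSEQ_zero, rule bounded_imp_summable)
  show "(\<Sum>k\<le>n. no_hit \<kappa> k (a, b)) \<le> 1 + real a * (real a + 3) / 2" if "b \<ge> 1" for n
    using no_hit_sum_le[OF that, of \<kappa> a "Suc n"] by (simp only: lessThan_Suc_atMost)
qed (simp add: no_hit_bounds)

text \<open>Links single steps to the law built by columns. Both obey the same one-step recursion,
  and the part undecided after \<open>N\<close> steps is at most \<open>no_hit \<kappa> N\<close>,
  which tends to zero; so the partial sums are squeezed.\<close>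

lemma exit_at_sums:
  assumes "b \<ge> 1"
  shows "(\<lambda>m. exit_at \<kappa> t m (a, b)) sums pmf (exit_law a b \<bind> noisy_step \<kappa>) t"
proof -
  define \<Psi> where "\<Psi> a b = pmf (exit_law a b \<bind> noisy_step \<kappa>) t" for a b
  have \<Psi>0: "\<Psi> 0 b = pmf (noisy_step \<kappa> b) t" for b by (simp add: \<Psi>_def bind_return_pmf)
  have \<Psi>S: "\<Psi> (Suc a) b = real (Suc a) / real (Suc a + b) * \<Psi> (Suc a) (Suc b) + real b / real (Suc a + b) * \<Psi> a b" for a b
  proof -
    have 1: "1 - real (Suc a) / real (Suc a + b) = real b / real (Suc a + b)" by (simp add: field_simps)
    have 2: "real (Suc a) / real (Suc a + b) \<in> {0..1}" by auto
    have "exit_law (Suc a) b \<bind> noisy_step \<kappa> = bernoulli_pmf (real (Suc a) / real (Suc a + b)) \<bind>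
      (\<lambda>c. if c then exit_law (Suc a) (Suc b) \<bind> noisy_step \<kappa> else exit_law a b \<bind> noisy_step \<kappa>)"
      by (subst exit_law_step) (auto simp: bind_assoc_pmf intro!: bind_pmf_cong)
    then have "\<Psi> (Suc a) b = pmf (bernoulli_pmf (real (Suc a) / real (Suc a + b)) \<bind>
      (\<lambda>c. if c then exit_law (Suc a) (Suc b) \<bind> noisy_step \<kappa> else exit_law a b \<bind> noisy_step \<kappa>)) t"
      by (simp only: \<Psi>_def)
    also have "\<dots> = real (Suc a) / real (Suc a + b) * \<Psi> (Suc a) (Suc b) + (1 - real (Suc a) / real (Suc a + b)) * \<Psi> a b"
      unfolding pmf_bind using 2 by (simp add: \<Psi>_def del: exit_law.simps of_nat_Suc of_nat_add)
    finally show ?thesis unfolding 1 .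
  qed
  have R: "b \<ge> 1 \<Longrightarrow> (\<Sum>m<N. exit_at \<kappa> t m (a, b)) \<le> \<Psi> a b \<and> \<Psi> a b \<le> (\<Sum>m<N. exit_at \<kappa> t m (a, b)) + no_hit \<kappa> N (a, b)" for N a b
  proof (induction N arbitrary: a b)
    case 0
    then show ?case by (simp add: \<Psi>_def pmf_le_1)
  next
    case (Suc N)
    have eq: "(\<Sum>m<Suc N. exit_at \<kappa> t m (a, b)) = exit_at \<kappa> t 0 (a, b) + (\<Sum>m<N. exit_at \<kappa> t (Suc m) (a, b))"
      by (rule sum.lessThan_Suc_shift)
    show ?case
    proof (cases a)
      case 0
      have "exit_at \<kappa> t 0 (0, b) = measure_pmf.expectation (noisy_step \<kappa> b) (\<lambda>w. if w = t then 1 else 0)"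
        using Suc.prems by (simp add: quad_kernel_def)
      also have "\<dots> = \<Psi> 0 b" by (simp add: expectation_indicator_point \<Psi>0)
      finally show ?thesis unfolding eq using 0 by simp
    next
      case (Suc a')
      define p where "p = real b / real (Suc a' + b)"
      have p1: "real (Suc a') / real (Suc a' + b) = 1 - p" by (simp add: p_def field_simps)
      have p: "0 \<le> p" "p \<le> 1" by (auto simp: p_def)
      have e: "(\<Sum>m<N. exit_at \<kappa> t (Suc m) (a, b)) = (1 - p) * (\<Sum>m<N. exit_at \<kappa> t m (Suc a', Suc b)) + p * (\<Sum>m<N. exit_at \<kappa> t m (a', b))"
      proof -
        have "exit_at \<kappa> t (Suc m) (a, b) = (1 - p) * exit_at \<kappa> t m (Suc a', Suc b) + p * exit_at \<kappa> t m (a', b)" for m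
          unfolding Suc exit_at.simps quad_kernel_expectation p1 p_def[symmetric] by simp
        then show ?thesis by (simp only: sum.distrib sum_distrib_left)
      qed
      have n: "no_hit \<kappa> (Suc N) (a, b) = (1 - p) * no_hit \<kappa> N (Suc a', Suc b) + p * no_hit \<kappa> N (a', b)"
        unfolding Suc no_hit.simps quad_kernel_expectation p1 p_def[symmetric] by simp
      have psi: "\<Psi> a b = (1 - p) * \<Psi> (Suc a') (Suc b) + p * \<Psi> a' b"
        by (simp only: Suc \<Psi>S[of a' b] p1 p_def[symmetric])
      have IH1: "(\<Sum>m<N. exit_at \<kappa> t m (Suc a', Suc b)) \<le> \<Psi> (Suc a') (Suc b)"
          "\<Psi> (Suc a') (Suc b) \<le> (\<Sum>m<N. exit_at \<kappa> t m (Suc a', Suc b)) + no_hit \<kappa> N (Suc a', Suc b)"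
        and IH2: "(\<Sum>m<N. exit_at \<kappa> t m (a', b)) \<le> \<Psi> a' b"
          "\<Psi> a' b \<le> (\<Sum>m<N. exit_at \<kappa> t m (a', b)) + no_hit \<kappa> N (a', b)"
        using Suc.IH Suc.prems by auto
      have "(1 - p) * \<Psi> (Suc a') (Suc b) + p * \<Psi> a' b
        \<le> (1 - p) * ((\<Sum>m<N. exit_at \<kappa> t m (Suc a', Suc b)) + no_hit \<kappa> N (Suc a', Suc b)) + p * ((\<Sum>m<N. exit_at \<kappa> t m (a', b)) + no_hit \<kappa> N (a', b))"
        using p IH1 IH2 by (intro add_mono mult_left_mono) auto
      moreover have "(1 - p) * (\<Sum>m<N. exit_at \<kappa> t m (Suc a', Suc b)) + p * (\<Sum>m<N. exit_at \<kappa> t m (a', b))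
        \<le> (1 - p) * \<Psi> (Suc a') (Suc b) + p * \<Psi> a' b"
        using p IH1 IH2 by (intro add_mono mult_left_mono) auto
      moreover have "exit_at \<kappa> t 0 (a, b) = 0" using Suc by simp
      ultimately show ?thesis unfolding eq e n psi by (simp only: distrib_left) linarith
    qed
  qed
  have "(\<lambda>N. \<Sum>m<N. exit_at \<kappa> t m (a, b)) \<longlonglongrightarrow> \<Psi> a b"
  proof (rule tendsto_sandwich)
    show "(\<lambda>N. \<Psi> a b - no_hit \<kappa> N (a, b)) \<longlonglongrightarrow> \<Psi> a b"
      using tendsto_diff[OF tendsto_const no_hit_tendsto_0[OF assms]] by simp
    show "\<forall>\<^sub>F N in sequentially. \<Psi> a b - no_hit \<kappa> N (a, b) \<le> (\<Sum>m<N. exit_at \<kappa> t m (a, b))"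
      using R[OF assms] by (intro always_eventually allI) (simp add: diff_le_eq)
    show "\<forall>\<^sub>F N in sequentially. (\<Sum>m<N. exit_at \<kappa> t m (a, b)) \<le> \<Psi> a b"
      using R[OF assms] by (intro always_eventually allI) simp
  qed simp
  then show ?thesis by (simp add: sums_def \<Psi>_def)
qed

definition first_hit :: "(nat \<Rightarrow> nat \<times> nat) \<Rightarrow> nat \<Rightarrow> nat \<Rightarrow> bool" where
  "first_hit p m j \<longleftrightarrow> m \<le> j \<and> fst (p j) = 0 \<and> (\<forall>i. m \<le> i \<and> i < j \<longrightarrow> fst (p i) \<noteq> 0)"

text \<open>\<open>block p k n\<close>: the \<open>k\<close>-th traversal of a quadrant by the folded path \<open>p\<close> starts at time \<open>n\<close>.\<close>

primrec block :: "(nat \<Rightarrow> nat \<times> nat) \<Rightarrow> nat \<Rightarrow> nat \<Rightarrow> bool" where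
  "block p 0 n \<longleftrightarrow> n = 0"
| "block p (Suc k) n \<longleftrightarrow> (\<exists>m j. block p k m \<and> first_hit p m j \<and> n = Suc j)"

lemma first_hit_unique: "first_hit p m j \<Longrightarrow> first_hit p m j' \<Longrightarrow> j = j'"
  unfolding first_hit_def by (metis linorder_neqE_nat)

lemma first_hit_cong: "(\<And>i. i \<le> j \<Longrightarrow> p i = q i) \<Longrightarrow> first_hit p m j \<Longrightarrow> first_hit q m j"
  unfolding first_hit_def by auto

lemma block_unique: "block p k n \<Longrightarrow> block p k n' \<Longrightarrow> n = n'"
  by (induction k arbitrary: n n') (auto dest: first_hit_unique)

text \<open>Stopping-time property: the start of a traversal is decided by the states strictly
  before it.\<close>

lemma block_cong: "(\<And>i. i < n \<Longrightarrow> p i = q i) \<Longrightarrow> block p k n \<Longrightarrow> block q k n"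
proof (induction k arbitrary: n)
  case (Suc k)
  then obtain m j where mj: "block p k m" "first_hit p m j" "n = Suc j" by auto
  then have "m \<le> j" by (simp add: first_hit_def)
  then have "block q k m" using Suc.prems mj by (intro Suc.IH[OF _ mj(1)]) auto
  moreover have "first_hit q m j" using Suc.prems mj by (intro first_hit_cong[OF _ mj(2)]) auto
  ultimately show ?case using mj by auto
qed simp

lemma block_le: "block p k n \<Longrightarrow> j \<le> k \<Longrightarrow> \<exists>i\<le>n. block p j i"
proof (induction k arbitrary: n)
  case (Suc k)
  show ?case
  proof (cases "j = Suc k")
    case False
    obtain m i where "block p k m" "first_hit p m i" "n = Suc i" using Suc.prems by auto
    moreover from this obtain i' where "i' \<le> m" "block p j i'" using Suc.IH False Suc.prems by (meson le_SucE)
    ultimately show ?thesis by (auto simp: first_hit_def intro!: exI[of _ i'])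
  qed (use Suc.prems in auto)
qed auto

definition block_size :: "(nat \<Rightarrow> nat \<times> nat) \<Rightarrow> nat \<Rightarrow> nat" where
  "block_size p k = fst (p (THE n. block p k n))"

lemma block_size_eq: "block p k n \<Longrightarrow> block_size p k = fst (p n)"
  unfolding block_size_def by (subst the_equality) (auto dest: block_unique)

text \<open>Almost every folded path has these properties, so the bookkeeping of traversals is done
  path by path.\<close>

definition quad_path :: "int pmf \<Rightarrow> nat \<Rightarrow> (nat \<Rightarrow> nat \<times> nat) \<Rightarrow> bool" where
  "quad_path \<kappa> z0 p \<longleftrightarrow> p 0 = (z0, 1) \<and> (\<forall>n. p (Suc n) \<in> set_pmf (quad_kernel \<kappa> (p n))) \<and> (\<exists>\<^sub>\<infinity>j. fst (p j) = 0)"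

lemma noisy_step_pos: "n \<in> set_pmf (noisy_step \<kappa> b) \<Longrightarrow> n \<ge> 1"
  by (auto simp: noisy_step_def)

lemma quad_path_snd:
  assumes "p 0 = (z0, 1)" "\<forall>n. p (Suc n) \<in> set_pmf (quad_kernel \<kappa> (p n))"
  shows "snd (p n) \<ge> 1"
proof (induction n)
  case (Suc n)
  have "p (Suc n) \<in> set_pmf (quad_kernel \<kappa> (p n))" using assms by blast
  with Suc show ?case by (cases "p n") (auto simp: quad_kernel_def split: if_splits)
qed (simp add: assms)

lemma quad_path_after_hit:
  assumes "quad_path \<kappa> z0 p" "fst (p n) = 0"
  shows "\<exists>z\<ge>1. p (Suc n) = (z, 1)"
proof -
  have "p (Suc n) \<in> set_pmf (quad_kernel \<kappa> (p n))" "snd (p n) \<ge> 1"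
    using assms quad_path_snd[of p z0 \<kappa> n] by (auto simp: quad_path_def)
  with assms(2) show ?thesis by (cases "p n") (auto simp: quad_kernel_def dest: noisy_step_pos)
qed

lemma quad_path_block_state:
  assumes "quad_path \<kappa> z0 p" "z0 \<ge> 1" "block p k n"
  shows "\<exists>z\<ge>1. p n = (z, 1)"
proof (cases k)
  case 0
  then show ?thesis using assms by (auto simp: quad_path_def)
next
  case (Suc k')
  then obtain m j where "first_hit p m j" "n = Suc j" using assms by auto
  then show ?thesis using quad_path_after_hit[OF assms(1), of j] by (auto simp: first_hit_def)
qed

lemma quad_path_first_hit:
  assumes "quad_path \<kappa> z0 p"
  obtains j where "first_hit p m j"
proof -
  have "\<exists>j\<ge>m. fst (p j) = 0" using assms by (auto simp: quad_path_def INFM_nat_le)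
  define j where "j = (LEAST j. m \<le> j \<and> fst (p j) = 0)"
  have "m \<le> j \<and> fst (p j) = 0"
    unfolding j_def using \<open>\<exists>j\<ge>m. fst (p j) = 0\<close> LeastI_ex[of "\<lambda>j. m \<le> j \<and> fst (p j) = 0"] by blast
  moreover have "\<not> (m \<le> i \<and> fst (p i) = 0)" if "i < j" for i
    using not_less_Least that unfolding j_def by blast
  ultimately show thesis by (intro that[of j]) (auto simp: first_hit_def)
qed

lemma quad_path_block:
  assumes "quad_path \<kappa> z0 p"
  shows "\<exists>n. block p k n"
proof (induction k)
  case (Suc k)
  then obtain m where "block p k m" by blast
  moreover obtain j where "first_hit p m j" by (rule quad_path_first_hit[OF assms])
  ultimately show ?case by auto
qed simp

locale quad_chain = mchain M "quad_kernel \<kappa>" "(z0, 1)" X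
  for M :: "'a measure" and \<kappa> :: "int pmf" and z0 :: nat and X :: "nat \<Rightarrow> 'a \<Rightarrow> nat \<times> nat" +
  assumes z0: "z0 \<ge> 1"
begin

lemma pr_no_hit:
  assumes "depends_upto n Q"
  shows "pr (\<lambda>p. Q p \<and> p n = s \<and> (\<forall>i. n \<le> i \<and> i < n + m \<longrightarrow> fst (p i) \<noteq> 0)) = pr (\<lambda>p. Q p \<and> p n = s) * ennreal (no_hit \<kappa> m s)"
  using assms
proof (induction m arbitrary: n Q s)
  case 0
  have "(\<lambda>p. Q p \<and> p n = s \<and> (\<forall>i. n \<le> i \<and> i < n + 0 \<longrightarrow> fst (p i) \<noteq> 0)) = (\<lambda>p. Q p \<and> p n = s)"
    by (auto simp: fun_eq_iff)
  then show ?case by (simp only:) simp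
next
  case (Suc m)
  define G where "G p \<longleftrightarrow> (\<forall>i. Suc n \<le> i \<and> i < Suc n + m \<longrightarrow> fst (p i) \<noteq> 0)" for p :: "nat \<Rightarrow> nat \<times> nat"
  have eq: "(p n = s \<and> (\<forall>i. n \<le> i \<and> i < n + Suc m \<longrightarrow> fst (p i) \<noteq> 0)) \<longleftrightarrow> (fst s \<noteq> 0 \<and> p n = s \<and> G p)"
    for p :: "nat \<Rightarrow> nat \<times> nat"
    unfolding G_def by (auto simp: Suc_le_eq) (metis le_neq_implies_less)
  show ?case
  proof (cases "fst s = 0")
    case True
    then show ?thesis unfolding eq by (simp add: pr_def)
  next
    case False
    have "pr (\<lambda>p. Q p \<and> p n = s \<and> G p) = pr (\<lambda>p. Q p \<and> p n = s) *
        ennreal (measure_pmf.expectation (quad_kernel \<kappa> s) (no_hit \<kappa> m))"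
    proof (rule pr_future[OF Suc.prems, where B=1])
      show "{\<omega> \<in> space M. G (\<lambda>i. X i \<omega>)} \<in> sets M"
        by (rule depends_measurable[of "Suc n + m"]) (auto simp: depends_upto_def G_def)
      fix Q' :: "(nat \<Rightarrow> nat \<times> nat) \<Rightarrow> bool" and t assume Q': "depends_upto (Suc n) Q'"
      show "pr (\<lambda>p. Q' p \<and> p (Suc n) = t \<and> G p) = pr (\<lambda>p. Q' p \<and> p (Suc n) = t) * ennreal (no_hit \<kappa> m t)"
        using Suc.IH[OF Q', of t] by (simp only: G_def)
    qed (auto simp: no_hit_bounds)
    then show ?thesis unfolding eq using False by simp
  qed
qed

lemma pr_exit_at:
  assumes "depends_upto n Q"
  shows "pr (\<lambda>p. Q p \<and> p n = s \<and> first_hit p n (n + m) \<and> fst (p (Suc (n + m))) = t)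
    = pr (\<lambda>p. Q p \<and> p n = s) * ennreal (exit_at \<kappa> t m s)"
  using assms
proof (induction m arbitrary: n Q s)
  case 0
  define G where "G p \<longleftrightarrow> fst (p (Suc n)) = t" for p :: "nat \<Rightarrow> nat \<times> nat"
  have eq: "(p n = s \<and> first_hit p n (n + 0) \<and> fst (p (Suc (n + 0))) = t) \<longleftrightarrow> (fst s = 0 \<and> p n = s \<and> G p)" for p
    unfolding G_def by (auto simp: first_hit_def)
  show ?case
  proof (cases "fst s = 0")
    case False
    then show ?thesis unfolding eq by (simp add: pr_def)
  next
    case True
    have "pr (\<lambda>p. Q p \<and> p n = s \<and> G p) = pr (\<lambda>p. Q p \<and> p n = s) *
        ennreal (measure_pmf.expectation (quad_kernel \<kappa> s) (\<lambda>w. if fst w = t then 1 else 0))"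
    proof (rule pr_future[OF 0, where B=1])
      show "{\<omega> \<in> space M. G (\<lambda>i. X i \<omega>)} \<in> sets M"
        by (rule depends_measurable[of "Suc n"]) (auto simp: depends_upto_def G_def)
      fix Q' :: "(nat \<Rightarrow> nat \<times> nat) \<Rightarrow> bool" and w
      show "pr (\<lambda>p. Q' p \<and> p (Suc n) = w \<and> G p) = pr (\<lambda>p. Q' p \<and> p (Suc n) = w) * ennreal (if fst w = t then 1 else 0)"
      proof (cases "fst w = t")
        case True
        then have "(\<lambda>p. Q' p \<and> p (Suc n) = w \<and> G p) = (\<lambda>p. Q' p \<and> p (Suc n) = w)" by (auto simp: G_def)
        then show ?thesis using True by simp
      next
        case False
        then have "(\<lambda>p. Q' p \<and> p (Suc n) = w \<and> G p) = (\<lambda>_. False)" by (auto simp: G_def)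
        then show ?thesis using False by (simp add: pr_def)
      qed
    qed auto
    then show ?thesis unfolding eq using True by simp
  qed
next
  case (Suc m)
  define G where "G p \<longleftrightarrow> first_hit p (Suc n) (Suc n + m) \<and> fst (p (Suc (Suc n + m))) = t" for p :: "nat \<Rightarrow> nat \<times> nat"
  have eq: "(p n = s \<and> first_hit p n (n + Suc m) \<and> fst (p (Suc (n + Suc m))) = t) \<longleftrightarrow> (fst s \<noteq> 0 \<and> p n = s \<and> G p)" for p
    unfolding G_def first_hit_def by (auto simp: Suc_le_eq) (metis le_neq_implies_less)
  show ?case
  proof (cases "fst s = 0")
    case True
    then show ?thesis unfolding eq by (simp add: pr_def)
  next
    case False
    have "pr (\<lambda>p. Q p \<and> p n = s \<and> G p) = pr (\<lambda>p. Q p \<and> p n = s) *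
        ennreal (measure_pmf.expectation (quad_kernel \<kappa> s) (exit_at \<kappa> t m))"
    proof (rule pr_future[OF Suc.prems, where B=1])
      show "{\<omega> \<in> space M. G (\<lambda>i. X i \<omega>)} \<in> sets M"
        by (rule depends_measurable[of "Suc (Suc n + m)"]) (auto simp: depends_upto_def G_def first_hit_def)
      fix Q' :: "(nat \<Rightarrow> nat \<times> nat) \<Rightarrow> bool" and w assume Q': "depends_upto (Suc n) Q'"
      show "pr (\<lambda>p. Q' p \<and> p (Suc n) = w \<and> G p) = pr (\<lambda>p. Q' p \<and> p (Suc n) = w) * ennreal (exit_at \<kappa> t m w)"
        using Suc.IH[OF Q', of w] by (simp only: G_def)
    qed (auto simp: exit_at_bounds)
    then show ?thesis unfolding eq using False by simp
  qed
qed

text \<open>The limit of \<open>no_hit\<close> is available from second coordinate at least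
  \<open>1\<close>. The null sets are formed for such states, and \<open>quad_path_snd\<close> keeps
  the path among them.\<close>

lemma AE_quad_path: "AE \<omega> in M. quad_path \<kappa> z0 (\<lambda>i. X i \<omega>)"
proof -
  have "AE \<omega> in M. \<forall>n s. snd s \<ge> 1 \<longrightarrow> \<not> (X n \<omega> = s \<and> (\<forall>i\<ge>n. fst (X i \<omega>) \<noteq> 0))"
    unfolding AE_all_countable
  proof (intro allI)
    fix n :: nat and s :: "nat \<times> nat"
    show "AE \<omega> in M. snd s \<ge> 1 \<longrightarrow> \<not> (X n \<omega> = s \<and> (\<forall>i\<ge>n. fst (X i \<omega>) \<noteq> 0))"
    proof (cases "snd s \<ge> 1")
      case True
      let ?A = "{\<omega> \<in> space M. X n \<omega> = s \<and> (\<forall>i\<ge>n. fst (X i \<omega>) \<noteq> 0)}"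
      have "emeasure M ?A \<le> ennreal (no_hit \<kappa> m s)" for m
      proof -
        have "emeasure M ?A \<le> pr (\<lambda>p. True \<and> p n = s \<and> (\<forall>i. n \<le> i \<and> i < n + m \<longrightarrow> fst (p i) \<noteq> 0))"
          unfolding pr_def by (intro emeasure_mono) auto
        also have "\<dots> = pr (\<lambda>p. True \<and> p n = s) * ennreal (no_hit \<kappa> m s)"
          by (rule pr_no_hit) (simp add: depends_upto_def)
        also have "\<dots> \<le> 1 * ennreal (no_hit \<kappa> m s)" by (intro mult_right_mono pr_le_1) auto
        finally show ?thesis by simp
      qed
      moreover have "(\<lambda>m. ennreal (no_hit \<kappa> m s)) \<longlonglongrightarrow> ennreal 0"
        using no_hit_tendsto_0[OF True, of \<kappa> "fst s"] by (intro tendsto_ennrealI) simp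
      ultimately have "emeasure M ?A \<le> ennreal 0" by (intro LIMSEQ_le_const) auto
      then show ?thesis by (intro AE_I[of _ _ ?A]) auto
    qed simp
  qed
  with S_0 AE_path show ?thesis
  proof eventually_elim
    case (elim \<omega>)
    have "snd (X n \<omega>) \<ge> 1" for n
      using quad_path_snd[of "\<lambda>i. X i \<omega>" z0 \<kappa> n] elim by auto
    then have "\<not> (X n \<omega> = X n \<omega> \<and> (\<forall>i\<ge>n. fst (X i \<omega>) \<noteq> 0))" for n
      using elim(3) by (elim allE[of _ n] allE[of _ "X n \<omega>"] impE) auto
    then have "\<exists>i\<ge>n. fst (X i \<omega>) = 0" for n by simp
    with elim show ?case by (auto simp: quad_path_def INFM_nat_le)
  qed
qed

text \<open>The duration \<open>m\<close> of the traversal is summed out. The starting time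
  \<open>n\<close> is deterministic here; \<open>block_chain\<close> takes care of its
  randomness.\<close>

lemma pr_next_block:
  assumes Q: "depends_upto n Q" and "b \<ge> 1"
  shows "pr (\<lambda>p. Q p \<and> p n = (a, b) \<and> (\<exists>m. first_hit p n (n + m) \<and> fst (p (Suc (n + m))) = t))
    = pr (\<lambda>p. Q p \<and> p n = (a, b)) * ennreal (pmf (exit_law a b \<bind> noisy_step \<kappa>) t)"
proof -
  define B where "B m = {\<omega> \<in> space M. Q (\<lambda>i. X i \<omega>) \<and> X n \<omega> = (a, b) \<and> first_hit (\<lambda>i. X i \<omega>) n (n + m) \<and> fst (X (Suc (n + m)) \<omega>) = t}" for m
  have B: "B m \<in> sets M" for m
  proof -
    have "depends_upto (Suc (n + m)) (\<lambda>p. Q p \<and> p n = (a, b) \<and> first_hit p n (n + m) \<and> fst (p (Suc (n + m))) = t)"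
    proof (rule depends_uptoI)
      fix p q assume *: "\<And>i. i \<le> Suc (n + m) \<Longrightarrow> p i = q i"
        "Q p \<and> p n = (a, b) \<and> first_hit p n (n + m) \<and> fst (p (Suc (n + m))) = t"
      have "Q q" using depends_uptoD[OF Q, of p q] * by simp
      moreover have "first_hit q n (n + m)" by (rule first_hit_cong[of _ p]) (use * in auto)
      ultimately show "Q q \<and> q n = (a, b) \<and> first_hit q n (n + m) \<and> fst (q (Suc (n + m))) = t"
        using *(1)[of n] *(1)[of "Suc (n + m)"] *(2) by simp
    qed
    from depends_measurable[OF this] show ?thesis by (simp only: B_def)
  qed
  have "disjoint_family B"
    unfolding disjoint_family_on_def
  proof (intro ballI impI)
    fix m m' :: nat assume "m \<noteq> m'"
    have False if "\<omega> \<in> B m" "\<omega> \<in> B m'" for \<omega>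
      using that first_hit_unique[of "\<lambda>i. X i \<omega>" n "n + m" "n + m'"] \<open>m \<noteq> m'\<close> by (simp add: B_def)
    then show "B m \<inter> B m' = {}" by blast
  qed
  then have "(\<Sum>m. emeasure M (B m)) = emeasure M (\<Union>m. B m)"
    using B by (intro suminf_emeasure) auto
  also have "(\<Union>m. B m) = {\<omega> \<in> space M. Q (\<lambda>i. X i \<omega>) \<and> X n \<omega> = (a, b) \<and>
      (\<exists>m. first_hit (\<lambda>i. X i \<omega>) n (n + m) \<and> fst (X (Suc (n + m)) \<omega>) = t)}" by (auto simp: B_def)
  finally have "pr (\<lambda>p. Q p \<and> p n = (a, b) \<and> (\<exists>m. first_hit p n (n + m) \<and> fst (p (Suc (n + m))) = t))
     = (\<Sum>m. emeasure M (B m))" by (simp add: pr_def)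
  also have "\<dots> = (\<Sum>m. pr (\<lambda>p. Q p \<and> p n = (a, b)) * ennreal (exit_at \<kappa> t m (a, b)))"
    using pr_exit_at[OF Q] by (simp add: B_def pr_def)
  also have "\<dots> = pr (\<lambda>p. Q p \<and> p n = (a, b)) * (\<Sum>m. ennreal (exit_at \<kappa> t m (a, b)))"
    by (rule ennreal_suminf_cmult)
  also have "(\<Sum>m. ennreal (exit_at \<kappa> t m (a, b))) = ennreal (pmf (exit_law a b \<bind> noisy_step \<kappa>) t)"
    using exit_at_sums[OF \<open>b \<ge> 1\<close>, of \<kappa> t a] by (subst suminf_ennreal2) (auto simp: exit_at_bounds sums_iff)
  finally show ?thesis .
qed

text \<open>Strong Markov property at the random start of the \<open>k\<close>-th traversal, by
  decomposing over its value \<open>n\<close>. \<open>E n\<close> fixes the start and the sizes so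
  far, depends on the path up to \<open>n\<close> only, and puts the state at
  \<open>(s k, 1)\<close>: a traversal remembers nothing but its size.\<close>

lemma block_chain:
  assumes Zm: "\<And>k. Z k \<in> measurable M (count_space UNIV)"
    and Z: "AE \<omega> in M. \<forall>k. Z k \<omega> = block_size (\<lambda>i. X i \<omega>) k"
  shows "mchain M (urn_chain \<kappa>) z0 Z"
proof (intro mchain.intro mchain_axioms.intro markov_chainI)
  show "prob_space M" "prob_space M" by unfold_locales
  show "Z n \<in> measurable M (count_space UNIV)" for n by (rule Zm)
  note [measurable] = Zm
  have good: "AE \<omega> in M. quad_path \<kappa> z0 (\<lambda>i. X i \<omega>) \<and> (\<forall>k. Z k \<omega> = block_size (\<lambda>i. X i \<omega>) k)"
    using AE_quad_path Z by eventually_elim simp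
  show "AE \<omega> in M. Z 0 \<omega> = z0"
    using good by eventually_elim (auto simp: quad_path_def block_size_eq[of _ 0 0])
  fix k :: nat and s :: "nat \<Rightarrow> nat" and t :: nat
  define E where "E n p \<longleftrightarrow> block p k n \<and> (\<forall>j\<le>k. \<exists>i\<le>n. block p j i \<and> fst (p i) = s j) \<and> p n = (s k, 1)" for n p
  define G where "G n p \<longleftrightarrow> (\<exists>m. first_hit p n (n + m) \<and> fst (p (Suc (n + m))) = t)" for n p
  have E: "depends_upto n (E n)" for n
  proof (rule depends_uptoI)
    fix p q :: "nat \<Rightarrow> nat \<times> nat" assume *: "\<And>i. i \<le> n \<Longrightarrow> p i = q i" "E n p"
    have "block q j i" if "block p j i" "i \<le> n" for i j
      by (rule block_cong[OF _ that(1)]) (use * that in auto)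
    with * show "E n q" unfolding E_def by (metis order_refl)
  qed
  have Em: "{\<omega> \<in> space M. E n (\<lambda>i. X i \<omega>)} \<in> sets M" for n by (rule depends_measurable[OF E])
  have Gm: "{\<omega> \<in> space M. G n (\<lambda>i. X i \<omega>)} \<in> sets M" for n
  proof -
    have "{\<omega> \<in> space M. first_hit (\<lambda>i. X i \<omega>) n (n + m) \<and> fst (X (Suc (n + m)) \<omega>) = t} \<in> sets M" for m
      by (rule depends_measurable[of "Suc (n + m)"]) (auto simp: depends_upto_def first_hit_def)
    then have "(\<Union>m. {\<omega> \<in> space M. first_hit (\<lambda>i. X i \<omega>) n (n + m) \<and> fst (X (Suc (n + m)) \<omega>) = t}) \<in> sets M"
      by blast
    also have "(\<Union>m. {\<omega> \<in> space M. first_hit (\<lambda>i. X i \<omega>) n (n + m) \<and> fst (X (Suc (n + m)) \<omega>) = t})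
      = {\<omega> \<in> space M. G n (\<lambda>i. X i \<omega>)}" by (auto simp: G_def)
    finally show ?thesis .
  qed
  have E_iff: "(\<forall>i\<le>k. block_size p i = s i) \<longleftrightarrow> E n p" if qp: "quad_path \<kappa> z0 p" and bl: "block p k n" for p n
  proof
    assume *: "\<forall>i\<le>k. block_size p i = s i"
    have "\<exists>i\<le>n. block p j i \<and> fst (p i) = s j" if "j \<le> k" for j
      using block_le[OF bl that] * that block_size_eq by metis
    moreover obtain z where "p n = (z, 1)" using quad_path_block_state[OF qp z0 bl] by blast
    moreover have "fst (p n) = s k" using * block_size_eq[OF bl] by auto
    ultimately show "E n p" using bl by (auto simp: E_def)
  next
    assume "E n p"
    then show "\<forall>i\<le>k. block_size p i = s i" unfolding E_def using block_size_eq by metis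
  qed
  have G_iff: "block_size p (Suc k) = t \<longleftrightarrow> G n p" if qp: "quad_path \<kappa> z0 p" and bl: "block p k n" for p n
  proof -
    obtain j where j: "first_hit p n j" by (rule quad_path_first_hit[OF qp])
    then have "block p (Suc k) (Suc j)" using bl by auto
    then have "block_size p (Suc k) = fst (p (Suc j))" by (rule block_size_eq)
    moreover have "G n p \<longleftrightarrow> fst (p (Suc j)) = t"
      unfolding G_def using j by (metis first_hit_def first_hit_unique le_add_diff_inverse)
    ultimately show ?thesis by simp
  qed
  \<comment> \<open>Applied to \<open>Z (Suc k) \<omega> = t\<close> and to the sure event, so that
    the transition probability can be taken out of the sum.\<close>
  have sum: "emeasure M {\<omega> \<in> space M. (\<forall>i\<le>k. Z i \<omega> = s i) \<and> R \<omega>} = (\<Sum>n. pr (\<lambda>p. E n p \<and> H n p))"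
    if [measurable]: "Measurable.pred M R" and H: "\<And>n. {\<omega> \<in> space M. H n (\<lambda>i. X i \<omega>)} \<in> sets M"
      and RH: "\<And>\<omega> n. quad_path \<kappa> z0 (\<lambda>i. X i \<omega>) \<Longrightarrow> (\<forall>k. Z k \<omega> = block_size (\<lambda>i. X i \<omega>) k) \<Longrightarrow>
        block (\<lambda>i. X i \<omega>) k n \<Longrightarrow> R \<omega> = H n (\<lambda>i. X i \<omega>)" for R H
  proof -
    define B where "B n = {\<omega> \<in> space M. E n (\<lambda>i. X i \<omega>) \<and> H n (\<lambda>i. X i \<omega>)}" for n
    have Bm: "B n \<in> sets M" for n
    proof -
      have "B n = {\<omega> \<in> space M. E n (\<lambda>i. X i \<omega>)} \<inter> {\<omega> \<in> space M. H n (\<lambda>i. X i \<omega>)}" by (auto simp: B_def)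
      then show ?thesis using Em[of n] H[of n] by simp
    qed
    have dj: "disjoint_family B"
      unfolding disjoint_family_on_def
    proof (intro ballI impI)
      fix m m' :: nat assume "m \<noteq> m'"
      have False if "\<omega> \<in> B m" "\<omega> \<in> B m'" for \<omega>
        using that block_unique[of "\<lambda>i. X i \<omega>" k m m'] \<open>m \<noteq> m'\<close> by (simp add: B_def E_def)
      then show "B m \<inter> B m' = {}" by blast
    qed
    have "emeasure M {\<omega> \<in> space M. (\<forall>i\<le>k. Z i \<omega> = s i) \<and> R \<omega>} = emeasure M (\<Union>n. B n)"
    proof (rule emeasure_eq_AE)
      show "AE \<omega> in M. \<omega> \<in> {\<omega> \<in> space M. (\<forall>i\<le>k. Z i \<omega> = s i) \<and> R \<omega>} \<longleftrightarrow> \<omega> \<in> (\<Union>n. B n)"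
        using good
      proof (rule AE_mp, intro AE_I2 impI)
        fix \<omega> assume \<omega>: "\<omega> \<in> space M" "quad_path \<kappa> z0 (\<lambda>i. X i \<omega>) \<and> (\<forall>k. Z k \<omega> = block_size (\<lambda>i. X i \<omega>) k)"
        obtain n where n: "block (\<lambda>i. X i \<omega>) k n" using quad_path_block[of \<kappa> z0 "\<lambda>i. X i \<omega>"] \<omega> by blast
        have "((\<forall>i\<le>k. Z i \<omega> = s i) \<and> R \<omega>) \<longleftrightarrow> (E n (\<lambda>i. X i \<omega>) \<and> H n (\<lambda>i. X i \<omega>))"
          using E_iff[of "\<lambda>i. X i \<omega>" n] RH[of \<omega> n] \<omega>(2) n by auto
        moreover have "(\<exists>n'. E n' (\<lambda>i. X i \<omega>) \<and> H n' (\<lambda>i. X i \<omega>)) \<longleftrightarrow> (E n (\<lambda>i. X i \<omega>) \<and> H n (\<lambda>i. X i \<omega>))"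
          using n block_unique unfolding E_def by metis
        ultimately show "\<omega> \<in> {\<omega> \<in> space M. (\<forall>i\<le>k. Z i \<omega> = s i) \<and> R \<omega>} \<longleftrightarrow> \<omega> \<in> (\<Union>n. B n)"
          using \<omega>(1) by (auto simp: B_def)
      qed
      show "{\<omega> \<in> space M. (\<forall>i\<le>k. Z i \<omega> = s i) \<and> R \<omega>} \<in> sets M" by measurable
      show "(\<Union>n. B n) \<in> sets M" using Bm by (intro sets.countable_UN) auto
    qed
    also have "\<dots> = (\<Sum>n. emeasure M (B n))" using Bm dj by (intro suminf_emeasure[symmetric]) auto
    finally show ?thesis by (simp add: B_def pr_def)
  qed
  \<comment> \<open>Traversal sizes are almost surely at least \<open>1\<close>. For
    \<open>s k = 0\<close> both sides of the Markov property vanish, whatever the artificial kernel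
    at \<open>0\<close>.\<close>
  have zero: "pr (E n) = 0" if sk: "s k = 0" for n
  proof -
    have "AE \<omega> in M. \<not> E n (\<lambda>i. X i \<omega>)"
      using AE_quad_path
    proof eventually_elim
      case (elim \<omega>)
      show ?case
      proof
        assume *: "E n (\<lambda>i. X i \<omega>)"
        then obtain z where "z \<ge> 1" "X n \<omega> = (z, 1)"
          using quad_path_block_state[OF elim z0, of k n] by (auto simp: E_def)
        with * sk show False by (simp add: E_def)
      qed
    qed
    then show ?thesis unfolding pr_def using Em[of n] by (subst (asm) AE_iff_measurable) auto
  qed
  have step: "pr (\<lambda>p. E n p \<and> G n p) = pr (\<lambda>p. E n p \<and> True) * ennreal (pmf (urn_chain \<kappa> (s k)) t)" for n
  proof (cases "s k = 0")
    case True
    have "pr (\<lambda>p. E n p \<and> G n p) \<le> pr (E n)"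
      unfolding pr_def using Em[of n] by (intro emeasure_mono) auto
    then show ?thesis using zero[OF True, of n] by simp
  next
    case False
    have "(\<lambda>p. E n p \<and> G n p) = (\<lambda>p. E n p \<and> p n = (s k, 1) \<and> G n p)" "(\<lambda>p. E n p \<and> True) = (\<lambda>p. E n p \<and> p n = (s k, 1))"
      by (auto simp: E_def fun_eq_iff)
    moreover have "urn_chain \<kappa> (s k) = exit_law (s k) 1 \<bind> noisy_step \<kappa>"
      using False by (simp add: urn_chain_def max_def)
    moreover have "pr (\<lambda>p. E n p \<and> p n = (s k, 1) \<and> G n p)
        = pr (\<lambda>p. E n p \<and> p n = (s k, 1)) * ennreal (pmf (exit_law (s k) 1 \<bind> noisy_step \<kappa>) t)"
      unfolding G_def by (rule pr_next_block[OF E]) simp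
    ultimately show ?thesis by (simp only:)
  qed
  have "emeasure M {\<omega> \<in> space M. (\<forall>i\<le>k. Z i \<omega> = s i) \<and> Z (Suc k) \<omega> = t} = (\<Sum>n. pr (\<lambda>p. E n p \<and> G n p))"
    by (rule sum) (use Gm G_iff in auto)
  also have "\<dots> = (\<Sum>n. pr (\<lambda>p. E n p \<and> True)) * ennreal (pmf (urn_chain \<kappa> (s k)) t)"
    unfolding step by (rule ennreal_suminf_multc)
  also have "(\<Sum>n. pr (\<lambda>p. E n p \<and> True)) = emeasure M {\<omega> \<in> space M. (\<forall>i\<le>k. Z i \<omega> = s i) \<and> True}"
    by (rule sum[symmetric]) auto
  finally show "emeasure M {\<omega> \<in> space M. (\<forall>i\<le>k. Z i \<omega> = s i) \<and> Z (Suc k) \<omega> = t}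
    = emeasure M {\<omega> \<in> space M. \<forall>i\<le>k. Z i \<omega> = s i} * ennreal (pmf (urn_chain \<kappa> (s k)) t)" by simp
qed

end

section \<open>The noisy simple harmonic urn\<close>

lemma fst_quad_eq_0_iff: "fst (quad s) = 0 \<longleftrightarrow> fst s * snd s = 0"
  by (cases s) (auto simp: quad_def)

lemma quad_eq_size: "quad s = (z, 1) \<Longrightarrow> z \<ge> 1 \<Longrightarrow> max \<bar>fst s\<bar> \<bar>snd s\<bar> = int z"
  by (cases s) (auto simp: quad_def split: if_splits)

text \<open>A traversal starts one step after the axis visit that ends the previous one, and
  \<open>urn_nu q 0 = -1\<close> makes time \<open>0\<close> the initial start. As the axes are hit
  again and again along the path, \<open>LEAST\<close> returns a genuine hitting time.\<close>

lemma block_urn_nu: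
  assumes "quad_path \<kappa> z0 (\<lambda>i. quad (q i))"
  shows "urn_nu q k \<ge> -1 \<and> block (\<lambda>i. quad (q i)) k (nat (1 + urn_nu q k))"
proof (induction k)
  case (Suc k)
  define m where "m = nat (1 + urn_nu q k)"
  have m: "int m = 1 + urn_nu q k" and bl: "block (\<lambda>i. quad (q i)) k m" using Suc by (auto simp: m_def)
  obtain j where j: "first_hit (\<lambda>i. quad (q i)) m j" by (rule quad_path_first_hit[OF assms])
  have "(LEAST n. int n > urn_nu q k \<and> fst (q n) * snd (q n) = 0) = j"
  proof (rule Least_equality)
    show "int j > urn_nu q k \<and> fst (q j) * snd (q j) = 0"
      using j m by (auto simp: first_hit_def fst_quad_eq_0_iff)
    fix i assume i: "int i > urn_nu q k \<and> fst (q i) * snd (q i) = 0"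
    then have "m \<le> i" "fst (quad (q i)) = 0" using m by (auto simp: fst_quad_eq_0_iff)
    then show "j \<le> i" using j unfolding first_hit_def by (meson not_le)
  qed
  then have nu: "urn_nu q (Suc k) = int j" by simp
  have "nat (1 + int j) = Suc j" by simp
  then show ?case unfolding nu using bl j by auto
qed simp

lemma urn_Z_eq_block_size:
  assumes "quad_path \<kappa> z0 (\<lambda>i. quad (q i))" "z0 \<ge> 1"
  shows "urn_Z q k = block_size (\<lambda>i. quad (q i)) k"
proof -
  define n where "n = nat (1 + urn_nu q k)"
  have bl: "block (\<lambda>i. quad (q i)) k n" using block_urn_nu[OF assms(1)] by (simp add: n_def)
  obtain z where z: "z \<ge> 1" "quad (q n) = (z, 1)"
    using quad_path_block_state[OF assms bl] by blast
  have "urn_Z q k = nat (max \<bar>fst (q n)\<bar> \<bar>snd (q n)\<bar>)" by (simp add: urn_Z_def n_def Let_def)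
  also have "\<dots> = z" using quad_eq_size[OF z(2,1)] by simp
  also have "\<dots> = block_size (\<lambda>i. quad (q i)) k" using block_size_eq[OF bl] z by simp
  finally show ?thesis .
qed

lemma embedded_process_measurable:
  assumes S: "\<And>n. S n \<in> measurable M (count_space UNIV)"
  shows "embedded_process S k \<in> measurable M (count_space UNIV)"
proof -
  have nu: "(\<lambda>\<omega>. urn_nu (\<lambda>n. S n \<omega>) k) \<in> measurable M (count_space UNIV)"
  proof (induction k)
    case (Suc k)
    have "Measurable.pred M (\<lambda>\<omega>. int n > urn_nu (\<lambda>n. S n \<omega>) k \<and> fst (S n \<omega>) * snd (S n \<omega>) = 0)" for n
    proof (rule pred_intros_logic)
      show "Measurable.pred M (\<lambda>\<omega>. int n > urn_nu (\<lambda>n. S n \<omega>) k)"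
        by (rule measurable_compose[OF Suc]) simp
      show "Measurable.pred M (\<lambda>\<omega>. fst (S n \<omega>) * snd (S n \<omega>) = 0)"
        by (rule measurable_compose[OF S]) simp
    qed
    then have "(\<lambda>\<omega>. LEAST n. int n > urn_nu (\<lambda>n. S n \<omega>) k \<and> fst (S n \<omega>) * snd (S n \<omega>) = 0) \<in> measurable M (count_space UNIV)"
      by (rule measurable_Least)
    from measurable_compose[OF this, of int "count_space UNIV"] show ?case by simp
  qed simp
  have "(\<lambda>\<omega>. (\<lambda>m \<omega>. nat (max \<bar>fst (S (nat (1 + m)) \<omega>)\<bar> \<bar>snd (S (nat (1 + m)) \<omega>)\<bar>)) (urn_nu (\<lambda>n. S n \<omega>) k) \<omega>)
     \<in> measurable M (count_space UNIV)"
  proof (rule measurable_compose_countable[OF _ nu])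
    show "(\<lambda>\<omega>. nat (max \<bar>fst (S (nat (1 + m)) \<omega>)\<bar> \<bar>snd (S (nat (1 + m)) \<omega>)\<bar>)) \<in> measurable M (count_space UNIV)" for m
      by (rule measurable_compose[OF S]) simp
  qed
  then show ?thesis unfolding embedded_process_def[abs_def] urn_Z_def Let_def .
qed

lemma embedded_process_chain:
  assumes urn: "noisy_urn M \<kappa> z0 S" and z0: "z0 \<ge> 1"
  shows "mchain M (urn_chain \<kappa>) z0 (embedded_process S)"
proof -
  have mc: "markov_chain M (urn_kernel \<kappa>) (int z0, 1) S" using urn by (simp add: noisy_urn_def)
  then interpret S: mchain M "urn_kernel \<kappa>" "(int z0, 1)" S
    by (intro mchain.intro mchain_axioms.intro) (auto simp: markov_chain_def)
  have "quad (int z0, 1) = (z0, 1)" using z0 by (simp add: quad_def)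
  then have "mchain M (quad_kernel \<kappa>) (z0, 1) (\<lambda>n \<omega>. quad (S n \<omega>))"
    using S.lump[of quad "quad_kernel \<kappa>"] map_quad_urn_kernel by simp
  then interpret X: quad_chain M \<kappa> z0 "\<lambda>n \<omega>. quad (S n \<omega>)"
    using z0 by (intro quad_chain.intro quad_chain_axioms.intro)
  show ?thesis
  proof (rule X.block_chain)
    show "embedded_process S k \<in> measurable M (count_space UNIV)" for k
      by (rule embedded_process_measurable) (rule S.S_measurable)
    show "AE \<omega> in M. \<forall>k. embedded_process S k \<omega> = block_size (\<lambda>i. quad (S i \<omega>)) k"
      using X.AE_quad_path
      by eventually_elim (auto simp: embedded_process_def intro: urn_Z_eq_block_size[OF _ z0])
  qed
qed

section \<open>The three regimes\<close>

lemma urn_chain_0: "urn_chain \<kappa> 0 = urn_chain \<kappa> 1"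
  by (simp add: urn_chain_def)

lemma set_exit_law_max: "set_pmf (exit_law (max 1 z) 1) = {1..}"
proof -
  obtain a where a: "max 1 z = Suc a" by (cases "max 1 z") auto
  show ?thesis unfolding a by (rule set_exit_law) simp
qed

text \<open>The exit point has unbounded support, so it can outweigh any fixed value of the
  noise.\<close>

lemma urn_chain_unbounded: "\<exists>n\<ge>N. n \<in> set_pmf (urn_chain \<kappa> z)"
proof -
  obtain k where k: "k \<in> set_pmf \<kappa>" using set_pmf_not_empty by fast
  define y where "y = nat (int N + \<bar>k\<bar> + 1)"
  have "y \<in> set_pmf (exit_law (max 1 z) 1)" unfolding set_exit_law_max by (simp add: y_def)
  then have "nat (max 1 (int y - k)) \<in> set_pmf (urn_chain \<kappa> z)"
    using k unfolding urn_chain_def noisy_step_def by (auto simp del: exit_law.simps)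
  moreover have "nat (max 1 (int y - k)) \<ge> N" by (auto simp: y_def)
  ultimately show ?thesis by blast
qed

text \<open>Some noise value \<open>k \<ge> 1\<close> has positive probability, the exit point can
  be \<open>1\<close>, and truncation turns \<open>1 - k\<close> into \<open>1\<close>.\<close>

lemma pmf_urn_chain_1_pos:
  assumes "measure_pmf.expectation \<kappa> real_of_int > 0"
  shows "pmf (urn_chain \<kappa> z) 1 > 0"
proof -
  obtain k where k: "k \<in> set_pmf \<kappa>" "k \<ge> 1"
  proof (rule ccontr)
    assume "\<not> thesis"
    then have "\<forall>k\<in>set_pmf \<kappa>. k \<le> 0" using that by force
    then have "AE k in \<kappa>. 0 \<le> - real_of_int k" by (auto simp: AE_measure_pmf_iff)
    then have "0 \<le> measure_pmf.expectation \<kappa> (\<lambda>k. - real_of_int k)" by (rule integral_nonneg_AE)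
    with assms show False by simp
  qed
  have "1 \<in> set_pmf (exit_law (max 1 z) 1)" unfolding set_exit_law_max by simp
  then have "nat (max 1 (int 1 - k)) \<in> set_pmf (urn_chain \<kappa> z)"
    using k unfolding urn_chain_def noisy_step_def by (force simp del: exit_law.simps)
  moreover have "nat (max 1 (int 1 - k)) = 1" using k by simp
  ultimately show ?thesis by (simp add: pmf_positive_iff)
qed

lemma expectation_less_max:
  fixes f :: "'s \<Rightarrow> real"
  assumes f: "\<And>x. f x \<le> B" "\<And>x. \<bar>f x\<bar> \<le> C" and y: "y \<in> set_pmf p" "f y < B"
  shows "measure_pmf.expectation p f < B"
proof -
  have i: "integrable (measure_pmf p) (\<lambda>x. if x = y then B - f y else 0)"
    by (rule integrable_pmf_bounded[of _ "\<bar>B - f y\<bar>"]) auto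
  have "measure_pmf.expectation p f \<le> measure_pmf.expectation p (\<lambda>x. B - (if x = y then B - f y else 0))"
    using i f by (intro integral_mono integrable_pmf_bounded[OF f(2)]) auto
  also have "\<dots> = B - pmf p y * (B - f y)" using i by (simp add: expectation_indicator_point)
  also have "\<dots> < B" using y by (simp add: pmf_positive)
  finally show ?thesis .
qed

text \<open>\<open>F\<close> is the Lyapunov function cut off at its value in \<open>N\<close>. From
  \<open>N\<close> on the cut only lowers the mean; below \<open>N\<close> the cut function is at
  its maximum, and a jump beyond \<open>N\<close>, of positive probability, leads strictly down. So
  the decrease is strict in every state.\<close>

lemma urn_transient:
  assumes k4: "integrable (measure_pmf \<kappa>) (\<lambda>k. real_of_int k ^ 4)"
    and mean: "measure_pmf.expectation \<kappa> real_of_int < 1/3"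
    and chain: "mchain M (urn_chain \<kappa>) z0 Z"
  shows "transient M Z"
proof -
  obtain A N where A: "A \<ge> 1" "N \<ge> 1"
    "\<And>z. z \<ge> N \<Longrightarrow> measure_pmf.expectation (urn_chain \<kappa> z) (\<lambda>n. 1 / (A + ln (real n))) < 1 / (A + ln (real z))"
    using lyapunov_transient[OF k4 mean] by blast
  define f where "f z = 1 / (A + ln (real z))" for z
  define F where "F z = min (f N) (f z)" for z
  have ln0: "ln (real z) \<ge> 0" for z by (cases "z = 0") auto
  have f: "0 < f z" "f z \<le> 1" for z
    using A(1) ln0[of z] by (auto simp: f_def divide_le_eq add_pos_nonneg)
  have mono: "f z \<le> f w" if "w \<le> z" for w z
  proof -
    have "ln (real w) \<le> ln (real z)"
      using that ln0[of z] by (cases "w = 0") auto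
    then show ?thesis unfolding f_def using A(1) ln0[of w] by (intro divide_left_mono) (auto intro!: mult_pos_pos add_pos_nonneg)
  qed
  have strict: "f z < f N" if "z > N" for z
  proof -
    have "ln (real N) < ln (real z)" using that A(2) by (intro ln_less_cancel_iff[THEN iffD2]) auto
    then show ?thesis unfolding f_def using A(1) ln0[of N] by (intro divide_strict_left_mono) (auto intro!: mult_pos_pos add_pos_nonneg)
  qed
  show ?thesis
  proof (rule transient_criterion[OF chain])
    show F0: "0 \<le> F z" for z using f(1)[of z] f(1)[of N] by (simp add: F_def)
    show F1: "F z \<le> 1" for z using f(2)[of z] by (simp add: F_def)
    show "measure_pmf.expectation (urn_chain \<kappa> z) F < F z" for z
    proof (cases "z \<ge> N")
      case True
      have "measure_pmf.expectation (urn_chain \<kappa> z) F \<le> measure_pmf.expectation (urn_chain \<kappa> z) f"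
      proof (rule integral_mono)
        show "integrable (measure_pmf (urn_chain \<kappa> z)) F"
        proof (rule integrable_pmf_bounded)
          show "\<bar>F x\<bar> \<le> 1" for x using F0[of x] F1[of x] by simp
        qed
        show "integrable (measure_pmf (urn_chain \<kappa> z)) f"
          by (rule integrable_pmf_bounded[of _ 1]) (use f in \<open>simp add: less_imp_le\<close>)
      qed (simp add: F_def)
      also have "\<dots> < f z" using A(3)[OF True] by (simp add: f_def[abs_def])
      also have "f z = F z" using mono[OF True] by (simp add: F_def)
      finally show ?thesis .
    next
      case False
      obtain n where n: "n \<ge> Suc N" "n \<in> set_pmf (urn_chain \<kappa> z)" using urn_chain_unbounded by blast
      have "measure_pmf.expectation (urn_chain \<kappa> z) F < f N"
      proof (rule expectation_less_max[OF _ _ n(2)])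
        show "\<bar>F x\<bar> \<le> 1" for x using F0[of x] F1[of x] by simp
        show "F n < f N" using strict[of n] n(1) by (simp add: F_def)
      qed (simp add: F_def)
      also have "f N = F z" using mono[of z N] False by (simp add: F_def)
      finally show ?thesis .
    qed
  qed
qed

lemma urn_avoid_tendsto_0:
  assumes k4: "integrable (measure_pmf \<kappa>) (\<lambda>k. real_of_int k ^ 4)"
    and mean: "measure_pmf.expectation \<kappa> real_of_int \<ge> 1/3"
  shows "(\<lambda>n. avoid (urn_chain \<kappa>) 1 n z) \<longlonglongrightarrow> 0"
proof -
  obtain N where N: "N \<ge> 1" "\<And>z. z \<ge> N \<Longrightarrow>
      measure_pmf.expectation (urn_chain \<kappa> z) (\<lambda>n. ln (1 + ln (real n))) \<le> ln (1 + ln (real z))"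
    using lyapunov_recurrent[OF k4 mean] by blast
  have int: "integrable (measure_pmf (urn_chain \<kappa> z)) (\<lambda>n. ln (1 + ln (real n)))" for z
  proof -
    have "integrable (measure_pmf (urn_chain \<kappa> z)) (\<lambda>n. ln (1 + ln (real n)))" if "z \<ge> 1" for z
    proof (rule integrable_urn_chain[OF k4 that, where c=1])
      fix n :: nat assume n: "n \<ge> 1"
      then have "0 \<le> ln (real n)" "ln (real n) \<le> real n" by (auto intro!: order_trans[OF ln_le_minus_one])
      moreover from this have "ln (1 + ln (real n)) \<le> ln (real n)" by (intro ln_add_one_self_le_self) auto
      ultimately show "\<bar>ln (1 + ln (real n))\<bar> \<le> 1 * (1 + real n ^ 4)" using real_le_1_pow4[of n] by simp
    qed
    then show ?thesis using urn_chain_0[of \<kappa>] by (cases "z = 0") auto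
  qed
  show ?thesis
  proof (rule avoid_tendsto_0[where F="{..N}" and f="\<lambda>n. ln (1 + ln (real n))"])
    show "pmf (urn_chain \<kappa> z) 1 > 0" for z using mean by (intro pmf_urn_chain_1_pos) simp
    show "filterlim (\<lambda>n. ln (1 + ln (real n))) at_top sequentially" by real_asymp
    show "integrable (measure_pmf (urn_chain \<kappa> z)) (\<lambda>n. ln (1 + ln (real n)))" for z by (rule int)
    show "measure_pmf.expectation (urn_chain \<kappa> z) (\<lambda>n. ln (1 + ln (real n))) \<le> ln (1 + ln (real z))" if "z \<notin> {..N}" for z
      using that by (intro N(2)) auto
  qed (use N(1) in auto)
qed

text \<open>\<open>h\<close> and the kernel take the same values at \<open>0\<close> and at
  \<open>1\<close>, so the estimates for \<open>z \<ge> 1\<close> extend to \<open>0\<close>. The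
  drift at \<open>1\<close> is positive because arbitrarily large states, where
  \<open>h > 0\<close>, are reached from there in one step.\<close>

lemma urn_avoid_not_summable:
  assumes k4: "integrable (measure_pmf \<kappa>) (\<lambda>k. real_of_int k ^ 4)"
    and mean: "measure_pmf.expectation \<kappa> real_of_int \<le> 2/3"
  shows "\<not> summable (\<lambda>n. avoid (urn_chain \<kappa>) 1 n 1)"
proof -
  obtain h :: "nat \<Rightarrow> real" and C :: real and N :: nat where h: "h 0 = 0" "h 1 = 0" "\<And>z. 0 \<le> h z"
    "\<And>z. z \<ge> N \<Longrightarrow> h z > 0"
    "\<And>z. z \<ge> 1 \<Longrightarrow> integrable (measure_pmf (urn_chain \<kappa> z)) (\<lambda>n. (h n - h z)^2)"
    "\<And>z. z \<ge> 1 \<Longrightarrow> integrable (measure_pmf (urn_chain \<kappa> z)) h"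
    "\<And>z. z \<ge> 1 \<Longrightarrow> h z \<le> measure_pmf.expectation (urn_chain \<kappa> z) h"
    "\<And>z. z \<ge> 1 \<Longrightarrow> measure_pmf.expectation (urn_chain \<kappa> z) h \<le> h z + C"
    "\<And>z. z \<ge> 1 \<Longrightarrow> measure_pmf.expectation (urn_chain \<kappa> z) (\<lambda>n. (h n - h z)^2) \<le> C * (1 + h z)"
    by (fact lyapunov_null[OF k4 mean])
  have *: "urn_chain \<kappa> z = urn_chain \<kappa> (max 1 z)" "h z = h (max 1 z)" for z
    using urn_chain_0[of \<kappa>] h(1,2) by (cases "z = 0"; simp add: max_def)+
  have m: "max 1 z \<ge> 1" for z :: nat by simp
  show ?thesis
  proof (rule avoid_not_summable[where h=h and C=C])
    fix z
    show "integrable (measure_pmf (urn_chain \<kappa> z)) h" using h(6)[OF m] *(1)[of z] by simp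
    show "integrable (measure_pmf (urn_chain \<kappa> z)) (\<lambda>w. (h w - h z)^2)" using h(5)[OF m, of z] *[of z] by simp
    show "h z \<le> measure_pmf.expectation (urn_chain \<kappa> z) h" using h(7)[OF m, of z] *[of z] by simp
    show "measure_pmf.expectation (urn_chain \<kappa> z) h \<le> h z + C" using h(8)[OF m, of z] *[of z] by simp
    show "measure_pmf.expectation (urn_chain \<kappa> z) (\<lambda>w. (h w - h z)^2) \<le> C * (1 + h z)"
      using h(9)[OF m, of z] *[of z] by simp
  next
    obtain n where n: "n \<ge> N" "n \<in> set_pmf (urn_chain \<kappa> 1)" using urn_chain_unbounded by blast
    have "0 < pmf (urn_chain \<kappa> 1) n * h n" using h(4)[OF n(1)] n(2) by (simp add: pmf_positive)
    also have "\<dots> = measure_pmf.expectation (urn_chain \<kappa> 1) (\<lambda>w. if w = n then h n else 0)"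
      by (simp add: expectation_indicator_point)
    also have "\<dots> \<le> measure_pmf.expectation (urn_chain \<kappa> 1) h"
      using h(3) by (intro integral_mono h(6) integrable_pmf_bounded[of _ "h n"]) auto
    finally show "0 < measure_pmf.expectation (urn_chain \<kappa> 1) h" .
  qed (use h in auto)
qed

lemma urn_avoid_summable:
  assumes k4: "integrable (measure_pmf \<kappa>) (\<lambda>k. real_of_int k ^ 4)"
    and mean: "measure_pmf.expectation \<kappa> real_of_int > 2/3"
  shows "summable (\<lambda>n. avoid (urn_chain \<kappa>) 1 n z)"
proof -
  obtain c N where c: "c > 0"
    "\<And>z. z \<ge> N \<Longrightarrow> measure_pmf.expectation (urn_chain \<kappa> z) real \<le> real z - c"
    using lyapunov_positive[OF k4 mean] by blast
  show ?thesis
  proof (rule avoid_summable[where F="{..<N}" and f=real and d=c])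
    show "pmf (urn_chain \<kappa> z) 1 > 0" for z using mean by (intro pmf_urn_chain_1_pos) simp
    have "integrable (measure_pmf (urn_chain \<kappa> z)) real" if "z \<ge> 1" for z
      by (rule integrable_urn_chain[OF k4 that, where c=1]) (simp add: real_le_1_pow4)
    then show "integrable (measure_pmf (urn_chain \<kappa> z)) real" for z
      using urn_chain_0[of \<kappa>] by (cases "z = 0") auto
    show "measure_pmf.expectation (urn_chain \<kappa> z) real \<le> real z - c" if "z \<notin> {..<N}" for z
      using that by (intro c(2)) auto
  qed (use c in auto)
qed

theorem theorem2p4:
  fixes \<kappa> :: "int pmf" and z0 :: nat
    and M :: "'a measure" and S :: "nat \<Rightarrow> 'a \<Rightarrow> int \<times> int"
  assumes exp_moment:
      "\<exists>r::real. r > 0 \<and> integrable (measure_pmf \<kappa>) (\<lambda>k. exp (r * \<bar>real_of_int k\<bar>))"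
    and "z0 \<ge> 1"
    and "noisy_urn M \<kappa> z0 S"
  shows "(measure_pmf.expectation \<kappa> real_of_int < 1/3 \<longrightarrow>
            transient M (embedded_process S)) \<and>
         (1/3 \<le> measure_pmf.expectation \<kappa> real_of_int \<and>
          measure_pmf.expectation \<kappa> real_of_int \<le> 2/3 \<longrightarrow>
            null_recurrent M (embedded_process S)) \<and>
         (measure_pmf.expectation \<kappa> real_of_int > 2/3 \<longrightarrow>
            positive_recurrent M (embedded_process S))"
proof -
  have k4: "integrable (measure_pmf \<kappa>) (\<lambda>k. real_of_int k ^ 4)"
    using exp_moment integrable_pow4_of_exp by blast
  have chain: "mchain M (urn_chain \<kappa>) z0 (embedded_process S)"
    using assms(3,2) by (rule embedded_process_chain)
  show ?thesis
    using urn_transient[OF k4 _ chain]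
      null_recurrent_criterion[OF chain urn_avoid_tendsto_0[OF k4] urn_avoid_not_summable[OF k4]]
      positive_recurrent_criterion[OF chain urn_avoid_summable[OF k4]]
    by blast
qed

end
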